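(* Let $N\in\mathbb N$, $N\ge 1$, let $E,\epsilon,\eta>0$ with $\eta^2\le E\epsilon$, and let $0\le\sigma_+<\sigma_-$. For each $n=1,2,\ldots,N$, the closure of the operator $L_{\sigma,n}\!\upharpoonright_{\mathscr D}$ (in the real Banach space $V$ of self-adjoint trace-class operators on $\mathscr H$ with trace norm) is the generator of a trace-preserving strongly continuous contraction semigroup on $V$.
   Context: Setting. $\mathscr F$ is the one-mode boson Fock space with vacuum $\Omega$ and annihilation/creation operators $a,a^*$, $[a,a^*]=\mathbb 1$. $\mathscr H=\mathscr F^{\otimes(N+1)}$ (factors numbered $0,\ldots,N$), and $b_k,b_k^*$ act as $a,a^*$ on the factor number $k$ and as identity on the others, so $[b_k,b_{k'}^*]=\delta_{kk'}\mathbb 1$. $\mathcal D_0=\bigcap_{k=0}^N\mathrm{dom}(b_k^*b_k)$; $\hat n=\sum_{k=0}^N b_k^*b_k$ is the (non-negative self-adjoint) number operator with domain $\mathcal D_0$. For $n=1,\ldots,N$, on the domain $\mathcal D_0$, $$H_n=E\,b_0^*b_0+\epsilon\sum_{k=1}^N b_k^*b_k+\eta(b_0^*b_n+b_n^*b_0),\qquad K_n=\tfrac{\sigma_+}{2}b_0b_0^*+\tfrac{\sigma_-}{2}b_0^*b_0+iH_n .$$ The operators $K_n(\mathbb 1+\hat n)^{-1}$, $b_0(\mathbb 1+\hat n)^{-1}$, $b_0^*(\mathbb 1+\hat n)^{-1}$ are bounded. $\mathfrak C_1(\mathscr H)$ is the Banach space of trace-class operators with the trace norm, and $V\subset\mathfrak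 C_1(\mathscr H)$ is the real Banach subspace of self-adjoint elements. Put $\widetilde{\mathscr D}=\{(\mathbb 1+\hat n)^{-1}\rho(\mathbb 1+\hat n)^{-1}:\rho\in\mathfrak C_1(\mathscr H)\}$ and $\mathscr D=\widetilde{\mathscr D}\cap V=(\mathbb 1+\hat n)^{-1}V(\mathbb 1+\hat n)^{-1}$. The operator $L_{\sigma,n}$, formally $L_{\sigma,n}(\rho)=-K_n\rho-\rho K_n^*+\sigma_-b_0\rho b_0^*+\sigma_+b_0^*\rho b_0$, is defined on $\widetilde{\mathscr D}$ by $$\begin{aligned}L_{\sigma,n}\big((\mathbb 1+\hat n)^{-1}\rho(\mathbb 1+\hat n)^{-1}\big)=&-K_n(\mathbb 1+\hat n)^{-1}\rho(\mathbb 1+\hat n)^{-1}-(\mathbb 1+\hat n)^{-1}\rho\,(K_n(\mathbb 1+\hat n)^{-1})^*\\&+\sigma_-b_0(\mathbb 1+\hat n)^{-1}\rho\,(b_0(\mathbb 1+\hat n)^{-1})^*+\sigma_+b_0^*(\mathbb 1+\hat n)^{-1}\rho\,(b_0^*(\mathbb 1+\hat n)^{-1})^*\end{aligned}$$ for $\rho\in\mathfrak C_1(\mathscr H)$. A semigroup $\{T_t\}_{t\ge0}$ on $V$ is trace-preserving if $\mathrm{Tr}\,T_t(\rho)=\mathrm{Tr}\,\rho$ for all $\rho\in V$, $t\ge0$. *)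

theory Defs
  imports "HOL-Analysis.Analysis"
begin

section \<open>The complex Hilbert space of square-summable families\<close>

definition square_summable :: "('a \<Rightarrow> complex) \<Rightarrow> bool" where
  "square_summable f \<longleftrightarrow> (\<lambda>x. (cmod (f x))\<^sup>2) summable_on UNIV"

lemma square_summable_product:
  assumes "square_summable f" "square_summable g"
  shows "(\<lambda>x. cnj (f x) * g x) summable_on UNIV"
proof -
  have "(\<lambda>x. norm (cnj (f x) * g x)) summable_on UNIV"
    using assms unfolding square_summable_def
    by - (rule abs_summable_product, simp_all add: norm_mult power2_eq_square)
  then show ?thesis by (rule abs_summable_summable)
qed

lemma square_summable_zero: "square_summable (\<lambda>x. 0)"
  by (simp add: square_summable_def)

lemma square_summable_scale:
  assumes "square_summable f" shows "square_summable (\<lambda>x. c * f x)"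
  using assms unfolding square_summable_def
  by (simp add: norm_mult power_mult_distrib summable_on_cmult_right)

lemma square_summable_add:
  assumes "square_summable f" "square_summable g"
  shows "square_summable (\<lambda>x. f x + g x)"
proof -
  have s: "(\<lambda>x. 2 * (cmod (f x))\<^sup>2 + 2 * (cmod (g x))\<^sup>2) summable_on UNIV"
    using assms unfolding square_summable_def
    by (intro summable_on_add summable_on_cmult_right)
  have "(cmod (a + b))\<^sup>2 \<le> 2 * (cmod a)\<^sup>2 + 2 * (cmod b)\<^sup>2" for a b
  proof -
    have "(cmod (a + b))\<^sup>2 \<le> (cmod a + cmod b)\<^sup>2"
      by (intro power_mono norm_triangle_ineq) auto
    also have "\<dots> \<le> 2 * (cmod a)\<^sup>2 + 2 * (cmod b)\<^sup>2"
      using sum_squares_bound[of "cmod a" "cmod b"] by (simp add: power2_sum)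
    finally show ?thesis .
  qed
  then show ?thesis
    unfolding square_summable_def by (rule summable_on_comparison_test[OF s]) simp
qed

lemma square_summable_finite:
  assumes "finite {x. f x \<noteq> 0}" shows "square_summable f"
  unfolding square_summable_def
  by (rule finite_nonzero_values_imp_summable_on) (use assms in auto)

typedef 'a ell2 = "{f :: 'a \<Rightarrow> complex. square_summable f}"
  morphisms coeff Abs_ell2
  using square_summable_zero by blast

setup_lifting type_definition_ell2

lemma square_summable_coeff: "square_summable (coeff \<psi>)"
  using coeff by blast

lift_definition basis_vec :: "'a \<Rightarrow> 'a ell2" is "\<lambda>x y. if x = y then 1 else 0"
  by (rule square_summable_finite) auto

lift_definition scaleC :: "complex \<Rightarrow> 'a ell2 \<Rightarrow> 'a ell2" (infixr \<open>*\<^sub>C\<close> 75)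
  is "\<lambda>c f x. c * f x"
  by (rule square_summable_scale)

text \<open>Conjugate linear in the first argument.\<close>

lift_definition cinner :: "'a ell2 \<Rightarrow> 'a ell2 \<Rightarrow> complex"
  is "\<lambda>f g. \<Sum>\<^sub>\<infinity>x. cnj (f x) * g x" .

lemma Re_cinner_self: "Re (cinner \<psi> \<psi>) = (\<Sum>\<^sub>\<infinity>x. (cmod (coeff \<psi> x))\<^sup>2)"
proof -
  have "Re (cnj z * z) = (cmod z)\<^sup>2" for z
    by (simp only: cmod_power2) (simp add: power2_eq_square)
  then show ?thesis
    using infsum_Re[OF square_summable_product[OF square_summable_coeff square_summable_coeff], of \<psi> \<psi>]
    by (simp only: cinner.rep_eq)
qed

instantiation ell2 :: (type) real_inner
begin

lift_definition zero_ell2 :: "'a ell2" is "\<lambda>x. 0"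
  by (rule square_summable_zero)

lift_definition plus_ell2 :: "'a ell2 \<Rightarrow> 'a ell2 \<Rightarrow> 'a ell2" is "\<lambda>f g x. f x + g x"
  by (rule square_summable_add)

lift_definition uminus_ell2 :: "'a ell2 \<Rightarrow> 'a ell2" is "\<lambda>f x. - f x"
  by (simp add: square_summable_def)

lift_definition minus_ell2 :: "'a ell2 \<Rightarrow> 'a ell2 \<Rightarrow> 'a ell2" is "\<lambda>f g x. f x - g x"
  using square_summable_add[OF _ square_summable_scale[where c = "-1"]] by simp

lift_definition scaleR_ell2 :: "real \<Rightarrow> 'a ell2 \<Rightarrow> 'a ell2" is "\<lambda>r f x. complex_of_real r * f x"
  by (rule square_summable_scale)

definition inner_ell2 :: "'a ell2 \<Rightarrow> 'a ell2 \<Rightarrow> real" where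
  "inner_ell2 \<phi> \<psi> = Re (cinner \<phi> \<psi>)"

definition norm_ell2 :: "'a ell2 \<Rightarrow> real" where
  "norm_ell2 \<psi> = sqrt (Re (cinner \<psi> \<psi>))"

definition sgn_ell2 :: "'a ell2 \<Rightarrow> 'a ell2" where
  "sgn_ell2 \<psi> = inverse (norm \<psi>) *\<^sub>R \<psi>"

definition dist_ell2 :: "'a ell2 \<Rightarrow> 'a ell2 \<Rightarrow> real" where
  "dist_ell2 \<phi> \<psi> = norm (\<phi> - \<psi>)"

definition uniformity_ell2 :: "('a ell2 \<times> 'a ell2) filter" where
  "uniformity_ell2 = (INF e\<in>{0<..}. principal {(x, y). dist x y < e})"

definition open_ell2 :: "'a ell2 set \<Rightarrow> bool" where
  "open_ell2 U \<longleftrightarrow> (\<forall>x\<in>U. \<forall>\<^sub>F (x', y) in uniformity. x' = x \<longrightarrow> y \<in> U)"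

instance
proof
  fix a b c :: "'a ell2" and r s :: real
  show "a + b + c = a + (b + c)" "a + b = b + a" "0 + a = a" "- a + a = 0" "a - b = a + - b"
    by (transfer; simp add: algebra_simps)+
  show "r *\<^sub>R (a + b) = r *\<^sub>R a + r *\<^sub>R b" "(r + s) *\<^sub>R a = r *\<^sub>R a + s *\<^sub>R a"
    "r *\<^sub>R s *\<^sub>R a = (r * s) *\<^sub>R a" "1 *\<^sub>R a = a"
    by (transfer; simp add: algebra_simps)+
  show "sgn a = inverse (norm a) *\<^sub>R a" by (rule sgn_ell2_def)
  show "dist a b = norm (a - b)" by (rule dist_ell2_def)
  show "uniformity = (INF e\<in>{0<..}. principal {(x :: 'a ell2, y). dist x y < e})"
    by (rule uniformity_ell2_def)
  show "open U = (\<forall>x\<in>U. \<forall>\<^sub>F (x', y) in uniformity. x' = x \<longrightarrow> y \<in> U)" for U :: "'a ell2 set"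
    by (rule open_ell2_def)
  have "cinner a b = cnj (cinner b a)"
    by transfer (simp flip: infsum_cnj add: mult.commute)
  then show "a \<bullet> b = b \<bullet> a" by (simp add: inner_ell2_def)
  have "cinner (a + b) c = cinner a c + cinner b c"
    by transfer (simp add: distrib_right infsum_add square_summable_product)
  then show "(a + b) \<bullet> c = a \<bullet> c + b \<bullet> c" by (simp add: inner_ell2_def)
  have "cinner (r *\<^sub>R a) b = of_real r * cinner a b"
    by transfer (simp add: mult.assoc infsum_cmult_right')
  then show "(r *\<^sub>R a) \<bullet> b = r * (a \<bullet> b)" by (simp add: inner_ell2_def)
  have sq: "a \<bullet> a = (\<Sum>\<^sub>\<infinity>x. (cmod (coeff a x))\<^sup>2)"
    unfolding inner_ell2_def by (rule Re_cinner_self)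
  show "0 \<le> a \<bullet> a" unfolding sq by (rule infsum_nonneg) simp
  show "a \<bullet> a = 0 \<longleftrightarrow> a = 0"
  proof
    assume "a \<bullet> a = 0"
    then have "(cmod (coeff a x))\<^sup>2 = 0" for x
      unfolding sq
      by (intro nonneg_infsum_le_0D[where f = "\<lambda>x. (cmod (coeff a x))\<^sup>2" and A = UNIV])
        (use square_summable_coeff[of a] in \<open>auto simp: square_summable_def\<close>)
    then show "a = 0" by transfer auto
  next
    assume "a = 0"
    then show "a \<bullet> a = 0" unfolding sq by (simp add: zero_ell2.rep_eq)
  qed
  show "norm a = sqrt (a \<bullet> a)" by (simp add: norm_ell2_def inner_ell2_def)
qed

end

lemma norm_ell2_sq: "(norm \<psi>)\<^sup>2 = (\<Sum>\<^sub>\<infinity>x. (cmod (coeff \<psi> x))\<^sup>2)" for \<psi> :: "'a ell2"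
proof -
  have "(norm \<psi>)\<^sup>2 = Re (cinner \<psi> \<psi>)"
    unfolding power2_norm_eq_inner inner_ell2_def ..
  also have "\<dots> = (\<Sum>\<^sub>\<infinity>x. (cmod (coeff \<psi> x))\<^sup>2)"
    by (rule Re_cinner_self)
  finally show ?thesis .
qed

lemma sum_coeff_le_norm:
  fixes \<psi> :: "'a ell2"
  assumes "finite F" shows "(\<Sum>x\<in>F. (cmod (coeff \<psi> x))\<^sup>2) \<le> (norm \<psi>)\<^sup>2"
  unfolding norm_ell2_sq
  using square_summable_coeff[of \<psi>, unfolded square_summable_def] assms
  by (rule finite_sum_le_infsum) simp_all

lemma norm_coeff_le: "cmod (coeff \<psi> x) \<le> norm \<psi>"
  using sum_coeff_le_norm[of "{x}" \<psi>] by (intro power2_le_imp_le[OF _ norm_ge_zero]) simp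

lemma square_summable_bounded:
  assumes "\<And>F. finite F \<Longrightarrow> (\<Sum>x\<in>F. (cmod (f x))\<^sup>2) \<le> C"
  shows "square_summable f"
  unfolding square_summable_def
proof (rule nonneg_bdd_above_summable_on)
  show "bdd_above (sum (\<lambda>x. (cmod (f x))\<^sup>2) ` {F. F \<subseteq> UNIV \<and> finite F})"
    by (rule bdd_aboveI2[where M = C]) (simp add: assms)
qed simp

instance ell2 :: (type) complete_space
proof
  fix X :: "nat \<Rightarrow> 'a ell2"
  assume X: "Cauchy X"
  have "Cauchy (\<lambda>j. coeff (X j) x)" for x
  proof (rule metric_CauchyI)
    fix e :: real assume "e > 0"
    with X obtain M where M: "\<forall>m\<ge>M. \<forall>n\<ge>M. dist (X m) (X n) < e"
      unfolding Cauchy_def by blast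
    have "dist (coeff (X m) x) (coeff (X n) x) < e" if "m \<ge> M" "n \<ge> M" for m n
    proof -
      have "dist (coeff (X m) x) (coeff (X n) x) \<le> dist (X m) (X n)"
        using norm_coeff_le[of "X m - X n" x] by (simp add: dist_norm minus_ell2.rep_eq)
      also have "\<dots> < e" using M that by blast
      finally show ?thesis .
    qed
    then show "\<exists>M. \<forall>m\<ge>M. \<forall>n\<ge>M. dist (coeff (X m) x) (coeff (X n) x) < e" by blast
  qed
  then have "\<exists>l. (\<lambda>j. coeff (X j) x) \<longlonglongrightarrow> l" for x
    using Cauchy_convergent convergent_def by blast
  then obtain f where f: "\<And>x. (\<lambda>j. coeff (X j) x) \<longlonglongrightarrow> f x" by metis
  have est: "\<exists>M. \<forall>n\<ge>M. \<forall>F. finite F \<longrightarrow> (\<Sum>x\<in>F. (cmod (f x - coeff (X n) x))\<^sup>2) \<le> e\<^sup>2"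
    if "e > 0" for e :: real
  proof -
    obtain M where M: "\<forall>m\<ge>M. \<forall>n\<ge>M. dist (X m) (X n) < e"
      using X \<open>e > 0\<close> unfolding Cauchy_def by blast
    have "(\<Sum>x\<in>F. (cmod (f x - coeff (X n) x))\<^sup>2) \<le> e\<^sup>2" if "n \<ge> M" "finite F" for n F
    proof (rule tendsto_upperbound)
      show "(\<lambda>m. \<Sum>x\<in>F. (cmod (coeff (X m) x - coeff (X n) x))\<^sup>2)
          \<longlonglongrightarrow> (\<Sum>x\<in>F. (cmod (f x - coeff (X n) x))\<^sup>2)"
        by (intro tendsto_intros f)
      have "(\<Sum>x\<in>F. (cmod (coeff (X m) x - coeff (X n) x))\<^sup>2) \<le> e\<^sup>2" if "m \<ge> M" for m
      proof -
        have "(\<Sum>x\<in>F. (cmod (coeff (X m) x - coeff (X n) x))\<^sup>2) \<le> (norm (X m - X n))\<^sup>2"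
          using sum_coeff_le_norm[OF \<open>finite F\<close>, of "X m - X n"] by (simp add: minus_ell2.rep_eq)
        also have "\<dots> \<le> e\<^sup>2"
          using M \<open>n \<ge> M\<close> that by (intro power_mono) (auto simp: dist_norm less_imp_le)
        finally show ?thesis .
      qed
      then show "\<forall>\<^sub>F m in sequentially. (\<Sum>x\<in>F. (cmod (coeff (X m) x - coeff (X n) x))\<^sup>2) \<le> e\<^sup>2"
        by (auto simp: eventually_sequentially)
    qed simp
    then show ?thesis by blast
  qed
  obtain M where "\<forall>n\<ge>M. \<forall>F. finite F \<longrightarrow> (\<Sum>x\<in>F. (cmod (f x - coeff (X n) x))\<^sup>2) \<le> 1\<^sup>2"
    using est[of 1] by auto
  then have "square_summable (\<lambda>x. f x - coeff (X M) x)"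
    by (intro square_summable_bounded[where C = "1\<^sup>2"]) auto
  from square_summable_add[OF this square_summable_coeff[of "X M"]]
  have f2: "square_summable f" by simp
  have "X \<longlonglongrightarrow> Abs_ell2 f"
  proof (rule metric_LIMSEQ_I)
    fix e :: real assume "e > 0"
    then obtain M where M:
      "\<forall>n\<ge>M. \<forall>F. finite F \<longrightarrow> (\<Sum>x\<in>F. (cmod (f x - coeff (X n) x))\<^sup>2) \<le> (e/2)\<^sup>2"
      using est[of "e/2"] by auto
    have "dist (X n) (Abs_ell2 f) < e" if "n \<ge> M" for n
    proof -
      have c: "coeff (Abs_ell2 f - X n) x = f x - coeff (X n) x" for x
        using f2 by (simp add: minus_ell2.rep_eq Abs_ell2_inverse)
      have "(norm (Abs_ell2 f - X n))\<^sup>2 \<le> (e/2)\<^sup>2"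
        unfolding norm_ell2_sq
        by (rule infsum_le_finite_sums)
          (use M that square_summable_coeff[of "Abs_ell2 f - X n"] in
            \<open>auto simp: c square_summable_def\<close>)
      then have "norm (Abs_ell2 f - X n) \<le> e/2"
        using \<open>e > 0\<close> by - (rule power2_le_imp_le, simp_all)
      then show ?thesis using \<open>e > 0\<close> by (simp add: dist_norm norm_minus_commute)
    qed
    then show "\<exists>M. \<forall>n\<ge>M. dist (X n) (Abs_ell2 f) < e" by blast
  qed
  then show "convergent X" by (auto simp: convergent_def)
qed


section \<open>Trace-class operators\<close>

text \<open>
  Bounded operators are elements of \<^typ>\<open>'a ell2 \<Rightarrow>\<^sub>L 'a ell2\<close>.  That type only expresses
  real linearity, so complex linearity is carried by a predicate.
\<close>

type_synonym 'a op = "'a ell2 \<Rightarrow>\<^sub>L 'a ell2"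

definition clinear_op :: "'a op \<Rightarrow> bool" where
  "clinear_op A \<longleftrightarrow> (\<forall>c \<psi>. A (c *\<^sub>C \<psi>) = c *\<^sub>C A \<psi>)"

definition adj :: "'a op \<Rightarrow> 'a op" where
  "adj A = (THE B :: 'a op. \<forall>\<phi> \<psi>. cinner (A \<phi>) \<psi> = cinner \<phi> (B \<psi>))"

definition selfadjoint :: "'a op \<Rightarrow> bool" where
  "selfadjoint A \<longleftrightarrow> clinear_op A \<and> (\<forall>\<phi> \<psi>. cinner (A \<phi>) \<psi> = cinner \<phi> (A \<psi>))"

definition positive_op :: "'a op \<Rightarrow> bool" where
  "positive_op A \<longleftrightarrow> clinear_op A \<and> (\<forall>\<psi>. cinner \<psi> (A \<psi>) \<in> \<real> \<and> 0 \<le> Re (cinner \<psi> (A \<psi>)))"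

text \<open>The modulus of \<open>A\<close> is the unique positive square root of \<open>A\<^sup>* A\<close>.\<close>

definition abs_op :: "'a op \<Rightarrow> 'a op" where
  "abs_op A = (THE B. positive_op B \<and> B o\<^sub>L B = adj A o\<^sub>L A)"

definition trace_class :: "'a op set" where
  "trace_class = {A. clinear_op A \<and>
     (\<lambda>x. cinner (basis_vec x) (abs_op A (basis_vec x))) summable_on UNIV}"

definition op_trace :: "'a op \<Rightarrow> complex" where
  "op_trace A = (\<Sum>\<^sub>\<infinity>x. cinner (basis_vec x) (A (basis_vec x)))"

definition trace_norm :: "'a op \<Rightarrow> real" where
  "trace_norm A = Re (op_trace (abs_op A))"

definition sa_trace_class :: "'a op set" where
  "sa_trace_class = {A \<in> trace_class. selfadjoint A}"


section \<open>Contraction semigroups and their generators\<close>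

text \<open>
  The Banach space is given by a carrier \<open>V\<close> inside an ambient real vector space together
  with a norm \<open>nrm\<close> on \<open>V\<close>, because the trace norm is not the norm of the ambient type of
  bounded operators.  Partially defined operators in \<open>V\<close> are identified with their graphs.
\<close>

definition contraction_semigroup ::
    "'v::real_vector set \<Rightarrow> ('v \<Rightarrow> real) \<Rightarrow> (real \<Rightarrow> 'v \<Rightarrow> 'v) \<Rightarrow> bool" where
  "contraction_semigroup V nrm T \<longleftrightarrow>
     (\<forall>t\<ge>0. \<forall>x\<in>V. T t x \<in> V) \<and>
     (\<forall>t\<ge>0. \<forall>x\<in>V. \<forall>y\<in>V. T t (x + y) = T t x + T t y) \<and>
     (\<forall>t\<ge>0. \<forall>r. \<forall>x\<in>V. T t (r *\<^sub>R x) = r *\<^sub>R T t x) \<and>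
     (\<forall>x\<in>V. T 0 x = x) \<and>
     (\<forall>s\<ge>0. \<forall>t\<ge>0. \<forall>x\<in>V. T (s + t) x = T s (T t x)) \<and>
     (\<forall>t\<ge>0. \<forall>x\<in>V. nrm (T t x) \<le> nrm x) \<and>
     (\<forall>x\<in>V. \<forall>t\<ge>0. ((\<lambda>s. nrm (T s x - T t x)) \<longlongrightarrow> 0) (at t within {0..}))"

definition generator ::
    "'v::real_vector set \<Rightarrow> ('v \<Rightarrow> real) \<Rightarrow> (real \<Rightarrow> 'v \<Rightarrow> 'v) \<Rightarrow> ('v \<times> 'v) set" where
  "generator V nrm T =
     {(x, y). x \<in> V \<and> y \<in> V \<and> ((\<lambda>t. nrm ((1 / t) *\<^sub>R (T t x - x) - y)) \<longlongrightarrow> 0) (at_right 0)}"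

definition graph_closure ::
    "'v::real_vector set \<Rightarrow> ('v \<Rightarrow> real) \<Rightarrow> ('v \<times> 'v) set \<Rightarrow> ('v \<times> 'v) set" where
  "graph_closure V nrm G =
     {(x, y). x \<in> V \<and> y \<in> V \<and>
        (\<exists>u v. (\<forall>j::nat. (u j, v j) \<in> G) \<and>
           (\<lambda>j. nrm (u j - x)) \<longlonglongrightarrow> 0 \<and> (\<lambda>j. nrm (v j - y)) \<longlonglongrightarrow> 0)}"

definition trace_preserving :: "'a op set \<Rightarrow> (real \<Rightarrow> 'a op \<Rightarrow> 'a op) \<Rightarrow> bool" where
  "trace_preserving V T \<longleftrightarrow> (\<forall>t\<ge>0. \<forall>\<rho>\<in>V. op_trace (T t \<rho>) = op_trace \<rho>)"


section \<open>Boson modes\<close>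

text \<open>
  A multi-index \<open>m :: 'k \<Rightarrow> nat\<close> lists the occupation numbers of the modes \<open>k :: 'k\<close>.  The
  one-mode Fock space is \<open>\<ell>\<^sup>2(\<nat>)\<close> with vacuum \<open>e\<^sub>0\<close> and \<open>a e\<^sub>j = sqrt j e\<^sub>j\<^sub>-\<^sub>1\<close>,
  \<open>a\<^sup>* e\<^sub>j = sqrt (j + 1) e\<^sub>j\<^sub>+\<^sub>1\<close>; its Hilbert space tensor power over a finite set of modes
  is \<open>\<ell>\<^sup>2\<close> over the multi-indices, with \<^term>\<open>basis_vec m\<close> the tensor product of the
  \<open>e\<^bsub>m k\<^esub>\<close>.  The two functions below are the resulting actions on coefficients in factor \<open>k\<close>.
\<close>

type_synonym 'k fock = "('k \<Rightarrow> nat) ell2"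

definition annih_coeff :: "'k \<Rightarrow> (('k \<Rightarrow> nat) \<Rightarrow> complex) \<Rightarrow> ('k \<Rightarrow> nat) \<Rightarrow> complex" where
  "annih_coeff k f m = complex_of_real (sqrt (real (m k + 1))) * f (m(k := m k + 1))"

definition create_coeff :: "'k \<Rightarrow> (('k \<Rightarrow> nat) \<Rightarrow> complex) \<Rightarrow> ('k \<Rightarrow> nat) \<Rightarrow> complex" where
  "create_coeff k f m = complex_of_real (sqrt (real (m k))) * f (m(k := m k - 1))"

definition dom_b :: "'k \<Rightarrow> 'k fock set" where
  "dom_b k = {\<psi>. square_summable (annih_coeff k (coeff \<psi>))}"

definition dom_bdag :: "'k \<Rightarrow> 'k fock set" where
  "dom_bdag k = {\<psi>. square_summable (create_coeff k (coeff \<psi>))}"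

text \<open>These are meaningful only on \<^term>\<open>dom_b k\<close> and \<^term>\<open>dom_bdag k\<close>, respectively.\<close>

definition b_op :: "'k \<Rightarrow> 'k fock \<Rightarrow> 'k fock" where
  "b_op k \<psi> = Abs_ell2 (annih_coeff k (coeff \<psi>))"

definition bdag_op :: "'k \<Rightarrow> 'k fock \<Rightarrow> 'k fock" where
  "bdag_op k \<psi> = Abs_ell2 (create_coeff k (coeff \<psi>))"

definition D0 :: "'k::finite fock set" where
  "D0 = (\<Inter>k. {\<psi> \<in> dom_b k. b_op k \<psi> \<in> dom_bdag k})"

definition number_op :: "'k::finite fock \<Rightarrow> 'k fock" where
  "number_op \<psi> = (\<Sum>k\<in>UNIV. bdag_op k (b_op k \<psi>))"

definition number_resolvent :: "'k::finite fock \<Rightarrow> 'k fock" where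
  "number_resolvent = inv_into D0 (\<lambda>\<psi>. \<psi> + number_op \<psi>)"

definition R_op :: "('k::finite \<Rightarrow> nat) op" where
  "R_op = Blinfun number_resolvent"

text \<open>The bounded operator \<open>X (1 + n)\<^sup>-\<^sup>1\<close>, for \<open>X\<close> defined on \<^term>\<open>D0\<close>.\<close>

definition resolvent_product :: "('k::finite fock \<Rightarrow> 'k fock) \<Rightarrow> ('k \<Rightarrow> nat) op" where
  "resolvent_product X = Blinfun (\<lambda>\<psi>. X (number_resolvent \<psi>))"


section \<open>The model\<close>

text \<open>
  The \<open>N + 1\<close> factors are indexed by \<^typ>\<open>'n option\<close>, where the finite (hence nonempty)
  type \<^typ>\<open>'n\<close> has \<open>N\<close> elements: \<^const>\<open>None\<close> is factor 0, and the factors \<open>1, \<dots>, N\<close> are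
  \<^term>\<open>Some k\<close>.
\<close>

definition H_op :: "real \<Rightarrow> real \<Rightarrow> real \<Rightarrow> 'n::finite \<Rightarrow> 'n option fock \<Rightarrow> 'n option fock" where
  "H_op E \<epsilon> \<eta> n \<psi> =
     E *\<^sub>R bdag_op None (b_op None \<psi>) + \<epsilon> *\<^sub>R (\<Sum>k\<in>UNIV. bdag_op (Some k) (b_op (Some k) \<psi>))
     + \<eta> *\<^sub>R (bdag_op None (b_op (Some n) \<psi>) + bdag_op (Some n) (b_op None \<psi>))"

definition K_op ::
    "real \<Rightarrow> real \<Rightarrow> real \<Rightarrow> real \<Rightarrow> real \<Rightarrow> 'n::finite \<Rightarrow> 'n option fock \<Rightarrow> 'n option fock" where
  "K_op E \<epsilon> \<eta> \<sigma>p \<sigma>m n \<psi> =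
     (\<sigma>p / 2) *\<^sub>R b_op None (bdag_op None \<psi>) + (\<sigma>m / 2) *\<^sub>R bdag_op None (b_op None \<psi>)
     + \<i> *\<^sub>C H_op E \<epsilon> \<eta> n \<psi>"

text \<open>The value of \<open>L\<close> at \<open>(1 + n)\<^sup>-\<^sup>1 \<rho> (1 + n)\<^sup>-\<^sup>1\<close>.\<close>

definition L_value ::
    "real \<Rightarrow> real \<Rightarrow> real \<Rightarrow> real \<Rightarrow> real \<Rightarrow> 'n::finite \<Rightarrow> ('n option \<Rightarrow> nat) op \<Rightarrow> ('n option \<Rightarrow> nat) op"
  where
  "L_value E \<epsilon> \<eta> \<sigma>p \<sigma>m n \<rho> =
     (let R = R_op;
          KR = resolvent_product (K_op E \<epsilon> \<eta> \<sigma>p \<sigma>m n);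
          BR = resolvent_product (b_op None);
          BdR = resolvent_product (bdag_op None)
      in - (KR o\<^sub>L \<rho> o\<^sub>L R) - (R o\<^sub>L \<rho> o\<^sub>L adj KR)
         + \<sigma>m *\<^sub>R (BR o\<^sub>L \<rho> o\<^sub>L adj BR) + \<sigma>p *\<^sub>R (BdR o\<^sub>L \<rho> o\<^sub>L adj BdR))"

definition D_tilde :: "('k::finite \<Rightarrow> nat) op set" where
  "D_tilde = {R_op o\<^sub>L \<rho> o\<^sub>L R_op |\<rho>. \<rho> \<in> trace_class}"

definition D_sa :: "('k::finite \<Rightarrow> nat) op set" where
  "D_sa = D_tilde \<inter> sa_trace_class"

text \<open>The graph of \<open>L\<close>, with domain \<^term>\<open>D_tilde\<close>, and of its restriction to \<^term>\<open>D_sa\<close>.\<close>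

definition L_graph ::
    "real \<Rightarrow> real \<Rightarrow> real \<Rightarrow> real \<Rightarrow> real \<Rightarrow> 'n::finite \<Rightarrow>
      (('n option \<Rightarrow> nat) op \<times> ('n option \<Rightarrow> nat) op) set" where
  "L_graph E \<epsilon> \<eta> \<sigma>p \<sigma>m n =
     {(R_op o\<^sub>L \<rho> o\<^sub>L R_op, L_value E \<epsilon> \<eta> \<sigma>p \<sigma>m n \<rho>) |\<rho>. \<rho> \<in> trace_class}"

definition L_sa_graph ::
    "real \<Rightarrow> real \<Rightarrow> real \<Rightarrow> real \<Rightarrow> real \<Rightarrow> 'n::finite \<Rightarrow>
      (('n option \<Rightarrow> nat) op \<times> ('n option \<Rightarrow> nat) op) set" where
  "L_sa_graph E \<epsilon> \<eta> \<sigma>p \<sigma>m n = {(X, Y) \<in> L_graph E \<epsilon> \<eta> \<sigma>p \<sigma>m n. X \<in> D_sa}"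

end

theory Submission
  imports Defs
begin

text \<open>
  The semigroup comes from the Hille-Yosida theorem on the Banach space of self-adjoint trace-class
  operators.  On operators supported on total occupation number at most \<open>M\<close>, a finite-dimensional
  space, replace \<open>L\<close> by the compression \<open>G X = P (L X) P\<close>.  An approximate eigenvector argument shows
  that \<open>l X - G X \<ge> 0\<close> implies \<open>X \<ge> 0\<close> once \<open>l > \<sigma>\<^sub>-\<close>; hence \<open>l - G\<close> is bijective there, and
  as \<open>G\<close> does not increase the trace of positive operators, splitting into positive and negative parts
  gives \<open>l \<parallel>X\<parallel> \<le> \<parallel>l X - L X\<parallel>\<close>.  Since \<open>H\<^sub>n\<close> conserves the total number and the
  jump terms act on it as a linear birth-death process, the fourth moment of \<open>X = (l - G)\<^sup>-\<^sup>1 \<rho>\<close>,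
  \<open>\<rho> \<ge> 0\<close>, is bounded uniformly in \<open>M\<close> for \<open>l > 15 \<sigma>\<^sub>+\<close>.  Therefore \<open>L X - G X\<close>, which only
  involves jumps out of the top level, is of order \<open>1 / M\<close>, and the range of \<open>l - L\<close> is dense.
\<close>

section \<open>Inner product and adjoints\<close>

text \<open>The obstacle is density of the range of \<open>l - L\<close>: a formally
  trace-preserving generator may lose mass to infinite occupation numbers. It does not here, because
  pumping raises the total number by one at a rate that grows only linearly, so the weight
  \<open>(1 + deg m)^4\<close> grows at rate at most \<open>15 \<sigma>\<^sub>+\<close>, where
  \<open>15 = 2^4 - 1^4\<close>. The fourth power is \<open>(1 + n)\<^sup>2\<close> on each side of
  \<open>X\<close>: two resolvents per side leave the creation operator with norm of order
  \<open>1 / M\<close> on the way out of the top level. The threshold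
  \<open>\<sigma>\<^sub>-\<close> arises from applying the truncated generator to the identity,
  which yields at most \<open>\<sigma>\<^sub>-\<close>. Dissipativity holds for \<open>L\<close>
  itself and not only for \<open>G\<close>, since \<open>L\<close> raises the level by at most one:
  on level \<open>M\<close> it agrees with the \<open>G\<close> of level \<open>M + 1\<close>. Two
  encodings carry the analysis. The trace norm is defined through a modulus, so its triangle
  inequality and completeness are drawn from the dual bound \<open>nuc_bound\<close>. The
  self-adjoint trace-class operators become a type \<open>sa_tc\<close>, so that Hille-Yosida is
  proved for a type class of Banach spaces and transported back at the end.\<close>

instance ell2 :: (type) banach ..

lemma ell2_eqI: "\<phi> = \<psi>" if "\<And>x. coeff \<phi> x = coeff \<psi> x"
  using that by (simp add: coeff_inject[symmetric] ext)

lemmas coeff_simps = zero_ell2.rep_eq plus_ell2.rep_eq minus_ell2.rep_eq uminus_ell2.rep_eq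
  scaleR_ell2.rep_eq scaleC.rep_eq basis_vec.rep_eq

lemma coeff_sum: "coeff (\<Sum>i\<in>I. f i) x = (\<Sum>i\<in>I. coeff (f i) x)"
  by (induction I rule: infinite_finite_induct) (simp_all add: coeff_simps)

lemma scaleC_simps [simp]:
  "c *\<^sub>C (\<phi> + \<psi>) = c *\<^sub>C \<phi> + c *\<^sub>C \<psi>"
  "c *\<^sub>C (\<phi> - \<psi>) = c *\<^sub>C \<phi> - c *\<^sub>C \<psi>"
  "c *\<^sub>C (- \<phi>) = - (c *\<^sub>C \<phi>)"
  "c *\<^sub>C d *\<^sub>C \<phi> = (c * d) *\<^sub>C \<phi>"
  "c *\<^sub>C r *\<^sub>R \<phi> = r *\<^sub>R c *\<^sub>C \<phi>"
  "c *\<^sub>C 0 = 0" "0 *\<^sub>C \<phi> = 0" "1 *\<^sub>C \<phi> = \<phi>"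
  by (auto intro!: ell2_eqI simp: coeff_simps algebra_simps)

lemma scaleC_of_real: "complex_of_real r *\<^sub>C \<phi> = r *\<^sub>R \<phi>"
  by (auto intro!: ell2_eqI simp: coeff_simps algebra_simps)

lemma cinner_add_left: "cinner (\<phi> + \<xi>) \<psi> = cinner \<phi> \<psi> + cinner \<xi> \<psi>"
  by transfer (simp add: distrib_right infsum_add square_summable_product)

lemma cinner_add_right: "cinner \<phi> (\<psi> + \<xi>) = cinner \<phi> \<psi> + cinner \<phi> \<xi>"
  by transfer (simp add: distrib_left infsum_add square_summable_product)

lemma cinner_scaleC_left: "cinner (c *\<^sub>C \<phi>) \<psi> = cnj c * cinner \<phi> \<psi>"
  by transfer (simp add: mult.assoc infsum_cmult_right')

lemma cinner_scaleC_right: "cinner \<phi> (c *\<^sub>C \<psi>) = c * cinner \<phi> \<psi>"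
  by transfer (simp add: mult.left_commute infsum_cmult_right')

lemma cinner_scaleR_left: "cinner (r *\<^sub>R \<phi>) \<psi> = of_real r * cinner \<phi> \<psi>"
  using cinner_scaleC_left[of "of_real r"] by (simp add: scaleC_of_real)

lemma cinner_scaleR_right: "cinner \<phi> (r *\<^sub>R \<psi>) = of_real r * cinner \<phi> \<psi>"
  using cinner_scaleC_right[of _ "of_real r"] by (simp add: scaleC_of_real)

lemma cinner_minus_left: "cinner (- \<phi>) \<psi> = - cinner \<phi> \<psi>"
  using cinner_scaleR_left[of "-1"] by simp

lemma cinner_minus_right: "cinner \<phi> (- \<psi>) = - cinner \<phi> \<psi>"
  using cinner_scaleR_right[of _ "-1"] by simp

lemma cinner_diff_left: "cinner (\<phi> - \<xi>) \<psi> = cinner \<phi> \<psi> - cinner \<xi> \<psi>"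
  using cinner_add_left[of \<phi> "- \<xi>"] by (simp add: cinner_minus_left)

lemma cinner_diff_right: "cinner \<phi> (\<psi> - \<xi>) = cinner \<phi> \<psi> - cinner \<phi> \<xi>"
  using cinner_add_right[of \<phi> \<psi> "- \<xi>"] by (simp add: cinner_minus_right)

lemma cinner_zero [simp]: "cinner 0 \<psi> = 0" "cinner \<phi> 0 = 0"
  by (transfer; simp)+

lemmas cinner_simps = cinner_add_left cinner_add_right cinner_diff_left cinner_diff_right
  cinner_minus_left cinner_minus_right cinner_scaleC_left cinner_scaleC_right
  cinner_scaleR_left cinner_scaleR_right

lemma cinner_commute: "cinner \<phi> \<psi> = cnj (cinner \<psi> \<phi>)"
  by transfer (simp flip: infsum_cnj add: mult.commute)

lemma Re_cinner: "Re (cinner \<phi> \<psi>) = \<phi> \<bullet> \<psi>"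
  by (simp add: inner_ell2_def)

lemma cinner_self: "cinner \<psi> \<psi> = complex_of_real ((norm \<psi>)\<^sup>2)"
proof (rule complex_eqI)
  show "Im (cinner \<psi> \<psi>) = Im (complex_of_real ((norm \<psi>)\<^sup>2))"
    using cinner_commute[of \<psi> \<psi>] by (simp add: complex_eq_iff)
qed (simp add: Re_cinner power2_norm_eq_inner)

lemma norm_scaleC: "norm (c *\<^sub>C \<psi>) = cmod c * norm \<psi>" for \<psi> :: "'a ell2"
proof (rule power2_eq_imp_eq)
  have "cinner (c *\<^sub>C \<psi>) (c *\<^sub>C \<psi>) = of_real ((cmod c)\<^sup>2) * cinner \<psi> \<psi>"
    by (simp only: cinner_simps complex_norm_square mult_ac)
  then have "complex_of_real ((norm (c *\<^sub>C \<psi>))\<^sup>2) = complex_of_real ((cmod c * norm \<psi>)\<^sup>2)"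
    by (simp only: cinner_self power_mult_distrib of_real_mult)
  then show "(norm (c *\<^sub>C \<psi>))\<^sup>2 = (cmod c * norm \<psi>)\<^sup>2" by (simp only: of_real_eq_iff)
qed auto

lemma cmod_cinner_le: "cmod (cinner \<phi> \<psi>) \<le> norm \<phi> * norm \<psi>" for \<phi> :: "'a ell2"
proof (cases "cinner \<phi> \<psi> = 0")
  case False
  \<comment> \<open>The phase that turns the product into its modulus, after which the real
    Cauchy-Schwarz inequality applies.\<close>
  define c where "c = cnj (cinner \<phi> \<psi>) / cmod (cinner \<phi> \<psi>)"
  have "cmod c = 1" using False by (simp add: c_def norm_divide)
  have "c * cinner \<phi> \<psi> = cmod (cinner \<phi> \<psi>)"
    using False complex_norm_square[of "cinner \<phi> \<psi>"]
    by (simp add: c_def divide_simps power2_eq_square mult_ac)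
  then have "cmod (cinner \<phi> \<psi>) = \<phi> \<bullet> (c *\<^sub>C \<psi>)"
    by (simp flip: Re_cinner add: cinner_simps)
  also have "\<dots> \<le> norm \<phi> * norm (c *\<^sub>C \<psi>)" by (rule norm_cauchy_schwarz)
  finally show ?thesis using \<open>cmod c = 1\<close> by (simp add: norm_scaleC)
qed simp

lemma bounded_bilinear_cinner: "bounded_bilinear (cinner :: 'a ell2 \<Rightarrow> _)"
  by (rule bounded_bilinear.intro)
    (auto simp: cinner_simps scaleR_conv_of_real cmod_cinner_le intro!: exI[of _ 1])

lemmas tendsto_cinner = bounded_bilinear.tendsto[OF bounded_bilinear_cinner]

lemma cinner_sum_left: "cinner (\<Sum>i\<in>I. f i) \<psi> = (\<Sum>i\<in>I. cinner (f i) \<psi>)"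
  by (induction I rule: infinite_finite_induct) (simp_all add: cinner_simps)

lemma cinner_sum_right: "cinner \<psi> (\<Sum>i\<in>I. f i) = (\<Sum>i\<in>I. cinner \<psi> (f i))"
  by (induction I rule: infinite_finite_induct) (simp_all add: cinner_simps)

lemma cinner_basis_vec: "cinner (basis_vec x) \<psi> = coeff \<psi> x"
proof -
  have "(\<Sum>\<^sub>\<infinity>y. cnj (coeff (basis_vec x) y) * coeff \<psi> y)
      = (\<Sum>\<^sub>\<infinity>y\<in>{x}. cnj (coeff (basis_vec x) y) * coeff \<psi> y)"
    by (rule infsum_cong_neutral) (auto simp: coeff_simps)
  then show ?thesis by (simp add: cinner.rep_eq coeff_simps)
qed

lemma norm_basis_vec [simp]: "norm (basis_vec x) = 1"
proof -
  have "complex_of_real ((norm (basis_vec x))\<^sup>2) = 1"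
    using cinner_self[of "basis_vec x"] by (simp add: cinner_basis_vec coeff_simps)
  then have "(norm (basis_vec x))\<^sup>2 = 1" by (simp only: of_real_eq_1_iff)
  then show ?thesis by (simp add: power2_eq_1_iff) (use norm_ge_zero[of "basis_vec x"] in linarith)
qed

lemma cinner_ext: "\<phi> = \<psi>" if "\<And>\<xi>. cinner \<xi> \<phi> = cinner \<xi> \<psi>"
  by (rule ell2_eqI) (metis cinner_basis_vec that)

lemma norm_sq_has_sum: "((\<lambda>x. (cmod (coeff \<psi> x))\<^sup>2) has_sum (norm \<psi>)\<^sup>2) UNIV"
  using square_summable_coeff[of \<psi>] unfolding norm_ell2_sq square_summable_def by (rule has_sum_infsum)

lemma norm_sum_basis: 
  assumes "finite F"
  shows "(norm (\<Sum>x\<in>F. c x *\<^sub>C basis_vec x))\<^sup>2 = (\<Sum>x\<in>F. (cmod (c x))\<^sup>2)"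
proof -
  have "complex_of_real ((norm (\<Sum>x\<in>F. c x *\<^sub>C basis_vec x))\<^sup>2)
      = (\<Sum>x\<in>F. cnj (c x) * (\<Sum>y\<in>F. c y * (if y = x then 1 else 0)))"
    unfolding cinner_self[symmetric] using assms
    by (simp add: cinner_sum_left cinner_simps cinner_basis_vec coeff_sum coeff_simps)
  also have "\<dots> = complex_of_real (\<Sum>x\<in>F. (cmod (c x))\<^sup>2)"
    using assms by (simp add: complex_norm_square sum.delta mult_ac if_distrib cong: if_cong
        del: of_real_power)
  finally show ?thesis by (simp only: of_real_eq_iff)
qed

text \<open>Pythagoras: the squared distance from a partial sum to \<open>\<psi>\<close> is what
  remains of the squared norm.\<close>

lemma basis_expansion: "((\<lambda>x. coeff \<psi> x *\<^sub>C basis_vec x) has_sum \<psi>) UNIV"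
proof -
  let ?s = "\<lambda>F. \<Sum>x\<in>F. coeff \<psi> x *\<^sub>C basis_vec x"
  have eq: "(norm (?s F - \<psi>))\<^sup>2 = (norm \<psi>)\<^sup>2 - (\<Sum>x\<in>F. (cmod (coeff \<psi> x))\<^sup>2)" if "finite F" for F
  proof -
    have "cinner (?s F) \<psi> = (\<Sum>x\<in>F. complex_of_real ((cmod (coeff \<psi> x))\<^sup>2))"
      by (simp add: cinner_sum_left cinner_simps cinner_basis_vec complex_norm_square mult_ac
          flip: of_real_power)
    then have "?s F \<bullet> \<psi> = (\<Sum>x\<in>F. (cmod (coeff \<psi> x))\<^sup>2)" by (simp flip: Re_cinner)
    moreover have "(norm (?s F - \<psi>))\<^sup>2 = (norm (?s F))\<^sup>2 - 2 * (?s F \<bullet> \<psi>) + (norm \<psi>)\<^sup>2"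
      by (simp add: power2_norm_eq_inner inner_diff inner_commute)
    ultimately show ?thesis using norm_sum_basis[OF that] by simp
  qed
  have "((\<lambda>F. (norm \<psi>)\<^sup>2 - (\<Sum>x\<in>F. (cmod (coeff \<psi> x))\<^sup>2)) \<longlongrightarrow> (norm \<psi>)\<^sup>2 - (norm \<psi>)\<^sup>2)
      (finite_subsets_at_top UNIV)"
    using norm_sq_has_sum[of \<psi>] unfolding has_sum_def by (intro tendsto_intros)
  then have "((\<lambda>F. (norm (?s F - \<psi>))\<^sup>2) \<longlongrightarrow> 0) (finite_subsets_at_top UNIV)"
    unfolding diff_self by (rule Lim_transform_eventually)
      (simp add: eq eventually_finite_subsets_at_top_weakI)
  then have "((\<lambda>F. sqrt ((norm (?s F - \<psi>))\<^sup>2)) \<longlongrightarrow> sqrt 0) (finite_subsets_at_top UNIV)"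
    by (rule tendsto_real_sqrt)
  then have "((\<lambda>F. norm (?s F - \<psi>)) \<longlongrightarrow> 0) (finite_subsets_at_top UNIV)" by simp
  then show ?thesis unfolding has_sum_def
    by (subst (asm) tendsto_norm_zero_iff) (rule LIM_zero_cancel)
qed

section \<open>Complex-linear bounded operators and their adjoints\<close>

lemma clinear_opD: "clinear_op A \<Longrightarrow> A (c *\<^sub>C \<psi>) = c *\<^sub>C A \<psi>"
  by (simp add: clinear_op_def)

named_theorems clinear

lemma clinear_add [clinear]: "clinear_op A \<Longrightarrow> clinear_op B \<Longrightarrow> clinear_op (A + B)"
  and clinear_diff [clinear]: "clinear_op A \<Longrightarrow> clinear_op B \<Longrightarrow> clinear_op (A - B)"
  and clinear_uminus [clinear]: "clinear_op A \<Longrightarrow> clinear_op (- A)"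
  and clinear_scaleR [clinear]: "clinear_op A \<Longrightarrow> clinear_op (r *\<^sub>R A)"
  and clinear_compose [clinear]: "clinear_op A \<Longrightarrow> clinear_op B \<Longrightarrow> clinear_op (A o\<^sub>L B)"
  and clinear_id [clinear]: "clinear_op id_blinfun"
  and clinear_zero [clinear]: "clinear_op 0"
  by (simp_all add: clinear_op_def blinfun.bilinear_simps)

lemma op_eqI: "A = B" if "\<And>\<phi> \<psi>. cinner \<phi> (A \<psi>) = cinner \<phi> (B \<psi>)" for A B :: "'a op"
  by (rule blinfun_eqI, rule cinner_ext) (rule that)

lemma op_norm_le: "norm A \<le> c" if "c \<ge> 0" "\<And>\<psi>. norm (A \<psi>) \<le> c * norm \<psi>" for A :: "'a op"
  using that by (intro norm_blinfun_bound)

lemma op_norm_le_cinner: "norm A \<le> c"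
  if "c \<ge> 0" "\<And>\<phi> \<psi>. cmod (cinner \<phi> (A \<psi>)) \<le> c * norm \<phi> * norm \<psi>" for A :: "'a op"
proof (rule op_norm_le[OF \<open>c \<ge> 0\<close>])
  fix \<psi>
  have "(norm (A \<psi>))\<^sup>2 \<le> (norm (A \<psi>)) * (c * norm \<psi>)"
    using that(2)[of "A \<psi>" \<psi>] by (simp add: cinner_self norm_power mult_ac)
  then show "norm (A \<psi>) \<le> c * norm \<psi>" using \<open>c \<ge> 0\<close>
    by (cases "norm (A \<psi>) = 0") (auto simp: power2_eq_square)
qed

text \<open>Built coordinatewise: the coefficients of \<open>B \<psi>\<close> are forced to be
  \<open>cinner (A (basis_vec x)) \<psi>\<close>. Testing \<open>A\<close> on the finite vector with
  these very coefficients bounds their sum of squares, and the basis expansion extends the identity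
  from finite sums by continuity.\<close>

lemma adj_exists:
  assumes A: "clinear_op A"
  obtains B :: "'a op" where "\<And>\<phi> \<psi>. cinner (A \<phi>) \<psi> = cinner \<phi> (B \<psi>)"
proof -
  define b where "b \<psi> x = cinner (A (basis_vec x)) \<psi>" for \<psi> x
  have fin: "cinner (A (\<Sum>x\<in>F. c x *\<^sub>C basis_vec x)) \<psi> = (\<Sum>x\<in>F. cnj (c x) * b \<psi> x)" for F c \<psi>
    by (simp add: blinfun.sum_right cinner_sum_left clinear_opD[OF A] cinner_simps b_def)
  have bd: "(\<Sum>x\<in>F. (cmod (b \<psi> x))\<^sup>2) \<le> (norm A * norm \<psi>)\<^sup>2" if "finite F" for F \<psi>
  proof -
    let ?\<phi> = "\<Sum>x\<in>F. b \<psi> x *\<^sub>C basis_vec x" and ?s = "\<Sum>x\<in>F. (cmod (b \<psi> x))\<^sup>2"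
    have "?s \<ge> 0" by (intro sum_nonneg) simp
    have "complex_of_real ?s = cinner (A ?\<phi>) \<psi>"
      by (simp add: fin complex_norm_square mult_ac flip: of_real_power)
    then have "?s = cmod (cinner (A ?\<phi>) \<psi>)" using \<open>?s \<ge> 0\<close>
      by (metis norm_of_real abs_of_nonneg)
    also have "\<dots> \<le> norm (A ?\<phi>) * norm \<psi>" by (rule cmod_cinner_le)
    also have "\<dots> \<le> norm A * norm ?\<phi> * norm \<psi>" by (intro mult_right_mono norm_blinfun) simp
    finally have "?s\<^sup>2 \<le> (norm A * norm ?\<phi> * norm \<psi>)\<^sup>2" using \<open>?s \<ge> 0\<close> by (rule power_mono)
    also have "\<dots> = (norm A * norm \<psi>)\<^sup>2 * ?s"
      using norm_sum_basis[OF that, of "b \<psi>"] by (simp add: power_mult_distrib)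
    finally show ?thesis using \<open>?s \<ge> 0\<close>
      by (cases "?s = 0") (auto simp: power2_eq_square mult_le_cancel_right)
  qed
  have ss: "square_summable (b \<psi>)" for \<psi>
    by (rule square_summable_bounded) (rule bd)
  define B where "B \<psi> = Abs_ell2 (b \<psi>)" for \<psi>
  have cB: "coeff (B \<psi>) x = b \<psi> x" for \<psi> x by (simp add: B_def Abs_ell2_inverse ss)
  have nB: "norm (B \<psi>) \<le> norm A * norm \<psi>" for \<psi>
    by (rule power2_le_imp_le)
      (auto simp: norm_ell2_sq cB intro!: infsum_le_finite_sums bd
        ss[unfolded square_summable_def])
  have "bounded_linear B"
    by (rule bounded_linear_intro[where K = "norm A"])
      (auto intro!: ell2_eqI simp: cB b_def coeff_simps cinner_simps nB mult.commute[of "norm _" "norm A"])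
  then have app: "blinfun_apply (Blinfun B) = B" by (rule bounded_linear_Blinfun_apply)
  have "cinner (A \<phi>) \<psi> = cinner \<phi> (B \<psi>)" for \<phi> \<psi>
  proof (rule tendsto_unique)
    let ?s = "\<lambda>F. \<Sum>x\<in>F. coeff \<phi> x *\<^sub>C basis_vec x"
    have s: "(?s \<longlongrightarrow> \<phi>) (finite_subsets_at_top UNIV)"
      using basis_expansion[of \<phi>] by (simp add: has_sum_def)
    show "((\<lambda>F. cinner (A (?s F)) \<psi>) \<longlongrightarrow> cinner (A \<phi>) \<psi>) (finite_subsets_at_top UNIV)"
      by (intro tendsto_cinner blinfun.tendsto tendsto_const s)
    have "cinner (?s F) (B \<psi>) = cinner (A (?s F)) \<psi>" for F
      by (simp add: fin cinner_sum_left cinner_simps cinner_basis_vec cB)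
    then show "((\<lambda>F. cinner (A (?s F)) \<psi>) \<longlongrightarrow> cinner \<phi> (B \<psi>)) (finite_subsets_at_top UNIV)"
      using tendsto_cinner[OF s tendsto_const, of "B \<psi>"] by simp
  qed (simp add: finite_subsets_at_top_neq_bot)
  with app show thesis using that[of "Blinfun B"] by simp
qed

text \<open>\<open>adj\<close> is a definite description; since matrix elements determine an
  operator, exhibiting one adjoint identifies it.\<close>

lemma adj_eqI: "adj A = B" if eq: "\<And>\<phi> \<psi>. cinner (A \<phi>) \<psi> = cinner \<phi> (blinfun_apply B \<psi>)" for A B :: "'a op"
  unfolding adj_def
proof (rule the_equality)
  show "C = B" if "\<forall>\<phi> \<psi>. cinner (A \<phi>) \<psi> = cinner \<phi> (C \<psi>)" for C :: "'a op"
    by (rule op_eqI) (metis that eq)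
qed (use eq in blast)

lemma adj_cinner: "clinear_op A \<Longrightarrow> cinner \<phi> (adj A \<psi>) = cinner (A \<phi>) \<psi>"
  by (metis adj_exists adj_eqI)

lemma adj_cinner': "clinear_op A \<Longrightarrow> cinner (adj A \<phi>) \<psi> = cinner \<phi> (A \<psi>)"
  by (metis adj_cinner cinner_commute)

lemma clinear_adj [clinear]: "clinear_op A \<Longrightarrow> clinear_op (adj A)"
  unfolding clinear_op_def[of "adj A"]
  by (intro allI cinner_ext) (simp add: adj_cinner cinner_simps)

lemma adj_adj: "clinear_op A \<Longrightarrow> adj (adj A) = A"
  by (rule adj_eqI) (rule adj_cinner')

lemma adj_compose: "clinear_op A \<Longrightarrow> clinear_op B \<Longrightarrow> adj (A o\<^sub>L B) = adj B o\<^sub>L adj A"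
  by (rule adj_eqI) (simp add: adj_cinner)

lemma adj_add: "clinear_op A \<Longrightarrow> clinear_op B \<Longrightarrow> adj (A + B) = adj A + adj B"
  by (rule adj_eqI) (simp add: adj_cinner blinfun.bilinear_simps cinner_simps)

lemma adj_diff: "clinear_op A \<Longrightarrow> clinear_op B \<Longrightarrow> adj (A - B) = adj A - adj B"
  by (rule adj_eqI) (simp add: adj_cinner blinfun.bilinear_simps cinner_simps)

lemma adj_scaleR: "clinear_op A \<Longrightarrow> adj (r *\<^sub>R A) = r *\<^sub>R adj A"
  by (rule adj_eqI) (simp add: adj_cinner blinfun.bilinear_simps cinner_simps)

lemma norm_adj_le: "clinear_op A \<Longrightarrow> norm (adj A) \<le> norm A"
proof (rule op_norm_le_cinner)
  fix \<phi> \<psi> assume "clinear_op A"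
  then have "cmod (cinner \<phi> (adj A \<psi>)) \<le> norm (A \<phi>) * norm \<psi>"
    by (simp add: adj_cinner cmod_cinner_le)
  also have "\<dots> \<le> norm A * norm \<phi> * norm \<psi>" by (intro mult_right_mono norm_blinfun) simp
  finally show "cmod (cinner \<phi> (adj A \<psi>)) \<le> norm A * norm \<phi> * norm \<psi>" .
qed simp

lemma norm_adj: "clinear_op A \<Longrightarrow> norm (adj A) = norm A"
  by (metis adj_adj clinear_adj norm_adj_le order_antisym)

lemma selfadjoint_iff: "selfadjoint A \<longleftrightarrow> clinear_op A \<and> adj A = A"
  unfolding selfadjoint_def using adj_eqI[of A A] adj_cinner[of A] by auto

lemma selfadjoint_clinear [clinear]: "selfadjoint A \<Longrightarrow> clinear_op A"
  by (simp add: selfadjoint_def)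

lemma selfadjoint_cinner: "selfadjoint A \<Longrightarrow> cinner (A \<phi>) \<psi> = cinner \<phi> (A \<psi>)"
  by (simp add: selfadjoint_def)

lemma selfadjoint_inner: "selfadjoint A \<Longrightarrow> A \<phi> \<bullet> \<psi> = \<phi> \<bullet> A \<psi>"
  by (simp add: selfadjoint_def flip: Re_cinner)

lemma selfadjoint_add: "selfadjoint A \<Longrightarrow> selfadjoint B \<Longrightarrow> selfadjoint (A + B)"
  and selfadjoint_diff: "selfadjoint A \<Longrightarrow> selfadjoint B \<Longrightarrow> selfadjoint (A - B)"
  and selfadjoint_uminus: "selfadjoint A \<Longrightarrow> selfadjoint (- A)"
  and selfadjoint_scaleR: "selfadjoint A \<Longrightarrow> selfadjoint (r *\<^sub>R A)"
  and selfadjoint_id: "selfadjoint id_blinfun"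
  and selfadjoint_zero: "selfadjoint 0"
  by (simp_all add: selfadjoint_def clinear blinfun.bilinear_simps cinner_simps)

lemma selfadjoint_square: "selfadjoint A \<Longrightarrow> selfadjoint (A o\<^sub>L A)"
  by (simp add: selfadjoint_def clinear)

lemma selfadjoint_sandwich: "clinear_op A \<Longrightarrow> selfadjoint X \<Longrightarrow> selfadjoint (A o\<^sub>L X o\<^sub>L adj A)"
  unfolding selfadjoint_iff
  by (auto simp: clinear adj_compose adj_adj intro!: blinfun_eqI)

lemma tendsto_selfadjoint:
  assumes "\<And>n. selfadjoint (X n)" "X \<longlonglongrightarrow> A" shows "selfadjoint A"
  unfolding selfadjoint_def clinear_op_def
proof (intro conjI allI)
  have lim: "(\<lambda>n. X n \<psi>) \<longlonglongrightarrow> A \<psi>" for \<psi>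
    by (intro blinfun.tendsto assms tendsto_const)
  show "A (c *\<^sub>C \<psi>) = c *\<^sub>C A \<psi>" for c \<psi>
  proof (rule cinner_ext, rule LIMSEQ_unique)
    fix \<xi>
    show "(\<lambda>n. cinner \<xi> (X n (c *\<^sub>C \<psi>))) \<longlonglongrightarrow> cinner \<xi> (A (c *\<^sub>C \<psi>))"
      by (intro tendsto_cinner lim tendsto_const)
    have "X n (c *\<^sub>C \<psi>) = c *\<^sub>C X n \<psi>" for n
      using assms(1) by (simp add: clinear_opD clinear)
    then show "(\<lambda>n. cinner \<xi> (X n (c *\<^sub>C \<psi>))) \<longlonglongrightarrow> cinner \<xi> (c *\<^sub>C A \<psi>)"
      by (simp only: cinner_simps) (intro tendsto_mult tendsto_cinner lim tendsto_const)
  qed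
  show "cinner (A \<phi>) \<psi> = cinner \<phi> (A \<psi>)" for \<phi> \<psi>
  proof (rule LIMSEQ_unique)
    show "(\<lambda>n. cinner (X n \<phi>) \<psi>) \<longlonglongrightarrow> cinner (A \<phi>) \<psi>"
      by (intro tendsto_cinner lim tendsto_const)
    show "(\<lambda>n. cinner (X n \<phi>) \<psi>) \<longlonglongrightarrow> cinner \<phi> (A \<psi>)"
      using assms(1) by (simp only: selfadjoint_cinner) (intro tendsto_cinner lim tendsto_const)
  qed
qed

section \<open>Positive operators and square roots\<close>

lemma blinfun_compose_assoc: "(A o\<^sub>L B) o\<^sub>L C = A o\<^sub>L (B o\<^sub>L C)"
  by (rule blinfun_eqI) simp

text \<open>Over the complex scalars a real quadratic form forces self-adjointness: the sesquilinear
  defect \<open>h\<close> vanishes on the diagonal, and polarizing with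
  \<open>\<phi> + \<psi>\<close> and \<open>\<phi> + \<i> *\<^sub>C \<psi>\<close> kills it
  everywhere.\<close>

lemma positive_iff: "positive_op A \<longleftrightarrow> selfadjoint A \<and> (\<forall>\<psi>. 0 \<le> \<psi> \<bullet> A \<psi>)"
proof
  assume A: "positive_op A"
  define h where "h \<phi> \<psi> = cinner \<phi> (A \<psi>) - cinner (A \<phi>) \<psi>" for \<phi> \<psi>
  have cl: "clinear_op A" using A by (simp add: positive_op_def)
  have "cnj (cinner \<psi> (A \<psi>)) = cinner \<psi> (A \<psi>)" for \<psi>
    using A by (simp add: positive_op_def Reals_cnj_iff)
  then have h0: "h \<psi> \<psi> = 0" for \<psi>
    by (metis cinner_commute eq_iff_diff_eq_0 h_def)
  have "h \<phi> \<psi> = 0" for \<phi> \<psi>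
  proof -
    have "h (\<phi> + \<psi>) (\<phi> + \<psi>) = h \<phi> \<phi> + h \<phi> \<psi> + h \<psi> \<phi> + h \<psi> \<psi>"
      by (simp add: h_def cinner_simps blinfun.bilinear_simps)
    then have 1: "h \<phi> \<psi> + h \<psi> \<phi> = 0" by (simp add: h0)
    have "h (\<phi> + \<i> *\<^sub>C \<psi>) (\<phi> + \<i> *\<^sub>C \<psi>) = h \<phi> \<phi> + \<i> * h \<phi> \<psi> - \<i> * h \<psi> \<phi> + h \<psi> \<psi>"
      by (simp add: h_def cinner_simps blinfun.bilinear_simps clinear_opD[OF cl] algebra_simps)
    then have "\<i> * (h \<phi> \<psi> - h \<psi> \<phi>) = 0" by (simp add: h0 algebra_simps)
    with 1 show ?thesis by simp
  qed
  then have "selfadjoint A" using cl by (simp add: selfadjoint_def h_def)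
  with A show "selfadjoint A \<and> (\<forall>\<psi>. 0 \<le> \<psi> \<bullet> A \<psi>)"
    by (simp add: positive_op_def flip: Re_cinner)
next
  assume A: "selfadjoint A \<and> (\<forall>\<psi>. 0 \<le> \<psi> \<bullet> A \<psi>)"
  then have "cnj (cinner \<psi> (A \<psi>)) = cinner \<psi> (A \<psi>)" for \<psi>
    by (metis cinner_commute selfadjoint_cinner)
  with A show "positive_op A"
    by (simp add: positive_op_def clinear Reals_cnj_iff Re_cinner)
qed

lemma positive_selfadjoint: "positive_op A \<Longrightarrow> selfadjoint A"
  by (simp add: positive_iff)

lemma positive_inner: "positive_op A \<Longrightarrow> 0 \<le> \<psi> \<bullet> A \<psi>"
  by (simp add: positive_iff)

lemma positive_clinear [clinear]: "positive_op A \<Longrightarrow> clinear_op A"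
  by (simp add: positive_op_def)

lemma positive_scaleR: "positive_op A \<Longrightarrow> 0 \<le> r \<Longrightarrow> positive_op (r *\<^sub>R A)"
  by (simp add: positive_iff selfadjoint_scaleR blinfun.bilinear_simps)

lemma positive_square: "selfadjoint A \<Longrightarrow> positive_op (A o\<^sub>L A)"
  unfolding positive_iff blinfun_apply_blinfun_compose
  by (metis selfadjoint_square selfadjoint_inner inner_ge_zero)

lemma positive_sandwich: 
  assumes "clinear_op A" "positive_op X" shows "positive_op (A o\<^sub>L X o\<^sub>L adj A)"
proof -
  have "\<psi> \<bullet> A \<phi> = adj A \<psi> \<bullet> \<phi>" for \<phi> \<psi>
    using adj_cinner'[OF assms(1)] by (simp flip: Re_cinner)
  then show ?thesis using assms by (simp add: positive_iff selfadjoint_sandwich)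
qed

text \<open>Evaluate the positive form at \<open>\<psi> - t *\<^sub>R P \<psi>\<close> with
  \<open>t = 1 / norm P\<close>. The inequality is used to turn a small value of the form into a
  small vector.\<close>

lemma positive_norm_sq:
  assumes "positive_op P" shows "(norm (P \<psi>))\<^sup>2 \<le> norm P * (\<psi> \<bullet> P \<psi>)"
proof (cases "P = 0")
  case False
  define t where "t = 1 / norm P"
  have t: "t > 0" using False by (simp add: t_def)
  have sa: "\<psi> \<bullet> P (P \<psi>) = (norm (P \<psi>))\<^sup>2"
    using selfadjoint_inner[OF positive_selfadjoint[OF assms], of \<psi> "P \<psi>"]
    by (simp add: power2_norm_eq_inner)
  have "P \<psi> \<bullet> P (P \<psi>) \<le> norm (P \<psi>) * (norm P * norm (P \<psi>))"
    by (intro order_trans[OF norm_cauchy_schwarz] mult_left_mono norm_blinfun) simp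
  then have bd: "t\<^sup>2 * (P \<psi> \<bullet> P (P \<psi>)) \<le> t * (norm (P \<psi>))\<^sup>2"
    using False t unfolding t_def by (simp add: field_simps power2_eq_square)
  have "0 \<le> (\<psi> - t *\<^sub>R P \<psi>) \<bullet> P (\<psi> - t *\<^sub>R P \<psi>)" by (rule positive_inner[OF assms])
  also have "\<dots> = \<psi> \<bullet> P \<psi> - 2 * t * (norm (P \<psi>))\<^sup>2 + t\<^sup>2 * (P \<psi> \<bullet> P (P \<psi>))"
    using sa by (simp add: blinfun.bilinear_simps inner_diff dot_square_norm power2_eq_square[of t]
        algebra_simps)
  finally have "t * (norm (P \<psi>))\<^sup>2 \<le> \<psi> \<bullet> P \<psi>" using bd by linarith
  then show ?thesis using False by (simp add: t_def field_simps)
qed simp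

text \<open>With \<open>Q = 1 - P\<close>, the solution \<open>Y\<close> of \<open>Y = (Q + Y\<^sup>2) / 2\<close> satisfies \<open>(1 - Y)\<^sup>2 = P\<close>.\<close>

primrec root_iter :: "'a op \<Rightarrow> nat \<Rightarrow> 'a op" where
  "root_iter Q 0 = 0"
| "root_iter Q (Suc k) = (1/2) *\<^sub>R (Q + (root_iter Q k o\<^sub>L root_iter Q k))"

text \<open>The same iteration for the scalar 1, serving as a majorant: it increases, stays below 1,
  hence converges, and the operator iteration inherits the Cauchy property from it.\<close>

primrec root_iter_bound :: "nat \<Rightarrow> real" where
  "root_iter_bound 0 = 0"
| "root_iter_bound (Suc k) = (1 + (root_iter_bound k)\<^sup>2) / 2"

lemma root_iter_bound_bounds: "0 \<le> root_iter_bound k \<and> root_iter_bound k \<le> 1"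
  by (induction k) (auto simp: power_le_one)

lemma root_iter_commute:
  assumes "A o\<^sub>L Q = Q o\<^sub>L A" shows "A o\<^sub>L root_iter Q k = root_iter Q k o\<^sub>L A"
proof (induction k)
  case (Suc k)
  have "A (root_iter Q k \<psi>) = root_iter Q k (A \<psi>)" "A (Q \<psi>) = Q (A \<psi>)" for \<psi>
    using Suc assms by (metis blinfun_apply_blinfun_compose)+
  then show ?case by (auto intro!: blinfun_eqI simp: blinfun.bilinear_simps)
qed simp

text \<open>Consecutive iterates commute, so the difference of their squares factors as sum times
  difference, exactly as for the scalar majorant.\<close>

lemma root_iter_step:
  assumes Q: "norm Q \<le> 1"
  shows "norm (root_iter Q k) \<le> root_iter_bound k"
    and "norm (root_iter Q (Suc k) - root_iter Q k) \<le> root_iter_bound (Suc k) - root_iter_bound k"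
proof -
  let ?Y = "root_iter Q" and ?y = root_iter_bound
  show Y: "norm (?Y k) \<le> ?y k" for k
  proof (induction k)
    case (Suc k)
    have "norm (Q + (?Y k o\<^sub>L ?Y k)) \<le> norm Q + norm (?Y k) * norm (?Y k)"
      by (intro order_trans[OF norm_triangle_ineq] add_left_mono norm_blinfun_compose)
    also have "\<dots> \<le> 1 + ?y k * ?y k"
      using Q Suc root_iter_bound_bounds[of k] by (intro add_mono mult_mono) auto
    finally show ?case by (simp add: power2_eq_square)
  qed simp
  show "norm (?Y (Suc k) - ?Y k) \<le> ?y (Suc k) - ?y k"
  proof (induction k)
    case 0
    show ?case using Q by simp
  next
    case (Suc k)
    have "?Y k o\<^sub>L Q = Q o\<^sub>L ?Y k" using root_iter_commute[of Q Q k] by simp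
    then have "?Y k o\<^sub>L ?Y (Suc k) = ?Y (Suc k) o\<^sub>L ?Y k" by (rule root_iter_commute)
    then have "?Y k (?Y (Suc k) \<psi>) = ?Y (Suc k) (?Y k \<psi>)" for \<psi>
      by (metis blinfun_apply_blinfun_compose)
    then have "(1/2) *\<^sub>R (Q + (?Y (Suc k) o\<^sub>L ?Y (Suc k))) - (1/2) *\<^sub>R (Q + (?Y k o\<^sub>L ?Y k))
        = (1/2) *\<^sub>R ((?Y (Suc k) + ?Y k) o\<^sub>L (?Y (Suc k) - ?Y k))"
      by (intro blinfun_eqI)
        (simp add: blinfun.bilinear_simps algebra_simps del: root_iter.simps)
    then have "?Y (Suc (Suc k)) - ?Y (Suc k)
        = (1/2) *\<^sub>R ((?Y (Suc k) + ?Y k) o\<^sub>L (?Y (Suc k) - ?Y k))"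
      by (metis root_iter.simps(2))
    then have "norm (?Y (Suc (Suc k)) - ?Y (Suc k))
        \<le> (1/2) * (norm (?Y (Suc k) + ?Y k) * norm (?Y (Suc k) - ?Y k))"
      by (simp add: norm_blinfun_compose del: root_iter.simps)
    also have "norm (?Y (Suc k) + ?Y k) * norm (?Y (Suc k) - ?Y k)
        \<le> (?y (Suc k) + ?y k) * (?y (Suc k) - ?y k)"
      using Suc Y[of "Suc k"] Y[of k] root_iter_bound_bounds[of k] root_iter_bound_bounds[of "Suc k"]
      by (intro mult_mono order_trans[OF norm_triangle_ineq] add_mono)
        (simp_all del: root_iter.simps root_iter_bound.simps)
    also have "(1/2) * ((?y (Suc k) + ?y k) * (?y (Suc k) - ?y k))
        = (1 + (?y (Suc k))\<^sup>2) / 2 - (1 + (?y k)\<^sup>2) / 2"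
      by (simp add: field_simps power2_eq_square del: root_iter_bound.simps)
    also have "\<dots> = ?y (Suc (Suc k)) - ?y (Suc k)"
      by (simp only: root_iter_bound.simps(2))
    finally show ?case by simp
  qed
qed

lemma root_iter_convergent:
  assumes "norm Q \<le> 1" shows "convergent (root_iter Q)"
proof -
  let ?Y = "root_iter Q" and ?y = root_iter_bound
  have mono: "?y k \<le> ?y (Suc k)" for k
    using order_trans[OF norm_ge_zero root_iter_step(2)[OF assms, of k]] by simp
  then have "incseq ?y" by (rule incseq_SucI)
  then have "convergent ?y"
    using root_iter_bound_bounds by (intro Bseq_mono_convergent BseqI'[where K = 1]) (auto simp: incseq_def)
  then have C: "Cauchy ?y" by (simp add: Cauchy_convergent_iff)
  have diff: "norm (?Y (m + j) - ?Y m) \<le> ?y (m + j) - ?y m" for m j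
  proof (induction j)
    case (Suc j)
    have "norm (?Y (m + Suc j) - ?Y m) \<le> norm (?Y (Suc (m + j)) - ?Y (m + j)) + norm (?Y (m + j) - ?Y m)"
      using norm_triangle_ineq[of "?Y (Suc (m + j)) - ?Y (m + j)" "?Y (m + j) - ?Y m"]
      by (simp del: root_iter.simps)
    with Suc root_iter_step(2)[OF assms, of "m + j"] show ?case
      by (simp del: root_iter.simps root_iter_bound.simps)
  qed simp
  have "Cauchy ?Y"
  proof (rule metric_CauchyI)
    fix e :: real assume "e > 0"
    with C obtain M where M: "\<forall>m\<ge>M. \<forall>n\<ge>M. dist (?y m) (?y n) < e" unfolding Cauchy_def by blast
    have *: "dist (?Y n) (?Y m) < e" if "m \<ge> M" "n \<ge> m" for m n
    proof -
      have "dist (?Y n) (?Y m) \<le> ?y n - ?y m"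
        using diff[of m "n - m"] that by (simp add: dist_norm)
      also have "\<dots> \<le> dist (?y n) (?y m)" by (simp add: dist_real_def)
      also have "\<dots> < e" using M that by auto
      finally show ?thesis .
    qed
    have "dist (?Y m) (?Y n) < e" if "m \<ge> M" "n \<ge> M" for m n
      using *[of m n] *[of n m] that by (cases "m \<le> n") (auto simp: dist_commute)
    then show "\<exists>M. \<forall>m\<ge>M. \<forall>n\<ge>M. dist (?Y m) (?Y n) < e" by blast
  qed
  then show ?thesis by (rule Cauchy_convergent)
qed

lemma sqrt_exists_contraction:
  assumes P: "positive_op P" and "norm P \<le> 1"
  obtains T where "positive_op T" "T o\<^sub>L T = P" "\<And>A. A o\<^sub>L P = P o\<^sub>L A \<Longrightarrow> A o\<^sub>L T = T o\<^sub>L A"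
proof -
  define Q where "Q = id_blinfun - P"
  have saQ: "selfadjoint Q"
    unfolding Q_def by (intro selfadjoint_diff selfadjoint_id positive_selfadjoint P)
  \<comment> \<open>Since \<open>(norm (P \<psi>))\<^sup>2 \<le> \<psi> \<bullet> P \<psi>\<close>,
    the cross term in the square of \<open>\<psi> - P \<psi>\<close> outweighs the last one.\<close>
  have "norm (Q \<psi>) \<le> 1 * norm \<psi>" for \<psi>
  proof (rule power2_le_imp_le)
    have "(norm (P \<psi>))\<^sup>2 \<le> 1 * (\<psi> \<bullet> P \<psi>)"
      using assms by (intro order_trans[OF positive_norm_sq[OF P]] mult_right_mono positive_inner)
    with positive_inner[OF P, of \<psi>] show "(norm (Q \<psi>))\<^sup>2 \<le> (1 * norm \<psi>)\<^sup>2"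
      by (simp add: Q_def blinfun.bilinear_simps power2_norm_eq_inner inner_diff inner_commute)
  qed simp
  then have nQ: "norm Q \<le> 1" by (rule op_norm_le[rotated]) simp
  then obtain Y where Y: "root_iter Q \<longlonglongrightarrow> Y"
    using root_iter_convergent convergent_def by blast
  have nY: "norm Y \<le> 1"
    using order_trans[OF root_iter_step(1)[OF nQ]] root_iter_bound_bounds
    by (intro LIMSEQ_le_const2[OF tendsto_norm[OF Y]]) blast
  have "selfadjoint (root_iter Q k)" for k
    by (induction k)
      (auto intro!: selfadjoint_zero selfadjoint_scaleR selfadjoint_add selfadjoint_square saQ)
  then have saY: "selfadjoint Y" using Y by (rule tendsto_selfadjoint)
  have comp: "(\<lambda>k. A o\<^sub>L root_iter Q k) \<longlonglongrightarrow> (A o\<^sub>L Y)" "(\<lambda>k. root_iter Q k o\<^sub>L A) \<longlonglongrightarrow> (Y o\<^sub>L A)" for A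
    by (intro bounded_bilinear.tendsto[OF bounded_bilinear_blinfun_compose] tendsto_const Y)+
  have "(\<lambda>k. root_iter Q (Suc k)) \<longlonglongrightarrow> (1/2) *\<^sub>R (Q + (Y o\<^sub>L Y))"
    unfolding root_iter.simps
    by (intro tendsto_intros bounded_bilinear.tendsto[OF bounded_bilinear_blinfun_compose] Y)
  then have eq: "Y = (1/2) *\<^sub>R (Q + (Y o\<^sub>L Y))"
    using LIMSEQ_Suc[OF Y] by (blast intro: LIMSEQ_unique)
  have YY: "Y (Y \<psi>) = 2 *\<^sub>R Y \<psi> - Q \<psi>" for \<psi>
  proof -
    have "2 *\<^sub>R Y \<psi> = 2 *\<^sub>R ((1/2) *\<^sub>R (Q + (Y o\<^sub>L Y))) \<psi>"
      using arg_cong[OF eq, of "\<lambda>Z. 2 *\<^sub>R blinfun_apply Z \<psi>"] .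
    then show ?thesis by (simp add: blinfun.bilinear_simps algebra_simps)
  qed
  define T where "T = id_blinfun - Y"
  have "positive_op T" unfolding positive_iff
  proof (intro conjI allI)
    show "selfadjoint T" unfolding T_def by (intro selfadjoint_diff selfadjoint_id saY)
    fix \<psi>
    have "\<psi> \<bullet> Y \<psi> \<le> norm \<psi> * (1 * norm \<psi>)"
      using nY by (intro order_trans[OF norm_cauchy_schwarz] mult_left_mono
          order_trans[OF norm_blinfun] mult_right_mono) auto
    then show "0 \<le> \<psi> \<bullet> T \<psi>"
      by (simp add: T_def blinfun.bilinear_simps inner_diff power2_norm_eq_inner[symmetric]
          power2_eq_square)
  qed
  moreover have "T o\<^sub>L T = P"
    by (rule blinfun_eqI) (simp add: T_def blinfun.bilinear_simps YY scaleR_2 Q_def)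
  moreover have "A o\<^sub>L T = T o\<^sub>L A" if "A o\<^sub>L P = P o\<^sub>L A" for A
  proof -
    have "A (P \<psi>) = P (A \<psi>)" for \<psi> using that by (metis blinfun_apply_blinfun_compose)
    then have "A o\<^sub>L Q = Q o\<^sub>L A"
      by (auto intro!: blinfun_eqI simp: Q_def blinfun.bilinear_simps)
    then have "A o\<^sub>L Y = Y o\<^sub>L A"
      using comp[of A] by (simp add: root_iter_commute LIMSEQ_unique)
    then have "A (Y \<psi>) = Y (A \<psi>)" for \<psi> by (metis blinfun_apply_blinfun_compose)
    then show ?thesis by (auto intro!: blinfun_eqI simp: T_def blinfun.bilinear_simps)
  qed
  ultimately show thesis by (rule that)
qed

lemma sqrt_exists:
  assumes P: "positive_op P"
  obtains T where "positive_op T" "T o\<^sub>L T = P" "\<And>A. A o\<^sub>L P = P o\<^sub>L A \<Longrightarrow> A o\<^sub>L T = T o\<^sub>L A"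
proof (cases "P = 0")
  case True
  then show thesis by (intro that[of 0]) (simp_all add: positive_iff selfadjoint_zero)
next
  case False
  define r where "r = norm P"
  have r: "r > 0" using False by (simp add: r_def)
  have P': "positive_op ((1/r) *\<^sub>R P)" using r by (intro positive_scaleR P) simp
  moreover have "norm ((1/r) *\<^sub>R P) \<le> 1" using r by (simp add: r_def)
  ultimately obtain T where T: "positive_op T" "T o\<^sub>L T = (1/r) *\<^sub>R P"
    and c: "\<And>A. A o\<^sub>L ((1/r) *\<^sub>R P) = ((1/r) *\<^sub>R P) o\<^sub>L A \<Longrightarrow> A o\<^sub>L T = T o\<^sub>L A"
    using sqrt_exists_contraction by metis
  note bl = bounded_bilinear.scaleR_left[OF bounded_bilinear_blinfun_compose]
    bounded_bilinear.scaleR_right[OF bounded_bilinear_blinfun_compose]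
  show thesis
  proof (rule that[of "sqrt r *\<^sub>R T"])
    show "positive_op (sqrt r *\<^sub>R T)" using r T by (intro positive_scaleR) auto
    show "sqrt r *\<^sub>R T o\<^sub>L sqrt r *\<^sub>R T = P" using r T(2) by (simp add: bl)
    show "A o\<^sub>L sqrt r *\<^sub>R T = sqrt r *\<^sub>R T o\<^sub>L A" if "A o\<^sub>L P = P o\<^sub>L A" for A
      using that by (simp add: bl c)
  qed
qed

lemma positive_inner_eq_0:
  assumes "positive_op P" "\<psi> \<bullet> P \<psi> = 0" shows "P \<psi> = 0"
  using positive_norm_sq[OF assms(1), of \<psi>] assms(2) by simp

text \<open>Both roots are compared with the root \<open>R\<close> from \<open>sqrt_exists\<close>,
  which commutes with everything that commutes with the square, hence with every root
  \<open>U\<close>. Then \<open>(U + R) (U - R) = 0\<close>, so both positive forms vanish on the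
  range of \<open>D = U - R\<close>. This gives \<open>D (D \<phi>) = 0\<close>, and
  \<open>D = 0\<close> by self-adjointness.\<close>

lemma sqrt_unique:
  assumes T: "positive_op T" and S: "positive_op S" and eq: "S o\<^sub>L S = T o\<^sub>L T"
  shows "S = T"
proof -
  obtain R where R: "positive_op R" "R o\<^sub>L R = T o\<^sub>L T"
    and c: "\<And>A. A o\<^sub>L (T o\<^sub>L T) = (T o\<^sub>L T) o\<^sub>L A \<Longrightarrow> A o\<^sub>L R = R o\<^sub>L A"
    using sqrt_exists[OF positive_square[OF positive_selfadjoint[OF T]]] by metis
  have *: "U = R" if U: "positive_op U" and UU: "U o\<^sub>L U = T o\<^sub>L T" for U
  proof (rule blinfun_eqI)
    fix \<psi>
    have "U o\<^sub>L R = R o\<^sub>L U" by (rule c) (simp flip: UU add: blinfun_compose_assoc)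
    then have UR: "U (R \<phi>) = R (U \<phi>)" for \<phi> by (metis blinfun_apply_blinfun_compose)
    have UURR: "U (U \<phi>) = R (R \<phi>)" for \<phi> using UU R(2) by (metis blinfun_apply_blinfun_compose)
    define D where "D = U - R"
    have saD: "selfadjoint D" unfolding D_def
      by (intro selfadjoint_diff positive_selfadjoint U R)
    have D0: "U (D \<phi>) + R (D \<phi>) = 0" for \<phi>
      by (simp add: D_def blinfun.bilinear_simps UR UURR)
    have "D \<phi> \<bullet> U (D \<phi>) + D \<phi> \<bullet> R (D \<phi>) = 0" for \<phi>
      by (simp add: D0 flip: inner_add_right)
    then have "D \<phi> \<bullet> U (D \<phi>) = 0" "D \<phi> \<bullet> R (D \<phi>) = 0" for \<phi>
      using positive_inner[OF U, of "D \<phi>"] positive_inner[OF R(1), of "D \<phi>"] by (smt (verit))+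
    then have "D (D \<phi>) = 0" for \<phi>
      using positive_inner_eq_0[OF U, of "D \<phi>"] positive_inner_eq_0[OF R(1), of "D \<phi>"]
      by (simp add: D_def blinfun.diff_left)
    then have "D \<psi> \<bullet> D \<psi> = 0" by (simp add: selfadjoint_inner[OF saD])
    then show "U \<psi> = R \<psi>" by (simp add: D_def blinfun.diff_left)
  qed
  show ?thesis using *[OF S eq] *[OF T] by simp
qed

section \<open>The modulus, and approximate eigenvectors in place of a spectral theorem\<close>

lemma abs_op_eqI:
  assumes "positive_op B" "B o\<^sub>L B = adj A o\<^sub>L A" shows "abs_op A = B"
  unfolding abs_op_def
  by (rule the_equality) (use assms in \<open>auto intro: sqrt_unique\<close>)

lemma abs_op_positive_eq: "positive_op A \<Longrightarrow> abs_op A = A"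
  by (rule abs_op_eqI) (simp_all add: positive_selfadjoint[unfolded selfadjoint_iff])

lemma abs_op_selfadjoint:
  assumes "selfadjoint A"
  shows "positive_op (abs_op A)" "abs_op A o\<^sub>L abs_op A = A o\<^sub>L A" "A o\<^sub>L abs_op A = abs_op A o\<^sub>L A"
proof -
  have AA: "adj A o\<^sub>L A = A o\<^sub>L A" using assms by (simp add: selfadjoint_iff)
  obtain T where T: "positive_op T" "T o\<^sub>L T = A o\<^sub>L A" "A o\<^sub>L T = T o\<^sub>L A"
    using sqrt_exists[OF positive_square[OF assms]] by (metis blinfun_compose_assoc)
  moreover from T have "abs_op A = T" by (intro abs_op_eqI) (simp_all add: AA)
  ultimately show "positive_op (abs_op A)" "abs_op A o\<^sub>L abs_op A = A o\<^sub>L A"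
    "A o\<^sub>L abs_op A = abs_op A o\<^sub>L A" by simp_all
qed

text \<open>\<open>\<mu>\<close> is the infimum of the form on unit vectors. It need not be an
  eigenvalue, but \<open>X - \<mu>\<close> is positive, so by \<open>positive_norm_sq\<close> a unit
  vector that almost attains the infimum is almost an eigenvector.\<close>

lemma not_positive_approx:
  assumes X: "selfadjoint X" and neg: "\<not> positive_op X"
  obtains \<mu> where "\<mu> < 0" "\<And>\<psi>. \<mu> * (norm \<psi>)\<^sup>2 \<le> \<psi> \<bullet> X \<psi>"
    "\<And>e. e > 0 \<Longrightarrow> \<exists>\<psi>. norm \<psi> = 1 \<and> norm (X \<psi> - \<mu> *\<^sub>R \<psi>) < e"
proof -
  define S where "S = {\<psi> \<bullet> X \<psi> |\<psi>. norm \<psi> = 1}"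
  define \<mu> where "\<mu> = Inf S"
  have bdd: "bdd_below S"
  proof (rule bdd_belowI[where m = "- norm X"], clarsimp simp: S_def)
    fix \<psi> :: "'a ell2" assume "norm \<psi> = 1"
    then show "- norm X \<le> \<psi> \<bullet> X \<psi>"
      using Cauchy_Schwarz_ineq2[of \<psi> "X \<psi>"] norm_blinfun[of X \<psi>] by simp
  qed
  have normalize: "(\<psi> \<bullet> X \<psi>) / (norm \<psi>)\<^sup>2 \<in> S" if "\<psi> \<noteq> 0" for \<psi>
    using that unfolding S_def
    by (intro CollectI exI[of _ "(1 / norm \<psi>) *\<^sub>R \<psi>"])
      (simp add: blinfun.bilinear_simps power2_eq_square)
  from neg X obtain \<psi>\<^sub>0 where \<psi>\<^sub>0: "\<psi>\<^sub>0 \<bullet> X \<psi>\<^sub>0 < 0" by (auto simp: positive_iff not_le)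
  then have "\<psi>\<^sub>0 \<noteq> 0" by auto
  have "\<mu> \<le> (\<psi>\<^sub>0 \<bullet> X \<psi>\<^sub>0) / (norm \<psi>\<^sub>0)\<^sup>2"
    unfolding \<mu>_def by (intro cInf_lower normalize bdd \<open>\<psi>\<^sub>0 \<noteq> 0\<close>)
  also have "\<dots> < 0" using \<psi>\<^sub>0 \<open>\<psi>\<^sub>0 \<noteq> 0\<close> by (simp add: divide_neg_pos)
  finally have "\<mu> < 0" .
  have lower: "\<mu> * (norm \<psi>)\<^sup>2 \<le> \<psi> \<bullet> X \<psi>" for \<psi>
  proof (cases "\<psi> = 0")
    case False
    then have "\<mu> \<le> (\<psi> \<bullet> X \<psi>) / (norm \<psi>)\<^sup>2"
      unfolding \<mu>_def by (intro cInf_lower normalize bdd)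
    with False show ?thesis by (simp add: field_simps)
  qed simp
  define Z where "Z = X - \<mu> *\<^sub>R id_blinfun"
  have Z: "positive_op Z" unfolding positive_iff
    using lower by (auto simp: Z_def blinfun.bilinear_simps inner_diff power2_norm_eq_inner
        intro!: selfadjoint_diff selfadjoint_scaleR selfadjoint_id X)
  have "\<exists>\<psi>. norm \<psi> = 1 \<and> norm (X \<psi> - \<mu> *\<^sub>R \<psi>) < e" if "e > 0" for e
  proof -
    \<comment> \<open>Chosen so that \<open>norm Z * d < e\<^sup>2\<close>; the added 1 covers
      \<open>Z = 0\<close>.\<close>
    define d where "d = e\<^sup>2 / (norm Z + 1)"
    have "norm Z + 1 > 0" by (simp add: add_nonneg_pos)
    have "d > 0" using that \<open>norm Z + 1 > 0\<close> by (simp add: d_def)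
    have "S \<noteq> {}" using normalize[OF \<open>\<psi>\<^sub>0 \<noteq> 0\<close>] by auto
    then obtain s where "s \<in> S" "s < \<mu> + d"
      using cInf_lessD[of S "\<mu> + d"] \<open>d > 0\<close> by (auto simp: \<mu>_def)
    then obtain \<psi> where \<psi>: "norm \<psi> = 1" "\<psi> \<bullet> X \<psi> < \<mu> + d" by (auto simp: S_def)
    have "\<psi> \<bullet> Z \<psi> = \<psi> \<bullet> X \<psi> - \<mu>"
      using \<psi>(1) by (simp add: Z_def blinfun.bilinear_simps inner_diff flip: power2_norm_eq_inner)
    then have "(norm (Z \<psi>))\<^sup>2 \<le> norm Z * d"
      using \<psi>(2) by (intro order_trans[OF positive_norm_sq[OF Z]] mult_left_mono) auto
    also have "\<dots> < (norm Z + 1) * d" using \<open>d > 0\<close> by simp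
    also have "\<dots> = e\<^sup>2" using \<open>norm Z + 1 > 0\<close> by (simp add: d_def)
    finally have "norm (Z \<psi>) < e" by (rule power2_less_imp_less) (use that in simp)
    with \<psi>(1) show ?thesis by (auto simp: Z_def blinfun.bilinear_simps)
  qed
  with \<open>\<mu> < 0\<close> lower show thesis by (rule that)
qed

text \<open>Let \<open>P\<close> be the modulus and \<open>\<psi>\<close> an approximate eigenvector
  of \<open>P - A\<close> for some \<open>\<mu> < 0\<close>. Because
  \<open>(P + A) (P - A) = 0\<close>, the vector \<open>(P + A) \<psi>\<close> is small, so
  \<open>2 P \<psi> = (P - A) \<psi> + (P + A) \<psi>\<close> is close to
  \<open>\<mu> \<psi>\<close>. This contradicts positivity of \<open>P\<close>.\<close>

lemma positive_abs_diff:
  assumes A: "selfadjoint A" shows "positive_op (abs_op A - A)"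
proof (rule ccontr)
  define P where "P = abs_op A"
  note P = abs_op_selfadjoint[OF A, folded P_def]
  assume "\<not> positive_op (abs_op A - A)"
  then have neg: "\<not> positive_op (P - A)" by (simp add: P_def)
  have "selfadjoint (P - A)" using P A by (simp add: selfadjoint_diff positive_selfadjoint)
  from not_positive_approx[OF this neg] obtain \<mu> where \<mu>: "\<mu> < 0"
    and ap: "\<And>e. e > 0 \<Longrightarrow> \<exists>\<psi>. norm \<psi> = 1 \<and> norm ((P - A) \<psi> - \<mu> *\<^sub>R \<psi>) < e"
    by metis
  \<comment> \<open>\<open>C * norm r\<close> bounds the residual \<open>r\<close> together with
    \<open>(P + A) \<psi>\<close>; an approximation within \<open>- \<mu> / C\<close> therefore
    keeps the total error below \<open>- \<mu>\<close>.\<close>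
  define C where "C = 1 + norm (P + A) / \<bar>\<mu>\<bar>"
  have "C > 0" by (simp add: C_def add_pos_nonneg)
  then have "- \<mu> / C > 0" using \<mu> by (simp add: divide_neg_pos)
  then obtain \<psi> where \<psi>: "norm \<psi> = 1" and small: "norm ((P - A) \<psi> - \<mu> *\<^sub>R \<psi>) < - \<mu> / C"
    using ap by blast
  define r where "r = (P - A) \<psi> - \<mu> *\<^sub>R \<psi>"
  have PP: "P (P \<phi>) = A (A \<phi>)" "A (P \<phi>) = P (A \<phi>)" for \<phi>
    using P by (metis blinfun_apply_blinfun_compose)+
  have "(P + A) ((P - A) \<psi>) = 0"
    by (simp add: blinfun.bilinear_simps PP)
  then have "\<mu> *\<^sub>R (P + A) \<psi> = - (P + A) r"
    by (simp add: r_def blinfun.bilinear_simps algebra_simps)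
  then have "\<bar>\<mu>\<bar> * norm ((P + A) \<psi>) = norm ((P + A) r)"
    by (metis norm_minus_cancel norm_scaleR)
  also have "\<dots> \<le> norm (P + A) * norm r" by (rule norm_blinfun)
  finally have s: "norm ((P + A) \<psi>) \<le> norm (P + A) / \<bar>\<mu>\<bar> * norm r" using \<mu> by (simp add: field_simps)
  have "2 *\<^sub>R P \<psi> = \<mu> *\<^sub>R \<psi> + (r + (P + A) \<psi>)"
    by (simp add: r_def blinfun.bilinear_simps scaleR_2)
  then have "2 * (\<psi> \<bullet> P \<psi>) = \<psi> \<bullet> (\<mu> *\<^sub>R \<psi> + (r + (P + A) \<psi>))" by (metis inner_scaleR_right)
  also have "\<dots> = \<mu> + \<psi> \<bullet> (r + (P + A) \<psi>)"
    using \<psi> by (simp add: inner_add flip: power2_norm_eq_inner)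
  also have "\<psi> \<bullet> (r + (P + A) \<psi>) \<le> norm r + norm ((P + A) \<psi>)"
    using norm_cauchy_schwarz[of \<psi> "r + (P + A) \<psi>"] norm_triangle_ineq[of r "(P + A) \<psi>"] \<psi> by simp
  also have "\<dots> \<le> C * norm r" using s by (simp add: C_def algebra_simps)
  also have "\<dots> < C * (- \<mu> / C)"
    using mult_strict_left_mono[OF small \<open>C > 0\<close>] by (simp only: r_def)
  finally have "\<psi> \<bullet> P \<psi> < 0" using \<open>C > 0\<close> by simp
  with positive_inner[OF P(1), of \<psi>] show False by simp
qed

lemma positive_abs_add:
  assumes "selfadjoint A" shows "positive_op (abs_op A + A)"
proof -
  have "abs_op (- A) = abs_op A"
    using abs_op_selfadjoint[OF assms] assms
    by (intro abs_op_eqI blinfun_eqI)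
      (simp_all add: adj_scaleR[of A "-1", simplified] selfadjoint_iff blinfun.bilinear_simps)
  then show ?thesis using positive_abs_diff[OF selfadjoint_uminus[OF assms]] by simp
qed

text \<open>\<open>P + e\<close> is inverted by Banach's fixed point theorem: with
  \<open>t = 1 / (norm P + e)\<close> the operator \<open>M = 1 - t (P + e)\<close> contracts by the
  factor \<open>q = t * norm P < 1\<close>. Coercivity bounds the inverse by
  \<open>1 / e\<close>.\<close>

lemma coercive_inverse:
  fixes P :: "'a op"
  assumes P: "positive_op P" and e: "e > 0"
  obtains G :: "'a op" where "\<And>\<psi>. G (P \<psi> + e *\<^sub>R \<psi>) = \<psi>" "\<And>\<psi>. P (G \<psi>) + e *\<^sub>R G \<psi> = \<psi>"
    "clinear_op G"
proof -
  define t where "t = 1 / (norm P + e)"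
  define q where "q = 1 - t * e"
  have "norm P + e > 0" using e by (simp add: add_nonneg_pos)
  then have t: "t > 0" and q: "q = t * norm P" by (simp_all add: t_def q_def field_simps)
  have "q < 1" "q \<ge> 0" using t e by (simp_all add: q_def) (simp_all add: t_def q_def field_simps)
  define M where "M = q *\<^sub>R id_blinfun - t *\<^sub>R P"
  have M: "norm (M \<psi>) \<le> q * norm \<psi>" for \<psi>
  proof (rule power2_le_imp_le)
    have "t\<^sup>2 * (norm (P \<psi>))\<^sup>2 \<le> t\<^sup>2 * (norm P * (\<psi> \<bullet> P \<psi>))"
      by (intro mult_left_mono positive_norm_sq P) simp
    also have "\<dots> = q * t * (\<psi> \<bullet> P \<psi>)" by (simp add: q power2_eq_square)
    also have "\<dots> \<le> 2 * (q * t * (\<psi> \<bullet> P \<psi>))"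
      using positive_inner[OF P, of \<psi>] t \<open>q \<ge> 0\<close> by simp
    finally show "(norm (M \<psi>))\<^sup>2 \<le> (q * norm \<psi>)\<^sup>2"
      by (simp add: M_def blinfun.bilinear_simps power2_norm_eq_inner inner_diff inner_commute
          power2_eq_square[of q] power2_eq_square[of t] power_mult_distrib algebra_simps)
  qed (use \<open>q \<ge> 0\<close> in simp)
  define f where "f \<psi> = P \<psi> + e *\<^sub>R \<psi>" for \<psi>
  have fM: "t *\<^sub>R f \<psi> = \<psi> - M \<psi>" for \<psi>
    by (simp add: f_def M_def q_def blinfun.bilinear_simps algebra_simps)
  have lower: "e * norm \<psi> \<le> norm (f \<psi>)" for \<psi>
  proof -
    have "e * norm \<psi> * norm \<psi> = \<psi> \<bullet> (e *\<^sub>R \<psi>)"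
      by (simp add: power2_eq_square flip: power2_norm_eq_inner)
    also have "\<dots> \<le> \<psi> \<bullet> f \<psi>" using positive_inner[OF P, of \<psi>] by (simp add: f_def inner_add)
    also have "\<dots> \<le> norm (f \<psi>) * norm \<psi>" by (metis norm_cauchy_schwarz mult.commute)
    finally show ?thesis by (cases "\<psi> = 0") simp_all
  qed
  have fdiff: "f \<phi> - f \<psi> = f (\<phi> - \<psi>)" for \<phi> \<psi>
    by (simp add: f_def blinfun.bilinear_simps algebra_simps)
  have "inj f"
  proof (rule injI)
    fix \<phi> \<psi> assume "f \<phi> = f \<psi>"
    then show "\<phi> = \<psi>" using lower[of "\<phi> - \<psi>"] e fdiff[of \<phi> \<psi>] by (simp add: mult_le_0_iff)
  qed
  have "\<exists>\<psi>. f \<psi> = \<phi>" for \<phi>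
  proof -
    have "\<exists>!\<psi>. M \<psi> + t *\<^sub>R \<phi> = \<psi>"
      using \<open>q < 1\<close> \<open>q \<ge> 0\<close> M
      by (intro banach_fix_type) (auto simp: dist_norm simp flip: blinfun.diff_right)
    then obtain \<psi> where "M \<psi> + t *\<^sub>R \<phi> = \<psi>" by blast
    then have "t *\<^sub>R f \<psi> = t *\<^sub>R \<phi>" by (metis fM add_diff_cancel_left')
    then show ?thesis using t by auto
  qed
  then have "bij f" using \<open>inj f\<close> by (metis bijI surjI)
  then have fg: "f (inv f \<psi>) = \<psi>" and gf: "inv f (f \<psi>) = \<psi>" for \<psi>
    by (simp_all add: bij_inv_eq_iff bij_is_inj bij_is_surj surj_f_inv_f)
  have flin: "f (\<phi> + \<psi>) = f \<phi> + f \<psi>" "f (r *\<^sub>R \<psi>) = r *\<^sub>R f \<psi>" "f (c *\<^sub>C \<psi>) = c *\<^sub>C f \<psi>" for \<phi> \<psi> r c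
    using clinear_opD[OF positive_clinear[OF P]]
    by (simp_all add: f_def blinfun.bilinear_simps algebra_simps)
  have "bounded_linear (inv f)"
  proof (rule bounded_linear_intro[where K = "1/e"])
    show "inv f (x + y) = inv f x + inv f y" for x y by (metis fg gf flin(1))
    show "inv f (r *\<^sub>R x) = r *\<^sub>R inv f x" for r x by (metis fg gf flin(2))
    show "norm (inv f x) \<le> norm x * (1 / e)" for x
      using lower[of "inv f x"] e by (simp add: fg field_simps)
  qed
  then have app: "blinfun_apply (Blinfun (inv f)) = inv f" by (rule bounded_linear_Blinfun_apply)
  show thesis
  proof (rule that[of "Blinfun (inv f)"])
    show "clinear_op (Blinfun (inv f))" unfolding clinear_op_def app by (metis fg gf flin(3))
  qed (use fg gf in \<open>simp_all add: app f_def\<close>)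
qed

section \<open>Trace norm by duality\<close>

definition rank1 :: "'a ell2 \<Rightarrow> 'a ell2 \<Rightarrow> 'a op" where
  "rank1 \<phi> \<psi> = Blinfun (\<lambda>\<xi>. cinner \<psi> \<xi> *\<^sub>C \<phi>)"

lemma rank1_bounded_linear: "bounded_linear (\<lambda>\<xi>. cinner \<psi> \<xi> *\<^sub>C \<phi>)" for \<phi> \<psi> :: "'a ell2"
proof (rule bounded_linear_intro[where K = "norm \<phi> * norm \<psi>"])
  show "norm (cinner \<psi> \<xi> *\<^sub>C \<phi>) \<le> norm \<xi> * (norm \<phi> * norm \<psi>)" for \<xi>
    using mult_right_mono[OF cmod_cinner_le[of \<psi> \<xi>], of "norm \<phi>"]
    by (simp add: norm_scaleC mult_ac)
qed (auto intro!: ell2_eqI simp: cinner_simps coeff_simps algebra_simps)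

lemma rank1_apply [simp]: "rank1 \<phi> \<psi> \<xi> = cinner \<psi> \<xi> *\<^sub>C \<phi>"
  by (simp add: rank1_def bounded_linear_Blinfun_apply rank1_bounded_linear)

lemma clinear_rank1 [clinear]: "clinear_op (rank1 \<phi> \<psi>)"
  by (simp add: clinear_op_def cinner_simps)

lemma norm_rank1_le: "norm (rank1 \<phi> \<psi>) \<le> norm \<phi> * norm \<psi>"
  using mult_right_mono[OF cmod_cinner_le[of \<psi>], of "norm \<phi>"]
  by (intro op_norm_le) (auto simp: norm_scaleC mult_ac)

text \<open>
  For self-adjoint \<open>A\<close> this says that \<open>A\<close> is trace class with trace norm at most \<open>c\<close>.
  Linearity, limits and two-sided multiplication are immediate in this form.
\<close>

definition nuc_bound :: "'a op \<Rightarrow> real \<Rightarrow> bool" where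
  "nuc_bound A c \<longleftrightarrow> (\<forall>F (B :: 'a op) (C :: 'a op). finite F \<longrightarrow> clinear_op B \<longrightarrow> clinear_op C \<longrightarrow>
     cmod (\<Sum>x\<in>F. cinner (B (basis_vec x)) (A (C (basis_vec x)))) \<le> c * (norm B * norm C))"

lemma nuc_boundD:
  "nuc_bound A c \<Longrightarrow> finite F \<Longrightarrow> clinear_op B \<Longrightarrow> clinear_op C \<Longrightarrow>
     cmod (\<Sum>x\<in>F. cinner (B (basis_vec x)) (A (C (basis_vec x)))) \<le> c * (norm B * norm C)"
  unfolding nuc_bound_def by blast

lemma nuc_bound_nonneg:
  assumes "nuc_bound (A :: 'a op) c" shows "0 \<le> c"
proof -
  have "norm (id_blinfun :: 'a op) \<ge> 1"
    using norm_blinfun[of "id_blinfun :: 'a op" "basis_vec undefined"] by simp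
  then have "norm (id_blinfun :: 'a op) > 0" by linarith
  moreover have "0 \<le> c * (norm (id_blinfun :: 'a op) * norm (id_blinfun :: 'a op))"
    using nuc_boundD[OF assms, of "{}" id_blinfun id_blinfun] by (simp add: clinear)
  ultimately show ?thesis by (metis mult_neg_pos mult_pos_pos linorder_not_le)
qed

lemma nuc_bound_add:
  assumes "nuc_bound A a" "nuc_bound B b" shows "nuc_bound (A + B) (a + b)"
  unfolding nuc_bound_def
  using assms[THEN nuc_boundD]
  by (auto simp: blinfun.bilinear_simps cinner_simps sum.distrib distrib_right
      intro!: order_trans[OF norm_triangle_ineq] add_mono)

lemma nuc_bound_scaleR:
  assumes "nuc_bound A a" shows "nuc_bound (r *\<^sub>R A) (\<bar>r\<bar> * a)"
  unfolding nuc_bound_def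
  using mult_left_mono[OF nuc_boundD[OF assms], of _ _ _ "\<bar>r\<bar>"]
  by (auto simp: blinfun.bilinear_simps cinner_simps norm_mult mult.assoc simp flip: sum_distrib_left)

lemma nuc_bound_mono: "nuc_bound A a \<Longrightarrow> a \<le> b \<Longrightarrow> nuc_bound A b"
  unfolding nuc_bound_def by (meson mult_right_mono norm_ge_zero mult_nonneg_nonneg order_trans)

text \<open>The outer factors are absorbed into the test operators.\<close>

lemma nuc_bound_sandwich:
  assumes A: "nuc_bound A a" and S: "clinear_op S" and T: "clinear_op T"
  shows "nuc_bound (S o\<^sub>L A o\<^sub>L T) (norm S * a * norm T)"
  unfolding nuc_bound_def
proof (intro allI impI)
  fix F :: "'a set" and B C :: "'a op" assume F: "finite F" "clinear_op B" "clinear_op C"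
  have "cmod (\<Sum>x\<in>F. cinner (B (basis_vec x)) ((S o\<^sub>L A o\<^sub>L T) (C (basis_vec x))))
      = cmod (\<Sum>x\<in>F. cinner ((adj S o\<^sub>L B) (basis_vec x)) (A ((T o\<^sub>L C) (basis_vec x))))"
    using S by (simp add: adj_cinner')
  also have "\<dots> \<le> a * (norm (adj S o\<^sub>L B) * norm (T o\<^sub>L C))"
    using F S T by (intro nuc_boundD[OF A]) (auto simp: clinear)
  also have "\<dots> \<le> a * ((norm S * norm B) * (norm T * norm C))"
    using norm_blinfun_compose[of "adj S" B] norm_blinfun_compose[of T C] norm_adj[OF S]
    by (intro mult_left_mono mult_mono nuc_bound_nonneg[OF A]) auto
  finally show "cmod (\<Sum>x\<in>F. cinner (B (basis_vec x)) ((S o\<^sub>L A o\<^sub>L T) (C (basis_vec x))))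
      \<le> norm S * a * norm T * (norm B * norm C)"
    by (simp add: mult_ac)
qed

text \<open>Rank-one test operators over a single basis vector turn the test sum into
  \<open>cinner \<phi> (A \<psi>)\<close>.\<close>

lemma op_norm_le_nuc_bound:
  assumes "nuc_bound A c" shows "norm A \<le> c"
proof (rule op_norm_le_cinner)
  show c: "0 \<le> c" by (rule nuc_bound_nonneg[OF assms])
  fix \<phi> \<psi>
  let ?e = "basis_vec undefined"
  have "cmod (cinner \<phi> (A \<psi>)) \<le> c * (norm (rank1 \<phi> ?e) * norm (rank1 \<psi> ?e))"
    using nuc_boundD[OF assms, of "{undefined}" "rank1 \<phi> ?e" "rank1 \<psi> ?e"]
    by (simp add: clinear cinner_basis_vec coeff_simps)
  also have "\<dots> \<le> c * (norm \<phi> * norm \<psi>)"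
    using norm_rank1_le[of \<phi> ?e] norm_rank1_le[of \<psi> ?e] c by (intro mult_left_mono mult_mono) auto
  finally show "cmod (cinner \<phi> (A \<psi>)) \<le> c * norm \<phi> * norm \<psi>" by (simp add: mult_ac)
qed

text \<open>Each test sum involves finitely many matrix elements, so convergence in operator norm
  preserves the bound. Completeness in trace norm will rest on this.\<close>

lemma nuc_bound_limit:
  assumes X: "X \<longlonglongrightarrow> A" and ev: "eventually (\<lambda>n. nuc_bound (X n) c) sequentially"
  shows "nuc_bound A c"
  unfolding nuc_bound_def
proof (intro allI impI)
  fix F :: "'a set" and B C :: "'a op" assume F: "finite F" "clinear_op B" "clinear_op C"
  show "cmod (\<Sum>x\<in>F. cinner (B (basis_vec x)) (A (C (basis_vec x)))) \<le> c * (norm B * norm C)"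
  proof (rule tendsto_upperbound)
    show "(\<lambda>n. cmod (\<Sum>x\<in>F. cinner (B (basis_vec x)) (X n (C (basis_vec x)))))
        \<longlonglongrightarrow> cmod (\<Sum>x\<in>F. cinner (B (basis_vec x)) (A (C (basis_vec x))))"
      by (intro tendsto_norm tendsto_sum tendsto_cinner tendsto_const blinfun.tendsto X)
    show "\<forall>\<^sub>F n in sequentially. cmod (\<Sum>x\<in>F. cinner (B (basis_vec x)) (X n (C (basis_vec x))))
        \<le> c * (norm B * norm C)"
      using ev F by (auto elim!: eventually_mono intro: nuc_boundD)
  qed simp
qed

lemma has_sum_finite_sum:
  fixes f :: "'b \<Rightarrow> 'a \<Rightarrow> 'c :: topological_comm_monoid_add"
  assumes "finite F" "\<And>y. y \<in> F \<Longrightarrow> (f y has_sum s y) A"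
  shows "((\<lambda>x. \<Sum>y\<in>F. f y x) has_sum (\<Sum>y\<in>F. s y)) A"
  using assms by (induction F rule: finite_induct) (auto intro: has_sum_add)

subsection \<open>Hilbert-Schmidt operators\<close>

text \<open>Here \<open>c\<close> bounds the square of the Hilbert-Schmidt norm.\<close>

definition hs_bound :: "'a op \<Rightarrow> real \<Rightarrow> bool" where
  "hs_bound T c \<longleftrightarrow> (\<forall>F. finite F \<longrightarrow> (\<Sum>x\<in>F. (norm (T (basis_vec x)))\<^sup>2) \<le> c)"

lemma hs_bound_nonneg: "hs_bound T c \<Longrightarrow> 0 \<le> c"
  unfolding hs_bound_def by (metis finite.emptyI sum.empty)

text \<open>The sum of the squared moduli of all matrix entries does not see transposition; only the
  order of summation changes.\<close>

lemma hs_bound_adj: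
  assumes T: "clinear_op T" and c: "hs_bound T c" shows "hs_bound (adj T) c"
  unfolding hs_bound_def
proof (intro allI impI)
  fix F :: "'a set" assume F: "finite F"
  let ?m = "\<lambda>x y. (cmod (coeff (T (basis_vec x)) y))\<^sup>2"
  have m: "cmod (coeff (adj T (basis_vec y)) x) = cmod (coeff (T (basis_vec x)) y)" for x y
    using T by (metis adj_cinner cinner_basis_vec cinner_commute complex_mod_cnj)
  have "((\<lambda>x. \<Sum>y\<in>F. ?m x y) has_sum (\<Sum>y\<in>F. (norm (adj T (basis_vec y)))\<^sup>2)) UNIV"
    using norm_sq_has_sum[of "adj T (basis_vec _)"] by (intro has_sum_finite_sum F) (simp add: m)
  then show "(\<Sum>y\<in>F. (norm (adj T (basis_vec y)))\<^sup>2) \<le> c"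
  proof (rule has_sum_le_finite_sums)
    fix G :: "'a set" assume G: "finite G"
    have "(\<Sum>x\<in>G. \<Sum>y\<in>F. ?m x y) \<le> (\<Sum>x\<in>G. (norm (T (basis_vec x)))\<^sup>2)"
      by (intro sum_mono sum_coeff_le_norm F)
    also have "\<dots> \<le> c" using c G by (simp add: hs_bound_def)
    finally show "(\<Sum>x\<in>G. \<Sum>y\<in>F. ?m x y) \<le> c" .
  qed
qed

lemma hs_bound_compose_left:
  assumes "hs_bound T c" shows "hs_bound (A o\<^sub>L T) ((norm A)\<^sup>2 * c)"
  unfolding hs_bound_def
proof (intro allI impI)
  fix F :: "'a set" assume F: "finite F"
  have "(\<Sum>x\<in>F. (norm ((A o\<^sub>L T) (basis_vec x)))\<^sup>2) \<le> (\<Sum>x\<in>F. (norm A)\<^sup>2 * (norm (T (basis_vec x)))\<^sup>2)"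
    unfolding power_mult_distrib[symmetric] blinfun_apply_blinfun_compose
    by (intro sum_mono power_mono norm_blinfun) simp
  also have "\<dots> \<le> (norm A)\<^sup>2 * c"
    using assms F unfolding hs_bound_def by (simp flip: sum_distrib_left add: mult_left_mono)
  finally show "(\<Sum>x\<in>F. (norm ((A o\<^sub>L T) (basis_vec x)))\<^sup>2) \<le> (norm A)\<^sup>2 * c" .
qed

lemma hs_bound_compose_right:
  assumes "hs_bound T c" "clinear_op T" "clinear_op C" shows "hs_bound (T o\<^sub>L C) ((norm C)\<^sup>2 * c)"
proof -
  have "hs_bound (adj C o\<^sub>L adj T) ((norm C)\<^sup>2 * c)"
    using hs_bound_compose_left[OF hs_bound_adj[OF assms(2,1)], of "adj C"] assms by (simp add: norm_adj)
  then have "hs_bound (adj (T o\<^sub>L C)) ((norm C)\<^sup>2 * c)" using assms by (simp add: adj_compose)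
  from hs_bound_adj[OF _ this] show ?thesis using assms by (simp add: clinear adj_adj)
qed

text \<open>Cauchy-Schwarz for the sum over \<open>F\<close>, the test operators being absorbed as
  right factors of \<open>S\<close> and \<open>T\<close>.\<close>

lemma nuc_bound_hs:
  assumes S: "clinear_op S" "hs_bound S (a\<^sup>2)" and T: "clinear_op T" "hs_bound T (b\<^sup>2)"
    and ab: "0 \<le> a" "0 \<le> b"
  shows "nuc_bound (adj S o\<^sub>L T) (a * b)"
  unfolding nuc_bound_def
proof (intro allI impI)
  fix F :: "'a set" and B C :: "'a op" assume F: "finite F" "clinear_op B" "clinear_op C"
  have L2: "L2_set (\<lambda>x. norm (U (D (basis_vec x)))) F \<le> norm D * d"
    if "clinear_op U" "hs_bound U (d\<^sup>2)" "0 \<le> d" "clinear_op D" for U D :: "'a op" and d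
  proof -
    have "(\<Sum>x\<in>F. (norm ((U o\<^sub>L D) (basis_vec x)))\<^sup>2) \<le> (norm D)\<^sup>2 * d\<^sup>2"
      using hs_bound_compose_right[OF that(2,1,4)] F unfolding hs_bound_def by blast
    then show ?thesis using that unfolding L2_set_def
      by (intro real_le_lsqrt) (auto simp: power_mult_distrib intro!: sum_nonneg)
  qed
  have "cmod (\<Sum>x\<in>F. cinner (B (basis_vec x)) ((adj S o\<^sub>L T) (C (basis_vec x))))
      = cmod (\<Sum>x\<in>F. cinner (S (B (basis_vec x))) (T (C (basis_vec x))))"
    using S by (simp add: adj_cinner)
  also have "\<dots> \<le> (\<Sum>x\<in>F. \<bar>norm (S (B (basis_vec x)))\<bar> * \<bar>norm (T (C (basis_vec x)))\<bar>)"
    by (intro order_trans[OF norm_sum] sum_mono) (simp add: cmod_cinner_le)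
  also have "\<dots> \<le> L2_set (\<lambda>x. norm (S (B (basis_vec x)))) F * L2_set (\<lambda>x. norm (T (C (basis_vec x)))) F"
    by (rule L2_set_mult_ineq)
  also have "\<dots> \<le> (norm B * a) * (norm C * b)"
    using S T ab F by (intro mult_mono L2) auto
  finally show "cmod (\<Sum>x\<in>F. cinner (B (basis_vec x)) ((adj S o\<^sub>L T) (C (basis_vec x))))
      \<le> a * b * (norm B * norm C)"
    by (simp add: mult_ac)
qed

subsection \<open>Comparison with the definition of the trace norm\<close>

text \<open>For self-adjoint operators the real part loses nothing
  (\<open>diag_selfadjoint\<close>), and traces become real sums.\<close>

definition diag :: "'a op \<Rightarrow> 'a \<Rightarrow> real" where
  "diag A x = Re (coeff (A (basis_vec x)) x)"

lemma diag_eq_inner: "diag A x = basis_vec x \<bullet> A (basis_vec x)"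
  by (simp add: diag_def cinner_basis_vec flip: Re_cinner)

lemma diag_simps: "diag (A + B) x = diag A x + diag B x" "diag (A - B) x = diag A x - diag B x"
  "diag (r *\<^sub>R A) x = r * diag A x" "diag (- A) x = - diag A x"
  by (simp_all add: diag_def blinfun.bilinear_simps coeff_simps)

lemma diag_nonneg: "positive_op A \<Longrightarrow> 0 \<le> diag A x"
  by (simp add: diag_eq_inner positive_inner)

lemma diag_selfadjoint:
  assumes "selfadjoint A" shows "cinner (basis_vec x) (A (basis_vec x)) = of_real (diag A x)"
proof -
  have "cnj (cinner (basis_vec x) (A (basis_vec x))) = cinner (basis_vec x) (A (basis_vec x))"
    using assms by (metis cinner_commute selfadjoint_cinner)
  then have "Im (cinner (basis_vec x) (A (basis_vec x))) = 0" by (simp add: complex_eq_iff)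
  then show ?thesis by (simp add: complex_eq_iff diag_def cinner_basis_vec)
qed

lemma positive_hs_root:
  assumes A: "positive_op A" and c: "\<And>F. finite F \<Longrightarrow> (\<Sum>x\<in>F. diag A x) \<le> c"
  obtains T where "selfadjoint T" "A = T o\<^sub>L T" "hs_bound T c" "\<And>x. (norm (T (basis_vec x)))\<^sup>2 = diag A x"
proof -
  obtain T where T: "positive_op T" "T o\<^sub>L T = A" using sqrt_exists[OF A] by metis
  then have sa: "selfadjoint T" by (simp add: positive_selfadjoint)
  have "(norm (T (basis_vec x)))\<^sup>2 = diag A x" for x
    unfolding T(2)[symmetric]
    using selfadjoint_inner[OF sa, of "basis_vec x" "T (basis_vec x)"]
    by (simp add: diag_eq_inner power2_norm_eq_inner)
  with sa T c show thesis by (intro that[of T]) (auto simp: hs_bound_def)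
qed

text \<open>The square root of \<open>A\<close> is Hilbert-Schmidt with squared norm at most
  \<open>c\<close>, and \<open>A\<close> is its square.\<close>

lemma nuc_bound_positive:
  assumes A: "positive_op A" and c: "\<And>F. finite F \<Longrightarrow> (\<Sum>x\<in>F. diag A x) \<le> c"
  shows "nuc_bound A c"
proof -
  obtain T where T: "selfadjoint T" "A = T o\<^sub>L T" "hs_bound T c"
    using positive_hs_root[OF assms] by metis
  have "0 \<le> c" by (rule hs_bound_nonneg[OF T(3)])
  then have "nuc_bound (adj T o\<^sub>L T) (sqrt c * sqrt c)"
    using T by (intro nuc_bound_hs) (auto simp: clinear)
  then show ?thesis using T \<open>0 \<le> c\<close> by (simp add: selfadjoint_iff)
qed

text \<open>The converse estimate, by a regularized polar decomposition. With \<open>P\<close> the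
  modulus and \<open>G\<close> the inverse of \<open>P + e\<close>, the test operator
  \<open>A o\<^sub>L G\<close> is a contraction that approximates the sign of \<open>A\<close>.
  Pairing it with \<open>A\<close> reproduces the diagonal of \<open>P\<close> up to
  \<open>e\<close> per basis vector, and \<open>e\<close> is arbitrary.\<close>

lemma sum_diag_abs_le:
  fixes A :: "'a op"
  assumes A: "selfadjoint A" and c: "nuc_bound A c" and F: "finite F"
  shows "(\<Sum>x\<in>F. diag (abs_op A) x) \<le> c"
proof -
  define P where "P = abs_op A"
  note P = abs_op_selfadjoint[OF A, folded P_def]
  have PP: "A (A \<psi>) = P (P \<psi>)" for \<psi> using P(2) by (metis blinfun_apply_blinfun_compose)
  have saP: "cinner (P \<phi>) \<psi> = cinner \<phi> (P \<psi>)" for \<phi> \<psi>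
    by (rule selfadjoint_cinner[OF positive_selfadjoint[OF P(1)]])
  have *: "(\<Sum>x\<in>F. diag P x) \<le> c + e * real (card F)" if e: "e > 0" for e :: real
  proof -
    obtain G :: "'a op" where G: "\<And>\<psi>. P (G \<psi>) + e *\<^sub>R G \<psi> = \<psi>" "clinear_op G"
      using coercive_inverse[OF P(1) e] by metis
    have PG: "norm (P (G \<psi>)) \<le> norm \<psi>" for \<psi>
    proof (rule power2_le_imp_le)
      have "(norm (P (G \<psi>)))\<^sup>2 \<le> (norm (P (G \<psi>)))\<^sup>2 + 2 * e * (G \<psi> \<bullet> P (G \<psi>)) + e\<^sup>2 * (norm (G \<psi>))\<^sup>2"
        using positive_inner[OF P(1), of "G \<psi>"] e by simp
      also have "\<dots> = (norm (P (G \<psi>) + e *\<^sub>R G \<psi>))\<^sup>2"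
        by (simp add: power2_norm_eq_inner inner_add inner_commute power2_eq_square[of e] algebra_simps)
      finally show "(norm (P (G \<psi>)))\<^sup>2 \<le> (norm \<psi>)\<^sup>2" by (simp add: G)
    qed simp
    have "norm (A (G \<psi>)) = norm (P (G \<psi>))" for \<psi>
    proof (rule power2_eq_imp_eq)
      have "A (G \<psi>) \<bullet> A (G \<psi>) = P (G \<psi>) \<bullet> P (G \<psi>)"
        using selfadjoint_inner[OF A, of "G \<psi>" "A (G \<psi>)"]
          selfadjoint_inner[OF positive_selfadjoint[OF P(1)], of "G \<psi>" "P (G \<psi>)"]
        by (simp add: PP)
      then show "(norm (A (G \<psi>)))\<^sup>2 = (norm (P (G \<psi>)))\<^sup>2" by (simp add: power2_norm_eq_inner)
    qed auto
    then have nS: "norm (A o\<^sub>L G) \<le> 1" using PG by (intro op_norm_le) auto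
    have AG: "cinner (A (G \<psi>)) (A \<psi>) = cinner \<psi> (P \<psi>) - of_real e * cinner (P (G \<psi>)) \<psi>" for \<psi>
    proof -
      have "cinner (A (G \<psi>)) (A \<psi>) = cinner (P (G \<psi>)) (P \<psi>)"
        by (simp add: selfadjoint_cinner[OF A] PP saP)
      also have "P (G \<psi>) = \<psi> - e *\<^sub>R G \<psi>" using G(1)[of \<psi>] by (simp add: algebra_simps)
      finally show ?thesis by (simp add: cinner_simps saP)
    qed
    have "diag P x \<le> Re (cinner (A (G (basis_vec x))) (A (basis_vec x))) + e" for x
    proof -
      have "cmod (cinner (P (G (basis_vec x))) (basis_vec x)) \<le> 1"
        using cmod_cinner_le[of "P (G (basis_vec x))" "basis_vec x"] PG[of "basis_vec x"] by simp
      then have "Re (cinner (P (G (basis_vec x))) (basis_vec x)) \<le> 1"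
        using complex_Re_le_cmod order_trans by blast
      then have "e * Re (cinner (P (G (basis_vec x))) (basis_vec x)) \<le> e" using e by simp
      then show ?thesis by (simp add: AG diag_def cinner_basis_vec)
    qed
    then have "(\<Sum>x\<in>F. diag P x)
        \<le> (\<Sum>x\<in>F. Re (cinner (A (G (basis_vec x))) (A (basis_vec x))) + e)"
      by (intro sum_mono)
    also have "\<dots> = Re (\<Sum>x\<in>F. cinner ((A o\<^sub>L G) (basis_vec x)) (A (id_blinfun (basis_vec x)))) + e * card F"
      by (simp add: sum.distrib)
    also have "Re (\<Sum>x\<in>F. cinner ((A o\<^sub>L G) (basis_vec x)) (A (id_blinfun (basis_vec x))))
        \<le> c * (norm (A o\<^sub>L G) * norm (id_blinfun :: 'a op))"
      using F G A by (intro order_trans[OF complex_Re_le_cmod nuc_boundD[OF c]]) (simp_all add: clinear)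
    also have "\<dots> \<le> c * (1 * 1)"
      by (intro mult_left_mono mult_mono nS norm_blinfun_id_le nuc_bound_nonneg[OF c]) auto
    finally show ?thesis by simp
  qed
  have "(\<Sum>x\<in>F. diag P x) \<le> c + d" if d: "d > 0" for d
  proof -
    have "d / (real (card F) + 1) * real (card F) \<le> d"
      using d by (simp add: divide_simps)
    moreover have "(\<Sum>x\<in>F. diag P x) \<le> c + d / (real (card F) + 1) * real (card F)"
      using d by (intro * divide_pos_pos) auto
    ultimately show ?thesis by linarith
  qed
  then have "(\<Sum>x\<in>F. diag P x) \<le> c" by (rule field_le_epsilon)
  then show ?thesis by (simp add: P_def)
qed

lemma abs_diag_le: "selfadjoint A \<Longrightarrow> \<bar>diag A x\<bar> \<le> diag (abs_op A) x"
  using diag_nonneg[OF positive_abs_diff, of A x] diag_nonneg[OF positive_abs_add, of A x]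
  by (simp add: diag_simps)

lemma trace_norm_has_sum:
  assumes "A \<in> sa_trace_class" shows "(diag (abs_op A) has_sum trace_norm A) UNIV"
proof -
  have sa: "selfadjoint A" using assms by (simp add: sa_trace_class_def)
  have eq: "cinner (basis_vec x) (abs_op A (basis_vec x)) = of_real (diag (abs_op A) x)" for x
    by (intro diag_selfadjoint positive_selfadjoint abs_op_selfadjoint sa)
  have "(\<lambda>x. complex_of_real (diag (abs_op A) x)) summable_on UNIV"
    using assms by (simp add: sa_trace_class_def trace_class_def eq)
  from summable_on_Re[OF this] infsum_Re[OF this]
  have "diag (abs_op A) summable_on UNIV" "trace_norm A = infsum (diag (abs_op A)) UNIV"
    by (simp_all add: trace_norm_def op_trace_def eq)
  then show ?thesis by (simp only: has_sum_infsum)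
qed

text \<open>\<open>A\<close> is half the difference of the positive operators \<open>?p\<close> and
  \<open>?q\<close>, whose traces add up to twice the trace norm.\<close>

lemma nuc_bound_trace_norm:
  assumes "A \<in> sa_trace_class" shows "nuc_bound A (trace_norm A)"
proof -
  have sa: "selfadjoint A" using assms by (simp add: sa_trace_class_def)
  note hs = trace_norm_has_sum[OF assms]
  have s: "diag B summable_on UNIV" if "\<And>x. \<bar>diag B x\<bar> \<le> 2 * diag (abs_op A) x" for B
    using that summable_on_cmult_right[OF has_sum_imp_summable[OF hs], of 2]
    by (auto intro: abs_summable_summable[OF Infinite_Sum.abs_summable_on_comparison_test'])
  let ?p = "abs_op A + A" and ?q = "abs_op A - A"
  have pos: "positive_op ?p" "positive_op ?q"
    using sa by (simp_all add: positive_abs_add positive_abs_diff)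
  have "diag ?p summable_on UNIV" "diag ?q summable_on UNIV"
    using abs_diag_le[OF sa] by (intro s; simp add: diag_simps abs_le_iff; smt (verit))+
  then have pq: "(diag ?p has_sum infsum (diag ?p) UNIV) UNIV" "(diag ?q has_sum infsum (diag ?q) UNIV) UNIV"
    by (simp_all add: has_sum_infsum)
  have "((\<lambda>x. diag ?p x + diag ?q x) has_sum infsum (diag ?p) UNIV + infsum (diag ?q) UNIV) UNIV"
    by (intro has_sum_add pq)
  moreover have "(\<lambda>x. diag ?p x + diag ?q x) = (\<lambda>x. 2 * diag (abs_op A) x)"
    by (auto simp: diag_simps)
  ultimately have sum: "infsum (diag ?p) UNIV + infsum (diag ?q) UNIV = 2 * trace_norm A"
    using has_sum_cmult_right[OF hs, of 2] by (metis has_sum_unique)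
  have "nuc_bound B (infsum (diag B) UNIV)" if "positive_op B" "diag B summable_on UNIV" for B
    using that by (intro nuc_bound_positive finite_sum_le_infsum) (auto simp: diag_nonneg)
  then have "nuc_bound ((1/2) *\<^sub>R ?p + (-1/2) *\<^sub>R ?q)
      (\<bar>1/2\<bar> * infsum (diag ?p) UNIV + \<bar>-1/2\<bar> * infsum (diag ?q) UNIV)"
    using pos pq by (intro nuc_bound_add nuc_bound_scaleR) (auto simp: summable_on_def)
  moreover have "(1/2) *\<^sub>R ?p + (-1/2) *\<^sub>R ?q = A"
    by (simp add: scaleR_diff_right scaleR_add_right flip: scaleR_add_left)
  moreover have "\<bar>1/2\<bar> * infsum (diag ?p) UNIV + \<bar>-1/2\<bar> * infsum (diag ?q) UNIV = trace_norm A"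
    using sum by simp
  ultimately show ?thesis by metis
qed

lemma sa_trace_classI:
  assumes sa: "selfadjoint A" and c: "nuc_bound A c"
  shows "A \<in> sa_trace_class" "trace_norm A \<le> c"
proof -
  have eq: "cinner (basis_vec x) (abs_op A (basis_vec x)) = of_real (diag (abs_op A) x)" for x
    by (intro diag_selfadjoint positive_selfadjoint abs_op_selfadjoint sa)
  have "diag (abs_op A) summable_on UNIV"
    by (rule nonneg_bdd_above_summable_on)
      (auto intro!: bdd_aboveI2[where M = c] sum_diag_abs_le sa c diag_nonneg abs_op_selfadjoint)
  then show *: "A \<in> sa_trace_class"
    using sa by (simp add: sa_trace_class_def trace_class_def eq clinear summable_on_of_real)
  show "trace_norm A \<le> c"
    using trace_norm_has_sum[OF *] by (rule has_sum_le_finite_sums) (rule sum_diag_abs_le[OF sa c])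
qed

lemma sa_trace_class_diag_summable:
  assumes "A \<in> sa_trace_class"
  shows "diag A summable_on UNIV" "\<bar>infsum (diag A) UNIV\<bar> \<le> trace_norm A"
proof -
  have sa: "selfadjoint A" using assms by (simp add: sa_trace_class_def)
  note hs = trace_norm_has_sum[OF assms]
  show s: "diag A summable_on UNIV"
    using abs_diag_le[OF sa] has_sum_imp_summable[OF hs]
    by (auto intro: abs_summable_summable[OF Infinite_Sum.abs_summable_on_comparison_test'])
  note d = has_sum_infsum[OF s]
  have "infsum (diag A) UNIV \<le> trace_norm A"
    using abs_diag_le[OF sa] by (intro has_sum_mono[OF d hs]) (simp add: abs_le_iff)
  moreover have "- infsum (diag A) UNIV \<le> trace_norm A"
    using abs_diag_le[OF sa] by (intro has_sum_mono[OF has_sum_uminusI[OF d] hs]) (simp add: abs_le_iff)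
  ultimately show "\<bar>infsum (diag A) UNIV\<bar> \<le> trace_norm A" by linarith
qed

lemma op_trace_sa:
  assumes "A \<in> sa_trace_class" shows "op_trace A = of_real (infsum (diag A) UNIV)"
proof -
  have sa: "selfadjoint A" using assms by (simp add: sa_trace_class_def)
  show ?thesis
    using has_sum_of_real[OF has_sum_infsum[OF sa_trace_class_diag_summable(1)[OF assms]]]
    unfolding op_trace_def diag_selfadjoint[OF sa] by (rule infsumI)
qed

subsection \<open>Finite sections\<close>

definition proj :: "'a set \<Rightarrow> 'a op" where
  "proj F = (\<Sum>x\<in>F. rank1 (basis_vec x) (basis_vec x))"

lemma coeff_proj: "finite F \<Longrightarrow> coeff (proj F \<psi>) x = (if x \<in> F then coeff \<psi> x else 0)"
  by (simp add: proj_def blinfun.sum_left coeff_sum coeff_simps cinner_basis_vec if_distrib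
      cong: if_cong)

lemma clinear_proj [clinear]: "clinear_op (proj F)"
  unfolding proj_def by (induction F rule: infinite_finite_induct) (auto simp: clinear)

lemma selfadjoint_proj: "selfadjoint (proj F)"
proof -
  have "cinner \<phi> (basis_vec x) = cnj (coeff \<phi> x)" for \<phi> and x :: 'a
    by (metis cinner_basis_vec cinner_commute)
  then show ?thesis unfolding selfadjoint_def
    using clinear_proj[of F] by (simp add: proj_def blinfun.sum_left cinner_sum_left
        cinner_sum_right cinner_simps cinner_basis_vec mult.commute)
qed

lemma norm_proj_apply_le:
  assumes "finite F" shows "norm (proj F \<psi>) \<le> norm \<psi>"
proof (rule power2_le_imp_le)
  have "proj F \<psi> = (\<Sum>x\<in>F. coeff \<psi> x *\<^sub>C basis_vec x)"
    by (simp add: proj_def blinfun.sum_left cinner_basis_vec)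
  then show "(norm (proj F \<psi>))\<^sup>2 \<le> (norm \<psi>)\<^sup>2"
    using norm_sum_basis[OF assms, of "coeff \<psi>"] sum_coeff_le_norm[OF assms, of \<psi>] by simp
qed simp

lemma norm_proj_le: "finite F \<Longrightarrow> norm (proj F) \<le> 1"
  by (intro op_norm_le) (auto simp: norm_proj_apply_le)

lemma proj_basis_vec: "finite F \<Longrightarrow> proj F (basis_vec x) = (if x \<in> F then basis_vec x else 0)"
  by (rule ell2_eqI) (simp add: coeff_proj coeff_simps)

text \<open>
  With \<open>A = T\<^sup>2\<close> the difference is \<open>(T(1 - P))\<^sup>* T + (T P)\<^sup>* T(1 - P)\<close>, where \<open>T(1 - P)\<close> is
  small in Hilbert-Schmidt norm.
\<close>

lemma positive_finite_sections:
  assumes A: "positive_op A" "A \<in> sa_trace_class" and e: "e > 0"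
  obtains F\<^sub>0 where "finite F\<^sub>0"
    "\<And>F. finite F \<Longrightarrow> F\<^sub>0 \<subseteq> F \<Longrightarrow> nuc_bound (A - (proj F o\<^sub>L A o\<^sub>L proj F)) e"
proof -
  define c where "c = trace_norm A"
  have hs: "(diag A has_sum c) UNIV"
    using trace_norm_has_sum[OF A(2)] by (simp add: abs_op_positive_eq A(1) c_def)
  have fin: "(\<Sum>x\<in>F. diag A x) \<le> c" if "finite F" for F
    using that A(1) by (intro has_sum_mono2[OF has_sum_finite hs]) (auto simp: diag_nonneg)
  then obtain T where T: "selfadjoint T" "A = T o\<^sub>L T" "hs_bound T c"
      "\<And>x. (norm (T (basis_vec x)))\<^sup>2 = diag A x"
    using positive_hs_root[OF A(1)] by metis
  have "c \<ge> 0" by (rule hs_bound_nonneg[OF T(3)])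
  \<comment> \<open>Makes \<open>2 * (sqrt c * d)\<close> at most \<open>e\<close>; the added 1
    keeps the denominator positive when \<open>c = 0\<close>.\<close>
  define d where "d = e / (2 * (sqrt c + 1))"
  have d: "d > 0" using e \<open>c \<ge> 0\<close> by (simp add: d_def add_nonneg_pos)
  have "eventually (\<lambda>F. dist (sum (diag A) F) c < d\<^sup>2) (finite_subsets_at_top UNIV)"
    using hs d unfolding has_sum_def tendsto_iff by auto
  then obtain F\<^sub>0 where F0: "finite F\<^sub>0" "\<And>F. finite F \<Longrightarrow> F\<^sub>0 \<subseteq> F \<Longrightarrow> dist (sum (diag A) F) c < d\<^sup>2"
    unfolding eventually_finite_subsets_at_top by auto
  show thesis
  proof (rule that[OF F0(1)])
    fix F assume F: "finite F" "F\<^sub>0 \<subseteq> F"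
    define Q where "Q = id_blinfun - proj F"
    have Q: "selfadjoint Q" unfolding Q_def by (intro selfadjoint_diff selfadjoint_id selfadjoint_proj)
    have TQ: "hs_bound (T o\<^sub>L Q) (d\<^sup>2)"
      unfolding hs_bound_def
    proof (intro allI impI)
      fix G assume G: "finite (G :: 'a set)"
      have "(\<Sum>x\<in>G. (norm ((T o\<^sub>L Q) (basis_vec x)))\<^sup>2) = (\<Sum>x\<in>G - F. diag A x)"
        using G F by (intro sum.mono_neutral_cong_right)
          (auto simp: Q_def blinfun.bilinear_simps proj_basis_vec T(4))
      also have "\<dots> = (\<Sum>x\<in>F \<union> G. diag A x) - (\<Sum>x\<in>F. diag A x)"
        using G F by (simp add: sum_diff[symmetric] Un_Diff)
      also have "\<dots> \<le> c - (\<Sum>x\<in>F. diag A x)" using fin[of "F \<union> G"] F G by simp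
      also have "\<dots> \<le> d\<^sup>2" using F0(2)[OF F] by (simp add: dist_real_def)
      finally show "(\<Sum>x\<in>G. (norm ((T o\<^sub>L Q) (basis_vec x)))\<^sup>2) \<le> d\<^sup>2" .
    qed
    have hT: "hs_bound T ((sqrt c)\<^sup>2)" using T(3) \<open>c \<ge> 0\<close> by simp
    have "nuc_bound (adj (T o\<^sub>L Q) o\<^sub>L T) (d * sqrt c)"
      using T Q TQ hT d \<open>c \<ge> 0\<close> by (intro nuc_bound_hs) (auto simp: clinear)
    moreover have "hs_bound (T o\<^sub>L proj F) ((norm (proj F))\<^sup>2 * c)"
      using T by (intro hs_bound_compose_right) (auto simp: clinear)
    then have "hs_bound (T o\<^sub>L proj F) ((norm (proj F) * sqrt c)\<^sup>2)" using \<open>c \<ge> 0\<close> by (simp add: power_mult_distrib)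
    then have "nuc_bound (adj (T o\<^sub>L proj F) o\<^sub>L (T o\<^sub>L Q)) ((norm (proj F) * sqrt c) * d)"
      using T Q TQ d \<open>c \<ge> 0\<close> by (intro nuc_bound_hs) (auto simp: clinear)
    ultimately have "nuc_bound ((adj (T o\<^sub>L Q) o\<^sub>L T) + (adj (T o\<^sub>L proj F) o\<^sub>L (T o\<^sub>L Q)))
        (d * sqrt c + (norm (proj F) * sqrt c) * d)"
      by (rule nuc_bound_add)
    moreover have "(adj (T o\<^sub>L Q) o\<^sub>L T) + (adj (T o\<^sub>L proj F) o\<^sub>L (T o\<^sub>L Q)) = A - (proj F o\<^sub>L A o\<^sub>L proj F)"
      using T(1) Q selfadjoint_proj[of F]
      by (intro blinfun_eqI)
        (simp add: selfadjoint_iff adj_compose T(2), simp add: Q_def blinfun.bilinear_simps)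
    moreover have "d * sqrt c + (norm (proj F) * sqrt c) * d \<le> e"
    proof -
      have "(norm (proj F) * sqrt c) * d \<le> (1 * sqrt c) * d"
        using d \<open>c \<ge> 0\<close> norm_proj_le[OF F(1)] by (intro mult_right_mono) auto
      moreover have "2 * (sqrt c * d) \<le> e"
        using e \<open>c \<ge> 0\<close> by (simp add: d_def divide_simps add_nonneg_eq_0_iff)
          (smt (verit) mult_nonneg_nonneg real_sqrt_ge_zero)
      ultimately show ?thesis by (simp add: algebra_simps)
    qed
    ultimately show "nuc_bound (A - (proj F o\<^sub>L A o\<^sub>L proj F)) e"
      by (metis nuc_bound_mono)
  qed
qed

section \<open>Contraction semigroups from dissipative relations\<close>

text \<open>Bounded operators as a type of their own, so that they form a Banach algebra with an exponential.\<close>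

typedef (overloaded) 'v endo = "UNIV :: ('v::real_normed_vector \<Rightarrow>\<^sub>L 'v) set"
  morphisms endo_op Endo ..

setup_lifting type_definition_endo

text \<open>The sort \<open>perfect_space\<close> excludes the zero space, in which the identity
  would have norm 0 instead of 1.\<close>

instantiation endo :: ("{banach, perfect_space}") real_normed_algebra_1
begin

lift_definition zero_endo :: "'a endo" is "0" .
lift_definition one_endo :: "'a endo" is "id_blinfun" .
lift_definition plus_endo :: "'a endo \<Rightarrow> 'a endo \<Rightarrow> 'a endo" is "(+)" .
lift_definition minus_endo :: "'a endo \<Rightarrow> 'a endo \<Rightarrow> 'a endo" is "(-)" .
lift_definition uminus_endo :: "'a endo \<Rightarrow> 'a endo" is "uminus" .
lift_definition times_endo :: "'a endo \<Rightarrow> 'a endo \<Rightarrow> 'a endo" is "(o\<^sub>L)" .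
lift_definition scaleR_endo :: "real \<Rightarrow> 'a endo \<Rightarrow> 'a endo" is "(*\<^sub>R)" .
lift_definition norm_endo :: "'a endo \<Rightarrow> real" is "norm" .

definition sgn_endo :: "'a endo \<Rightarrow> 'a endo" where
  "sgn_endo A = inverse (norm A) *\<^sub>R A"

definition dist_endo :: "'a endo \<Rightarrow> 'a endo \<Rightarrow> real" where
  "dist_endo A B = norm (A - B)"

definition uniformity_endo :: "('a endo \<times> 'a endo) filter" where
  "uniformity_endo = (INF e\<in>{0<..}. principal {(x, y). dist x y < e})"

definition open_endo :: "'a endo set \<Rightarrow> bool" where
  "open_endo U \<longleftrightarrow> (\<forall>x\<in>U. \<forall>\<^sub>F (x', y) in uniformity. x' = x \<longrightarrow> y \<in> U)"

instance
proof
  fix a b c :: "'a endo" and r s :: real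
  show "a + b + c = a + (b + c)" "a + b = b + a" "0 + a = a" "- a + a = 0" "a - b = a + - b"
    by (transfer; simp)+
  show "r *\<^sub>R (a + b) = r *\<^sub>R a + r *\<^sub>R b" "(r + s) *\<^sub>R a = r *\<^sub>R a + s *\<^sub>R a"
    "r *\<^sub>R s *\<^sub>R a = (r * s) *\<^sub>R a" "1 *\<^sub>R a = a"
    by (transfer; simp add: algebra_simps)+
  show "a * b * c = a * (b * c)" "1 * a = a" "a * 1 = a"
    "(a + b) * c = a * c + b * c" "a * (b + c) = a * b + a * c"
    "r *\<^sub>R a * b = r *\<^sub>R (a * b)" "a * r *\<^sub>R b = r *\<^sub>R (a * b)"
    by (transfer; auto intro!: blinfun_eqI simp: blinfun.bilinear_simps)+
  show "(0 :: 'a endo) \<noteq> 1"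
    by transfer (metis norm_blinfun_id norm_zero zero_neq_one)
  show "norm (1 :: 'a endo) = 1" by transfer simp
  show "norm (a * b) \<le> norm a * norm b" by transfer (rule norm_blinfun_compose)
  show "norm (a + b) \<le> norm a + norm b" by transfer (rule norm_triangle_ineq)
  show "norm a = 0 \<longleftrightarrow> a = 0" "norm (r *\<^sub>R a) = \<bar>r\<bar> * norm a" by (transfer; simp)+
  show "sgn a = inverse (norm a) *\<^sub>R a" by (rule sgn_endo_def)
  show "dist a b = norm (a - b)" by (rule dist_endo_def)
  show "uniformity = (INF e\<in>{0<..}. principal {(x :: 'a endo, y). dist x y < e})"
    by (rule uniformity_endo_def)
  show "open U = (\<forall>x\<in>U. \<forall>\<^sub>F (x', y) in uniformity. x' = x \<longrightarrow> y \<in> U)" for U :: "'a endo set"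
    by (rule open_endo_def)
qed

end

instance endo :: ("{banach, perfect_space}") banach
proof
  fix X :: "nat \<Rightarrow> 'a endo" assume X: "Cauchy X"
  have d: "dist (endo_op A) (endo_op B) = dist A B" for A B :: "'a endo"
    by (simp add: dist_norm minus_endo.rep_eq norm_endo.rep_eq)
  have "Cauchy (\<lambda>n. endo_op (X n))" using X by (simp add: Cauchy_def d)
  then obtain L where "(\<lambda>n. endo_op (X n)) \<longlonglongrightarrow> L" using Cauchy_convergent convergent_def by blast
  then have "(\<lambda>n. dist (endo_op (X n)) (endo_op (Endo L))) \<longlonglongrightarrow> 0"
    by (simp add: Endo_inverse tendsto_dist_iff[symmetric])
  then have "X \<longlonglongrightarrow> Endo L" by (simp add: d tendsto_dist_iff[symmetric])
  then show "convergent X" by (auto simp: convergent_def)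
qed

lemma endo_simps:
  "endo_op (A * B) x = endo_op A (endo_op B x)" "endo_op (A + B) x = endo_op A x + endo_op B x"
  "endo_op (A - B) x = endo_op A x - endo_op B x" "endo_op (r *\<^sub>R A) x = r *\<^sub>R endo_op A x"
  "endo_op 1 x = x" "endo_op 0 x = 0"
  "endo_op A (x + y) = endo_op A x + endo_op A y" "endo_op A (x - y) = endo_op A x - endo_op A y"
  "endo_op A (r *\<^sub>R x) = r *\<^sub>R endo_op A x"
  by (simp_all add: times_endo.rep_eq plus_endo.rep_eq minus_endo.rep_eq scaleR_endo.rep_eq
      one_endo.rep_eq zero_endo.rep_eq blinfun.bilinear_simps)

lemma norm_endo_apply: "norm (endo_op A x) \<le> norm A * norm x"
  by (simp add: norm_endo.rep_eq norm_blinfun)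

lemma norm_endo_apply_le: "norm A \<le> 1 \<Longrightarrow> norm (endo_op A x) \<le> norm x"
  using norm_endo_apply[of A x] mult_right_mono[of "norm A" 1 "norm x"] by simp

lemma endo_eqI: "(\<And>x. endo_op A x = endo_op B x) \<Longrightarrow> A = B"
  by (simp add: endo_op_inject[symmetric] blinfun_eqI)

lemma bounded_linear_endo_left: "bounded_linear (\<lambda>A. endo_op A x)"
  by (rule bounded_linear_intro[where K = "norm x"])
    (simp_all add: endo_simps norm_endo_apply)

lemma norm_add_diff_le: "norm (a + b - c) \<le> norm a + norm b + norm c"
  for a b c :: "'a::real_normed_vector"
  using norm_triangle_ineq4[of "a + b" c] norm_triangle_ineq[of a b] by linarith

text \<open>The scalar part of the exponent splits off as \<open>exp (- (t * l))\<close>, which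
  compensates the crude bound \<open>exp (t * l)\<close> for the rest.\<close>

lemma norm_exp_yosida:
  fixes J :: "'a :: {real_normed_algebra_1, banach}"
  assumes "norm J \<le> 1" "0 \<le> l" "0 \<le> t"
  shows "norm (exp (t *\<^sub>R (l *\<^sub>R (J - 1)))) \<le> 1"
proof -
  have "t *\<^sub>R (l *\<^sub>R (J - 1)) = (t * l) *\<^sub>R J + of_real (- (t * l))"
    by (simp add: scaleR_diff_right scaleR_conv_of_real right_diff_distrib mult.assoc)
  then have "exp (t *\<^sub>R (l *\<^sub>R (J - 1))) = exp ((t * l) *\<^sub>R J) * of_real (exp (- (t * l)))"
    by (simp only: exp_of_real[symmetric])
      (intro exp_add_commuting; simp add: of_real_def del: of_real_minus of_real_mult)
  also have "norm \<dots> \<le> exp (norm ((t * l) *\<^sub>R J)) * exp (- (t * l))"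
    by (intro order_trans[OF norm_mult_ineq] mult_mono norm_exp) auto
  also have "\<dots> \<le> exp (t * l) * exp (- (t * l))"
    using assms mult_left_mono[of "norm J" 1 "t * l"] by (intro mult_right_mono) auto
  also have "\<dots> = 1" by (simp add: exp_minus)
  finally show ?thesis .
qed

text \<open>The hypotheses of the Hille-Yosida theorem, stated for a graph. They are demanded only
  beyond \<open>l\<^sub>0\<close>, because the positivity and moment estimates hold for large
  \<open>l\<close> and Yosida approximation looks only at \<open>l\<close> tending to
  infinity.\<close>

locale dissipative_relation =
  fixes A :: "('v::{banach,perfect_space} \<times> 'v) set" and l\<^sub>0 :: real
  assumes subspace: "subspace A" and closed: "closed A" and dense: "closure (fst ` A) = UNIV"
    and diss: "\<And>l x y. (x, y) \<in> A \<Longrightarrow> l\<^sub>0 < l \<Longrightarrow> l * norm x \<le> norm (l *\<^sub>R x - y)"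
    and range: "\<And>l z. l\<^sub>0 < l \<Longrightarrow> \<exists>x y. (x, y) \<in> A \<and> l *\<^sub>R x - y = z"
    and l0: "0 \<le> l\<^sub>0"
begin

lemma A_add: "(x, y) \<in> A \<Longrightarrow> (x', y') \<in> A \<Longrightarrow> (x + x', y + y') \<in> A"
  using subspace_add[OF subspace, of "(x, y)" "(x', y')"] by simp

lemma A_diff: "(x, y) \<in> A \<Longrightarrow> (x', y') \<in> A \<Longrightarrow> (x - x', y - y') \<in> A"
  using subspace_diff[OF subspace, of "(x, y)" "(x', y')"] by simp

lemma A_scale: "(x, y) \<in> A \<Longrightarrow> (r *\<^sub>R x, r *\<^sub>R y) \<in> A"
  using subspace_scale[OF subspace, of "(x, y)"] by simp

lemma resolvent_unique:
  assumes "(x, y) \<in> A" "(x', y') \<in> A" "l\<^sub>0 < l" "l *\<^sub>R x - y = l *\<^sub>R x' - y'"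
  shows "x = x'"
proof -
  have "l * norm (x - x') \<le> norm (l *\<^sub>R (x - x') - (y - y'))"
    using assms by (intro diss A_diff)
  also have "l *\<^sub>R (x - x') - (y - y') = 0" using assms(4) by (simp add: algebra_simps)
  finally show ?thesis using l0 assms(3) by (simp add: mult_le_0_iff)
qed

text \<open>\<open>J\<close> is \<open>l\<close> times the resolvent
  \<open>(l - A)\<^sup>-\<^sup>1\<close>: the first component \<open>x\<close> with
  \<open>l x - y = l z\<close> gives \<open>J z\<close>. Dissipativity makes it well defined and
  contractive.\<close>

lemma resolvent_exists:
  assumes l: "l\<^sub>0 < l"
  obtains J where "norm J \<le> 1" "\<And>z. (endo_op J z, l *\<^sub>R (endo_op J z - z)) \<in> A"
    "\<And>x y. (x, y) \<in> A \<Longrightarrow> endo_op J (l *\<^sub>R x - y) = l *\<^sub>R x"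
proof -
  have "l > 0" using l l0 by simp
  have "\<exists>x. (x, l *\<^sub>R (x - z)) \<in> A" for z
  proof -
    obtain x y where xy: "(x, y) \<in> A" "l *\<^sub>R x - y = z" using range[OF l] by blast
    then have "(l *\<^sub>R x, l *\<^sub>R y) \<in> A" by (intro A_scale)
    moreover have "y = l *\<^sub>R x - z" using xy(2) by (simp add: algebra_simps)
    ultimately show ?thesis by blast
  qed
  then obtain j where j: "\<And>z. (j z, l *\<^sub>R (j z - z)) \<in> A" by metis
  have j_eq: "j z = x" if "(x, l *\<^sub>R (x - z)) \<in> A" for x z
    by (rule resolvent_unique[OF j that l]) (simp add: algebra_simps)
  have "bounded_linear j"
  proof (rule bounded_linear_intro[where K = 1])
    show "j (x + y) = j x + j y" for x y
      using A_add[OF j j, of x y] by (intro j_eq) (simp add: algebra_simps)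
    show "j (r *\<^sub>R x) = r *\<^sub>R j x" for r x
      using A_scale[OF j, of r x] by (intro j_eq) (simp add: algebra_simps)
    show "norm (j x) \<le> norm x * 1" for x
      using diss[OF j l, of x] \<open>l > 0\<close> by (simp add: scaleR_diff_right)
  qed
  then have app: "blinfun_apply (Blinfun j) = j" by (rule bounded_linear_Blinfun_apply)
  have nj: "norm (j x) \<le> norm x" for x
    using diss[OF j l, of x] \<open>l > 0\<close> by (simp add: scaleR_diff_right)
  show thesis
  proof (rule that[of "Endo (Blinfun j)"])
    show "norm (Endo (Blinfun j)) \<le> 1"
      by (auto simp: norm_endo.rep_eq Endo_inverse app nj intro!: norm_blinfun_bound)
    show "(endo_op (Endo (Blinfun j)) z, l *\<^sub>R (endo_op (Endo (Blinfun j)) z - z)) \<in> A" for z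
      using j by (simp add: Endo_inverse app)
    show "endo_op (Endo (Blinfun j)) (l *\<^sub>R x - y) = l *\<^sub>R x" if "(x, y) \<in> A" for x y
      using A_scale[OF that, of l] by (simp add: Endo_inverse app j_eq)
  qed
qed

section \<open>Yosida approximation and the limit semigroup\<close>

definition ell :: "nat \<Rightarrow> real" where "ell n = l\<^sub>0 + 1 + real n"

lemma ell: "l\<^sub>0 < ell n" "0 < ell n" using l0 by (simp_all add: ell_def)

definition J :: "nat \<Rightarrow> 'v endo" where
  "J n = (SOME J. norm J \<le> 1 \<and> (\<forall>z. (endo_op J z, ell n *\<^sub>R (endo_op J z - z)) \<in> A) \<and>
    (\<forall>x y. (x, y) \<in> A \<longrightarrow> endo_op J (ell n *\<^sub>R x - y) = ell n *\<^sub>R x))"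

lemma J: "norm (J n) \<le> 1" "(endo_op (J n) z, ell n *\<^sub>R (endo_op (J n) z - z)) \<in> A"
  "(x, y) \<in> A \<Longrightarrow> endo_op (J n) (ell n *\<^sub>R x - y) = ell n *\<^sub>R x"
proof -
  have "\<exists>J. norm J \<le> 1 \<and> (\<forall>z. (endo_op J z, ell n *\<^sub>R (endo_op J z - z)) \<in> A) \<and>
    (\<forall>x y. (x, y) \<in> A \<longrightarrow> endo_op J (ell n *\<^sub>R x - y) = ell n *\<^sub>R x)"
    using resolvent_exists[OF ell(1)[of n]] by metis
  from someI_ex[OF this, folded J_def] show "norm (J n) \<le> 1"
    "(endo_op (J n) z, ell n *\<^sub>R (endo_op (J n) z - z)) \<in> A"
    "(x, y) \<in> A \<Longrightarrow> endo_op (J n) (ell n *\<^sub>R x - y) = ell n *\<^sub>R x"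
    by blast+
qed

text \<open>The Yosida approximant, formally \<open>A J\<close>. On the domain it equals
  \<open>J A\<close>, so it converges to \<open>A\<close> there once \<open>J n\<close> converges
  strongly to 1.\<close>

definition Y :: "nat \<Rightarrow> 'v endo" where "Y n = ell n *\<^sub>R (J n - 1)"

lemma Y_eq_J: "(x, y) \<in> A \<Longrightarrow> endo_op (Y n) x = endo_op (J n) y"
  using J(3)[of x y n] by (simp add: Y_def endo_simps algebra_simps)

lemma J_invariant: "(x, y) \<in> A \<Longrightarrow> (endo_op (J n) x, endo_op (J n) y) \<in> A"
  using J(2)[of n x] Y_eq_J[of x y n] by (simp add: Y_def endo_simps)

text \<open>\<open>J n\<close> maps the graph into itself, hence \<open>J n (J m z)\<close> solves
  the equation that characterizes \<open>J m (J n z)\<close>.\<close>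

lemma J_commute: "J m * J n = J n * J m"
proof (rule endo_eqI)
  fix z
  have "endo_op (J m) (ell m *\<^sub>R endo_op (J n) (endo_op (J m) z)
      - endo_op (J n) (ell m *\<^sub>R (endo_op (J m) z - z)))
      = ell m *\<^sub>R endo_op (J n) (endo_op (J m) z)"
    by (rule J(3)[OF J_invariant[OF J(2)]])
  then have "ell m *\<^sub>R endo_op (J m) (endo_op (J n) z) = ell m *\<^sub>R endo_op (J n) (endo_op (J m) z)"
    by (simp add: endo_simps algebra_simps)
  then show "endo_op (J m * J n) z = endo_op (J n * J m) z" using ell(2)[of m] by (simp add: endo_simps)
qed

lemma Y_commute: "Y m * Y n = Y n * Y m"
  by (simp add: Y_def algebra_simps J_commute)

definition S :: "nat \<Rightarrow> real \<Rightarrow> 'v endo" where "S n t = exp (t *\<^sub>R Y n)"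

lemma norm_S: "0 \<le> t \<Longrightarrow> norm (S n t) \<le> 1"
  unfolding S_def Y_def using J(1)[of n] ell(2)[of n] by (intro norm_exp_yosida) auto

lemma S_apply_le: "0 \<le> t \<Longrightarrow> norm (endo_op (S n t) x) \<le> norm x"
  by (intro norm_endo_apply_le norm_S)

lemma S_zero: "S n 0 = 1" by (simp add: S_def)

lemma S_add: "S n (s + t) = S n s * S n t"
  unfolding S_def scaleR_add_left by (rule exp_add_commuting) (simp add: mult_ac)

lemma S_derivative:
  "((\<lambda>s. endo_op (S n s) x) has_vector_derivative endo_op (S n s) (endo_op (Y n) x)) (at s within U)"
  using bounded_linear.has_vector_derivative[OF bounded_linear_endo_left[of x]
      exp_scaleR_has_vector_derivative_right[of "Y n" s U]]
  by (simp add: S_def endo_simps)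

lemma S_derivative':
  "((\<lambda>s. endo_op (S n s) x) has_vector_derivative endo_op (Y n) (endo_op (S n s) x)) (at s within U)"
  using bounded_linear.has_vector_derivative[OF bounded_linear_endo_left[of x]
      exp_scaleR_has_vector_derivative_left[of "Y n" s], THEN has_vector_derivative_at_within]
  by (simp add: S_def endo_simps)

text \<open>The mean value inequality for \<open>f s - s *\<^sub>R v\<close>. With
  \<open>v = 0\<close> it bounds increments, with \<open>v\<close> the expected derivative it bounds
  the linearization error.\<close>

lemma vector_derivative_bound:
  fixes f :: "real \<Rightarrow> 'b::real_normed_vector"
  assumes t: "0 \<le> t"
    and f: "\<And>s. s \<in> {0..t} \<Longrightarrow> (f has_vector_derivative f' s) (at s within {0..t})"
    and B: "\<And>s. s \<in> {0..t} \<Longrightarrow> norm (f' s - v) \<le> B"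
  shows "norm (f t - f 0 - t *\<^sub>R v) \<le> t * B"
proof -
  have "norm ((\<lambda>s. f s - s *\<^sub>R v) t - (\<lambda>s. f s - s *\<^sub>R v) 0) \<le> B * norm (t - 0)"
  proof (rule differentiable_bound[of "{0..t}" _ "\<lambda>s h. h *\<^sub>R (f' s - v)"])
    fix s assume s: "s \<in> {0..t}"
    show "((\<lambda>s. f s - s *\<^sub>R v) has_derivative (\<lambda>h. h *\<^sub>R (f' s - v))) (at s within {0..t})"
      using f[OF s] unfolding has_vector_derivative_def
      by (auto intro!: derivative_eq_intros simp: scaleR_diff_right)
    show "onorm (\<lambda>h. h *\<^sub>R (f' s - v)) \<le> B"
      using B[OF s] by (simp add: onorm_scaleR_left[of "\<lambda>h. h", simplified] onorm_id
          bounded_linear_ident)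
  qed (use t in auto)
  then show ?thesis using t by (simp add: mult.commute algebra_simps)
qed

text \<open>Interpolation between the two semigroups along \<open>S n s * S m (t - s)\<close>. Since
  the approximants commute, this is a constant factor times a single exponential in
  \<open>s\<close>, whose derivative contains the difference \<open>Y n - Y m\<close>.\<close>

lemma S_diff:
  assumes t: "0 \<le> t"
  shows "norm (endo_op (S n t) x - endo_op (S m t) x) \<le> t * norm (endo_op (Y n - Y m) x)"
proof -
  let ?D = "Y n - Y m"
  let ?f = "\<lambda>s. endo_op (exp (t *\<^sub>R Y m) * exp (s *\<^sub>R ?D)) x"
  have comm: "Y m * ?D = ?D * Y m" by (simp add: algebra_simps Y_commute)
  have eq: "exp (t *\<^sub>R Y m) * exp (s *\<^sub>R ?D) = S n s * S m (t - s)" for s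
  proof -
    have "exp (t *\<^sub>R Y m) * exp (s *\<^sub>R ?D) = exp (t *\<^sub>R Y m + s *\<^sub>R ?D)"
      by (rule exp_add_commuting[symmetric]) (simp add: comm mult_ac)
    also have "t *\<^sub>R Y m + s *\<^sub>R ?D = s *\<^sub>R Y n + (t - s) *\<^sub>R Y m"
      by (simp add: algebra_simps)
    also have "exp \<dots> = S n s * S m (t - s)"
      unfolding S_def by (rule exp_add_commuting) (simp add: Y_commute mult_ac)
    finally show ?thesis .
  qed
  have "norm (?f t - ?f 0 - t *\<^sub>R 0) \<le> t * norm (endo_op ?D x)"
  proof (rule vector_derivative_bound[OF t])
    fix s assume s: "s \<in> {0..t}"
    have "((\<lambda>s. exp (t *\<^sub>R Y m) * exp (s *\<^sub>R ?D)) has_vector_derivative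
        exp (t *\<^sub>R Y m) * (exp (s *\<^sub>R ?D) * ?D)) (at s within {0..t})"
      by (rule bounded_linear.has_vector_derivative[OF bounded_linear_mult_right
            exp_scaleR_has_vector_derivative_right])
    from bounded_linear.has_vector_derivative[OF bounded_linear_endo_left[of x] this]
    show "(?f has_vector_derivative endo_op (S n s * S m (t - s)) (endo_op ?D x)) (at s within {0..t})"
      by (simp add: eq[symmetric] endo_simps)
    show "norm (endo_op (S n s * S m (t - s)) (endo_op ?D x) - 0) \<le> norm (endo_op ?D x)"
      using s by (auto simp only: endo_simps(1) diff_zero atLeastAtMost_iff diff_ge_0_iff_ge
          intro!: order_trans[OF S_apply_le S_apply_le])
  qed
  then show ?thesis using eq[of t] eq[of 0] by (simp add: S_zero)
qed

lemma dense_approx: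
  assumes "e > 0" obtains x' y' where "(x', y') \<in> A" "norm (x - x') < e"
proof -
  have "x \<in> closure (fst ` A)" by (simp add: dense)
  then obtain x' where "x' \<in> fst ` A" "dist x' x < e" using assms unfolding closure_approachable by blast
  then show thesis using that by (auto simp: dist_norm norm_minus_commute)
qed

lemma ell_at_top: "filterlim ell at_top sequentially"
  unfolding ell_def by (intro filterlim_tendsto_add_at_top[OF tendsto_const] filterlim_real_sequentially)

text \<open>On the domain \<open>J n x - x\<close> is \<open>J n y / ell n\<close>, which tends to
  0; density and contractivity extend this to all vectors.\<close>

lemma J_tendsto: "(\<lambda>n. endo_op (J n) z) \<longlonglongrightarrow> z"
proof (rule metric_LIMSEQ_I)
  fix e :: real assume e: "e > 0"
  then have "e/3 > 0" by simp
  obtain x y where xy: "(x, y) \<in> A" "norm (z - x) < e/3" using dense_approx[OF \<open>e/3 > 0\<close>] by blast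
  have "(\<lambda>n. norm y / ell n) \<longlonglongrightarrow> 0"
    by (rule real_tendsto_divide_at_top[OF tendsto_const ell_at_top])
  then obtain N where N: "\<forall>n\<ge>N. norm (norm y / ell n - 0) < e/3"
    using \<open>e/3 > 0\<close> LIMSEQ_D by blast
  have "dist (endo_op (J n) z) z < e" if "n \<ge> N" for n
  proof -
    have "endo_op (J n) x - x = (1 / ell n) *\<^sub>R endo_op (J n) y"
      unfolding Y_eq_J[OF xy(1), symmetric] using ell(2)[of n] by (simp add: Y_def endo_simps)
    then have "norm (endo_op (J n) x - x) \<le> norm y / ell n"
      using norm_endo_apply_le[OF J(1), of n y] ell(2)[of n] by (simp add: divide_right_mono)
    also have "\<dots> < e/3" using N that ell(2)[of n] by auto
    finally have 1: "norm (endo_op (J n) x - x) < e/3" .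
    have 2: "norm (endo_op (J n) (z - x)) < e/3"
      using norm_endo_apply_le[OF J(1), of n "z - x"] xy(2) by simp
    have "endo_op (J n) z - z = endo_op (J n) (z - x) + (endo_op (J n) x - x) - (z - x)"
      by (simp add: endo_simps)
    then have "norm (endo_op (J n) z - z) \<le> norm (endo_op (J n) (z - x))
        + norm (endo_op (J n) x - x) + norm (z - x)"
      by (metis norm_add_diff_le)
    with 1 2 xy(2) show ?thesis by (simp add: dist_norm)
  qed
  then show "\<exists>N. \<forall>n\<ge>N. dist (endo_op (J n) z) z < e" by blast
qed

text \<open>For domain vectors \<open>S_diff\<close> reduces the claim to convergence of
  \<open>J n y\<close>; contractivity carries it over to the closure.\<close>

lemma S_convergent:
  assumes t: "0 \<le> t" shows "convergent (\<lambda>n. endo_op (S n t) x)"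
proof -
  have "Cauchy (\<lambda>n. endo_op (S n t) x)"
  proof (rule metric_CauchyI)
    fix e :: real assume e: "e > 0"
    then have "e/4 > 0" by simp
    obtain x' y where xy: "(x', y) \<in> A" "norm (x - x') < e/4" using dense_approx[OF \<open>e/4 > 0\<close>] by blast
    have "Cauchy (\<lambda>n. endo_op (J n) y)" using J_tendsto by (rule LIMSEQ_imp_Cauchy)
    moreover have "e / (2 * (t + 1)) > 0" using e t by simp
    ultimately obtain N where N: "\<forall>n\<ge>N. \<forall>m\<ge>N. dist (endo_op (J n) y) (endo_op (J m) y) < e / (2 * (t + 1))"
      unfolding Cauchy_def by blast
    have "dist (endo_op (S n t) x) (endo_op (S m t) x) < e" if "n \<ge> N" "m \<ge> N" for n m
    proof -
      have "norm (endo_op (S n t) x' - endo_op (S m t) x') \<le> t * norm (endo_op (Y n - Y m) x')"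
        by (rule S_diff[OF t])
      also have "norm (endo_op (Y n - Y m) x') = dist (endo_op (J n) y) (endo_op (J m) y)"
        by (simp add: endo_simps Y_eq_J[OF xy(1)] dist_norm)
      also have "t * \<dots> \<le> t * (e / (2 * (t + 1)))" using N that t by (intro mult_left_mono) (auto intro: less_imp_le)
      also have "\<dots> \<le> e / 2" using t e by (simp add: divide_simps)
      finally have 1: "norm (endo_op (S n t) x' - endo_op (S m t) x') \<le> e / 2" .
      have 2: "norm (endo_op (S k t) (x - x')) < e / 4" for k
        using S_apply_le[OF t, of k "x - x'"] xy(2) by simp
      have "endo_op (S n t) x - endo_op (S m t) x = endo_op (S n t) (x - x')
          + (endo_op (S n t) x' - endo_op (S m t) x') - endo_op (S m t) (x - x')"
        by (simp add: endo_simps)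
      then have "norm (endo_op (S n t) x - endo_op (S m t) x) \<le> norm (endo_op (S n t) (x - x'))
          + norm (endo_op (S n t) x' - endo_op (S m t) x') + norm (endo_op (S m t) (x - x'))"
        by (metis norm_add_diff_le)
      with 1 2[of n] 2[of m] show ?thesis by (simp add: dist_norm)
    qed
    then show "\<exists>N. \<forall>n\<ge>N. \<forall>m\<ge>N. dist (endo_op (S n t) x) (endo_op (S m t) x) < e" by blast
  qed
  then show ?thesis by (rule Cauchy_convergent)
qed

definition T :: "real \<Rightarrow> 'v \<Rightarrow> 'v" where "T t x = lim (\<lambda>n. endo_op (S n t) x)"

lemma S_tendsto: "0 \<le> t \<Longrightarrow> (\<lambda>n. endo_op (S n t) x) \<longlonglongrightarrow> T t x"
  unfolding T_def using S_convergent convergent_LIMSEQ_iff by blast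

lemma T_add: "0 \<le> t \<Longrightarrow> T t (x + y) = T t x + T t y"
  by (rule LIMSEQ_unique[OF S_tendsto])
    (auto simp: endo_simps intro!: tendsto_add S_tendsto)

lemma T_scaleR: "0 \<le> t \<Longrightarrow> T t (r *\<^sub>R x) = r *\<^sub>R T t x"
  by (rule LIMSEQ_unique[OF S_tendsto])
    (auto simp: endo_simps intro!: tendsto_scaleR S_tendsto)

lemma T_diff: "0 \<le> t \<Longrightarrow> T t (x - y) = T t x - T t y"
  using T_add[of t x "- y"] T_scaleR[of t "-1" y] by simp

lemma T_zero: "T 0 x = x"
  using S_tendsto[of 0 x] by (simp add: S_zero endo_simps LIMSEQ_const_iff)

lemma norm_T: "0 \<le> t \<Longrightarrow> norm (T t x) \<le> norm x"
  by (rule tendsto_upperbound[OF tendsto_norm[OF S_tendsto]]) (auto simp: S_apply_le)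

lemma T_semigroup:
  assumes "0 \<le> s" "0 \<le> t" shows "T (s + t) x = T s (T t x)"
proof (rule LIMSEQ_unique[OF S_tendsto])
  have "(\<lambda>n. endo_op (S n s) (endo_op (S n t) x - T t x)) \<longlonglongrightarrow> 0"
  proof (rule Lim_null_comparison)
    show "\<forall>\<^sub>F n in sequentially. norm (endo_op (S n s) (endo_op (S n t) x - T t x))
        \<le> norm (endo_op (S n t) x - T t x)"
      using assms by (simp add: S_apply_le)
    show "(\<lambda>n. norm (endo_op (S n t) x - T t x)) \<longlonglongrightarrow> 0"
      using S_tendsto[OF assms(2), of x] by (simp add: LIM_zero tendsto_norm_zero)
  qed
  from tendsto_add[OF this S_tendsto[OF assms(1), of "T t x"]]
  show "(\<lambda>n. endo_op (S n (s + t)) x) \<longlonglongrightarrow> T s (T t x)"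
    by (simp add: S_add endo_simps)
qed (use assms in simp)

text \<open>Uniform in \<open>n\<close>, so the bound survives the limit. \<open>C\<close> is the
  norm of the image of a domain vector close to \<open>x\<close>; this constant cannot be controlled
  by \<open>x\<close> itself, hence the additive \<open>e\<close>.\<close>

lemma S_near_zero:
  assumes "e > 0"
  obtains C where "0 \<le> C" "\<And>n t. 0 \<le> t \<Longrightarrow> norm (endo_op (S n t) x - x) \<le> e + C * t"
proof -
  have "e/2 > 0" using assms by simp
  obtain x' y where xy: "(x', y) \<in> A" "norm (x - x') < e/2" using dense_approx[OF \<open>e/2 > 0\<close>] by blast
  show thesis
  proof (rule that[of "norm y"])
    fix n and t :: real assume t: "0 \<le> t"
    have "norm (endo_op (S n t) x' - endo_op (S n 0) x' - t *\<^sub>R 0) \<le> t * norm y"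
    proof (rule vector_derivative_bound[OF t S_derivative])
      show "norm (endo_op (S n s) (endo_op (Y n) x') - 0) \<le> norm y" if "s \<in> {0..t}" for s
        using that order_trans[OF S_apply_le norm_endo_apply_le[OF J(1)], of s]
        by (simp add: Y_eq_J[OF xy(1)])
    qed
    then have 1: "norm (endo_op (S n t) x' - x') \<le> norm y * t" by (simp add: S_zero endo_simps mult.commute)
    have 2: "norm (endo_op (S n t) (x - x')) < e/2"
      using S_apply_le[OF t, of n "x - x'"] xy(2) by simp
    have "endo_op (S n t) x - x = endo_op (S n t) (x - x') + (endo_op (S n t) x' - x') - (x - x')"
      by (simp add: endo_simps)
    then have "norm (endo_op (S n t) x - x) \<le> norm (endo_op (S n t) (x - x'))
        + norm (endo_op (S n t) x' - x') + norm (x - x')"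
      by (metis norm_add_diff_le)
    with 1 2 xy(2) show "norm (endo_op (S n t) x - x) \<le> e + norm y * t" by simp
  qed simp
qed

lemma T_near_zero:
  assumes "e > 0"
  obtains C where "0 \<le> C" "\<And>t. 0 \<le> t \<Longrightarrow> norm (T t x - x) \<le> e + C * t"
proof -
  obtain C where C: "0 \<le> C" "\<And>n t. 0 \<le> t \<Longrightarrow> norm (endo_op (S n t) x - x) \<le> e + C * t"
    using S_near_zero[OF assms] by metis
  have "norm (T t x - x) \<le> e + C * t" if "0 \<le> t" for t
    using C that
    by (intro tendsto_upperbound[OF tendsto_norm[OF tendsto_diff[OF S_tendsto tendsto_const]]]) auto
  with C(1) show thesis by (rule that)
qed

lemma T_continuous:
  assumes t: "0 \<le> t" shows "((\<lambda>s. norm (T s x - T t x)) \<longlongrightarrow> 0) (at t within {0..})"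
proof -
  have le: "norm (T s x - T t x) \<le> norm (T \<bar>s - t\<bar> x - x)" if "0 \<le> s" for s
  proof (cases "t \<le> s")
    case True
    then have "T s x - T t x = T t (T (s - t) x - x)"
      using T_semigroup[of t "s - t" x] t by (simp add: T_diff)
    then show ?thesis using True norm_T[OF t] by simp
  next
    case False
    then have "T t x - T s x = T s (T (t - s) x - x)"
      using T_semigroup[of s "t - s" x] that by (simp add: T_diff)
    then have "norm (T t x - T s x) \<le> norm (T (t - s) x - x)" using norm_T[OF that] by simp
    then show ?thesis using False by (simp add: norm_minus_commute)
  qed
  show ?thesis unfolding tendsto_iff eventually_at
  proof (intro allI impI)
    fix e :: real assume e: "e > 0"
    then have "e/2 > 0" by simp
    obtain C where C: "0 \<le> C" "\<And>t. 0 \<le> t \<Longrightarrow> norm (T t x - x) \<le> e/2 + C * t"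
      using T_near_zero[OF \<open>e/2 > 0\<close>] by metis
    show "\<exists>d>0. \<forall>s\<in>{0..}. s \<noteq> t \<and> dist s t < d \<longrightarrow> dist (norm (T s x - T t x)) 0 < e"
    proof (intro exI[of _ "e / (2 * (C + 1))"] conjI ballI impI)
      show "e / (2 * (C + 1)) > 0" using e C(1) by simp
      fix s assume s: "s \<in> {0..}" "s \<noteq> t \<and> dist s t < e / (2 * (C + 1))"
      have "C * \<bar>s - t\<bar> \<le> C * (e / (2 * (C + 1)))"
        using s C(1) by (intro mult_left_mono) (auto simp: dist_real_def)
      also have "\<dots> < e / 2" using C(1) e by (simp add: divide_simps)
      finally show "dist (norm (T s x - T t x)) 0 < e"
        using le[of s] C(2)[of "\<bar>s - t\<bar>"] s by auto
    qed
  qed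
qed

lemma T_derivative:
  assumes xy: "(x, y) \<in> A"
  shows "((\<lambda>t. norm ((1 / t) *\<^sub>R (T t x - x) - y)) \<longlongrightarrow> 0) (at_right 0)"
  unfolding tendsto_iff
proof (intro allI impI)
  fix e :: real assume e: "e > 0"
  then have "e/2 > 0" by simp
  obtain C where C: "0 \<le> C" "\<And>n t. 0 \<le> t \<Longrightarrow> norm (endo_op (S n t) y - y) \<le> e/2 + C * t"
    using S_near_zero[OF \<open>e/2 > 0\<close>] by metis
  have bd: "norm (T t x - x - t *\<^sub>R y) \<le> t * (e/2 + C * t)" if t: "0 \<le> t" for t
  proof -
    \<comment> \<open>\<open>z n\<close> equals \<open>Y n x\<close>, the initial derivative of the
      approximating orbit. The linearization error is bounded against it uniformly in
      \<open>n\<close>, and only then \<open>n\<close> tends to infinity.\<close>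
    define z where "z n = endo_op (J n) y" for n
    have z: "z \<longlonglongrightarrow> y" unfolding z_def by (rule J_tendsto)
    have "norm (endo_op (S n t) x - x - t *\<^sub>R z n) \<le> t * (2 * norm (z n - y) + (e/2 + C * t))" for n
    proof -
      have "norm (endo_op (S n t) x - endo_op (S n 0) x - t *\<^sub>R z n)
          \<le> t * (2 * norm (z n - y) + (e/2 + C * t))"
      proof (rule vector_derivative_bound[OF t S_derivative])
        fix s assume s: "s \<in> {0..t}"
        have "endo_op (S n s) (z n) - z n = endo_op (S n s) (z n - y) + (endo_op (S n s) y - y) - (z n - y)"
          by (simp add: endo_simps)
        then have "norm (endo_op (S n s) (z n) - z n) \<le> norm (endo_op (S n s) (z n - y))
            + norm (endo_op (S n s) y - y) + norm (z n - y)"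
          by (metis norm_add_diff_le)
        also have "\<dots> \<le> norm (z n - y) + (e/2 + C * t) + norm (z n - y)"
          using s C(2)[of s n] S_apply_le[of s n "z n - y"] mult_left_mono[OF _ C(1), of s t]
          by (intro add_mono) auto
        finally show "norm (endo_op (S n s) (endo_op (Y n) x) - z n) \<le> 2 * norm (z n - y) + (e/2 + C * t)"
          by (simp add: Y_eq_J[OF xy] z_def)
      qed
      then show ?thesis by (simp add: S_zero endo_simps)
    qed
    moreover have "(\<lambda>n. norm (endo_op (S n t) x - x - t *\<^sub>R z n)) \<longlonglongrightarrow> norm (T t x - x - t *\<^sub>R y)"
      by (intro tendsto_intros S_tendsto t z)
    moreover have "(\<lambda>n. t * (2 * norm (z n - y) + (e/2 + C * t))) \<longlonglongrightarrow> t * (2 * norm (y - y) + (e/2 + C * t))"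
      by (intro tendsto_intros z)
    ultimately show ?thesis by (auto dest: LIMSEQ_le)
  qed
  show "\<forall>\<^sub>F t in at_right 0. dist (norm ((1 / t) *\<^sub>R (T t x - x) - y)) 0 < e"
    unfolding eventually_at
  proof (intro exI[of _ "e / (2 * (C + 1))"] conjI ballI impI)
    show "e / (2 * (C + 1)) > 0" using e C(1) by simp
    fix t :: real assume t: "t \<in> {0<..}" "t \<noteq> 0 \<and> dist t 0 < e / (2 * (C + 1))"
    then have "t > 0" by simp
    have "(1 / t) *\<^sub>R (T t x - x) - y = (1 / t) *\<^sub>R (T t x - x - t *\<^sub>R y)"
      using \<open>t > 0\<close> by (simp add: algebra_simps)
    then have "norm ((1 / t) *\<^sub>R (T t x - x) - y) = norm (T t x - x - t *\<^sub>R y) / t"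
      using \<open>t > 0\<close> by simp
    also have "\<dots> \<le> e/2 + C * t" using bd[of t] \<open>t > 0\<close> by (simp add: divide_simps mult.commute)
    also have "C * t \<le> C * (e / (2 * (C + 1)))" using t C(1) by (intro mult_left_mono) auto
    also have "C * (e / (2 * (C + 1))) < e / 2" using C(1) e by (simp add: divide_simps)
    finally show "dist (norm ((1 / t) *\<^sub>R (T t x - x) - y)) 0 < e" by simp
  qed
qed

text \<open>The generator extends \<open>A\<close> by \<open>T_derivative\<close>; it is no larger,
  because the range condition supplies \<open>(x', y') \<in> A\<close> with the same
  \<open>l x - y\<close>. The difference \<open>u\<close> then satisfies
  \<open>T t u = (1 + t l) u + o(t)\<close>, which contractivity permits only for
  \<open>u = 0\<close>.\<close>

lemma generator_T:
  "((\<lambda>t. norm ((1 / t) *\<^sub>R (T t x - x) - y)) \<longlongrightarrow> 0) (at_right 0) \<longleftrightarrow> (x, y) \<in> A"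
proof
  assume lim: "((\<lambda>t. norm ((1 / t) *\<^sub>R (T t x - x) - y)) \<longlongrightarrow> 0) (at_right 0)"
  define l where "l = ell 0"
  have l: "l\<^sub>0 < l" "l > 0" unfolding l_def by (rule ell)+
  obtain x' y' where xy: "(x', y') \<in> A" "l *\<^sub>R x' - y' = l *\<^sub>R x - y" using range[OF l(1)] by blast
  define u where "u = x - x'"
  have v: "y - y' = l *\<^sub>R u" using xy(2) by (simp add: u_def algebra_simps)
  have "((\<lambda>t. norm ((1 / t) *\<^sub>R (T t x - x) - y) + norm ((1 / t) *\<^sub>R (T t x' - x') - y')) \<longlongrightarrow> 0 + 0) (at_right 0)"
    by (intro tendsto_add lim T_derivative xy)
  then have "((\<lambda>t. norm ((1 / t) *\<^sub>R (T t x - x) - y) + norm ((1 / t) *\<^sub>R (T t x' - x') - y')) \<longlongrightarrow> 0) (at_right 0)"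
    by simp
  moreover have "\<forall>\<^sub>F t in at_right 0. l * norm u
      \<le> norm ((1 / t) *\<^sub>R (T t x - x) - y) + norm ((1 / t) *\<^sub>R (T t x' - x') - y')"
    unfolding eventually_at
  proof (intro exI[of _ 1] conjI ballI impI)
    fix t :: real assume "t \<in> {0<..}"
    then have t: "t > 0" by simp
    let ?r = "((1 / t) *\<^sub>R (T t x - x) - y) - ((1 / t) *\<^sub>R (T t x' - x') - y')"
    have "T t u = (1 + t * l) *\<^sub>R u + t *\<^sub>R ?r"
    proof -
      have "t *\<^sub>R ?r = (T t x - T t x') - (x - x') - t *\<^sub>R (y - y')"
        using t by (simp add: scaleR_diff_right)
      then show ?thesis using t by (simp add: v T_diff u_def[symmetric] scaleR_add_left)
          (simp add: u_def T_diff)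
    qed
    then have "(1 + t * l) *\<^sub>R u = T t u - t *\<^sub>R ?r" by (simp only: add_diff_cancel_right')
    then have "norm ((1 + t * l) *\<^sub>R u) \<le> norm (T t u) + norm (t *\<^sub>R ?r)"
      by (metis norm_triangle_ineq4)
    also have "norm (T t u) \<le> norm u" using t by (intro norm_T) simp
    finally have "(1 + t * l) * norm u \<le> norm u + t * norm ?r"
      using t l by simp
    then have "t * (l * norm u) \<le> t * norm ?r" by (simp add: algebra_simps)
    then have "l * norm u \<le> norm ?r" using t by simp
    also have "\<dots> \<le> norm ((1 / t) *\<^sub>R (T t x - x) - y) + norm ((1 / t) *\<^sub>R (T t x' - x') - y')"
      by (rule norm_triangle_ineq4)
    finally show "l * norm u \<le> norm ((1 / t) *\<^sub>R (T t x - x) - y) + norm ((1 / t) *\<^sub>R (T t x' - x') - y')" .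
  qed simp
  ultimately have "l * norm u \<le> 0" by (rule tendsto_lowerbound) simp
  then have "u = 0" using l(2) by (simp add: mult_le_0_iff)
  then show "(x, y) \<in> A" using v xy(1) by (simp add: u_def)
qed (rule T_derivative)

text \<open>Every \<open>Y n z\<close> is the second component of a pair in \<open>A\<close>. With
  the derivative written as in \<open>S_derivative'\<close>, \<open>Y n\<close> outermost,
  \<open>\<phi>\<close> is constant along each approximating orbit. The trace will be such a
  \<open>\<phi>\<close>.\<close>

lemma T_invariant:
  assumes \<phi>: "bounded_linear \<phi>" and A0: "\<And>x y. (x, y) \<in> A \<Longrightarrow> \<phi> y = (0 :: real)" and t: "0 \<le> t"
  shows "\<phi> (T t x) = \<phi> x"
proof (rule LIMSEQ_unique)
  show "(\<lambda>n. \<phi> (endo_op (S n t) x)) \<longlonglongrightarrow> \<phi> (T t x)"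
    by (intro bounded_linear.tendsto[OF \<phi>] S_tendsto t)
  have "\<phi> (endo_op (S n t) x) = \<phi> x" for n
  proof -
    have Y0: "\<phi> (endo_op (Y n) z) = 0" for z
      using A0[OF J(2)[of n z]] by (simp add: Y_def endo_simps)
    have "norm (\<phi> (endo_op (S n t) x) - \<phi> (endo_op (S n 0) x) - t *\<^sub>R 0) \<le> t * 0"
    proof (rule vector_derivative_bound[OF t])
      show "((\<lambda>s. \<phi> (endo_op (S n s) x)) has_vector_derivative 0) (at s within {0..t})" for s
        using bounded_linear.has_vector_derivative[OF \<phi> S_derivative'[of n x s "{0..t}"]]
        by (simp add: Y0)
    qed simp
    then show ?thesis by (simp add: S_zero endo_simps)
  qed
  then show "(\<lambda>n. \<phi> (endo_op (S n t) x)) \<longlonglongrightarrow> \<phi> x" by simp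
qed

end

section \<open>The Banach space of self-adjoint trace-class operators\<close>

lemma sa_trace_class_selfadjoint: "A \<in> sa_trace_class \<Longrightarrow> selfadjoint A"
  by (simp add: sa_trace_class_def)

lemma nuc_bound_0: "nuc_bound (0 :: 'a op) 0"
  by (simp add: nuc_bound_def)

lemma sa_trace_class_add: "A \<in> sa_trace_class \<Longrightarrow> B \<in> sa_trace_class \<Longrightarrow> A + B \<in> sa_trace_class"
  by (rule sa_trace_classI(1)[OF selfadjoint_add nuc_bound_add])
    (auto intro: sa_trace_class_selfadjoint nuc_bound_trace_norm)

lemma sa_trace_class_scaleR: "A \<in> sa_trace_class \<Longrightarrow> r *\<^sub>R A \<in> sa_trace_class"
  by (rule sa_trace_classI(1)[OF selfadjoint_scaleR nuc_bound_scaleR])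
    (auto intro: sa_trace_class_selfadjoint nuc_bound_trace_norm)

lemma sa_trace_class_zero: "0 \<in> sa_trace_class"
  by (rule sa_trace_classI(1)[OF selfadjoint_zero nuc_bound_0])

lemma sa_trace_class_uminus: "A \<in> sa_trace_class \<Longrightarrow> - A \<in> sa_trace_class"
  using sa_trace_class_scaleR[of A "-1"] by simp

lemma sa_trace_class_diff: "A \<in> sa_trace_class \<Longrightarrow> B \<in> sa_trace_class \<Longrightarrow> A - B \<in> sa_trace_class"
  using sa_trace_class_add[OF _ sa_trace_class_uminus, of A B] by simp

typedef 'a sa_tc = "sa_trace_class :: 'a op set"
  morphisms tc_op Abs_tc
  using sa_trace_class_zero by blast

setup_lifting type_definition_sa_tc

instantiation sa_tc :: (type) real_normed_vector
begin

lift_definition zero_sa_tc :: "'a sa_tc" is "0" by (rule sa_trace_class_zero)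
lift_definition plus_sa_tc :: "'a sa_tc \<Rightarrow> 'a sa_tc \<Rightarrow> 'a sa_tc" is "(+)" by (rule sa_trace_class_add)
lift_definition minus_sa_tc :: "'a sa_tc \<Rightarrow> 'a sa_tc \<Rightarrow> 'a sa_tc" is "(-)" by (rule sa_trace_class_diff)
lift_definition uminus_sa_tc :: "'a sa_tc \<Rightarrow> 'a sa_tc" is "uminus" by (rule sa_trace_class_uminus)
lift_definition scaleR_sa_tc :: "real \<Rightarrow> 'a sa_tc \<Rightarrow> 'a sa_tc" is "(*\<^sub>R)" by (rule sa_trace_class_scaleR)
lift_definition norm_sa_tc :: "'a sa_tc \<Rightarrow> real" is trace_norm .

definition sgn_sa_tc :: "'a sa_tc \<Rightarrow> 'a sa_tc" where
  "sgn_sa_tc A = inverse (norm A) *\<^sub>R A"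

definition dist_sa_tc :: "'a sa_tc \<Rightarrow> 'a sa_tc \<Rightarrow> real" where
  "dist_sa_tc A B = norm (A - B)"

definition uniformity_sa_tc :: "('a sa_tc \<times> 'a sa_tc) filter" where
  "uniformity_sa_tc = (INF e\<in>{0<..}. principal {(x, y). dist x y < e})"

definition open_sa_tc :: "'a sa_tc set \<Rightarrow> bool" where
  "open_sa_tc U \<longleftrightarrow> (\<forall>x\<in>U. \<forall>\<^sub>F (x', y) in uniformity. x' = x \<longrightarrow> y \<in> U)"

instance
proof
  fix a b c :: "'a sa_tc" and r s :: real
  show "a + b + c = a + (b + c)" "a + b = b + a" "0 + a = a" "- a + a = 0" "a - b = a + - b"
    by (transfer; simp)+
  show "r *\<^sub>R (a + b) = r *\<^sub>R a + r *\<^sub>R b" "(r + s) *\<^sub>R a = r *\<^sub>R a + s *\<^sub>R a"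
    "r *\<^sub>R s *\<^sub>R a = (r * s) *\<^sub>R a" "1 *\<^sub>R a = a"
    by (transfer; simp add: algebra_simps)+
  show "sgn a = inverse (norm a) *\<^sub>R a" by (rule sgn_sa_tc_def)
  show "dist a b = norm (a - b)" by (rule dist_sa_tc_def)
  show "uniformity = (INF e\<in>{0<..}. principal {(x :: 'a sa_tc, y). dist x y < e})"
    by (rule uniformity_sa_tc_def)
  show "open U = (\<forall>x\<in>U. \<forall>\<^sub>F (x', y) in uniformity. x' = x \<longrightarrow> y \<in> U)" for U :: "'a sa_tc set"
    by (rule open_sa_tc_def)
  show "norm (a + b) \<le> norm a + norm b"
    by transfer (auto intro: sa_trace_classI(2) selfadjoint_add nuc_bound_add
        sa_trace_class_selfadjoint nuc_bound_trace_norm)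
  have le: "trace_norm (r *\<^sub>R A) \<le> \<bar>r\<bar> * trace_norm A" if "A \<in> sa_trace_class" for r and A :: "'a op"
    using that by (auto intro: sa_trace_classI(2) selfadjoint_scaleR nuc_bound_scaleR
        sa_trace_class_selfadjoint nuc_bound_trace_norm)
  have z: "(0 :: 'a op) \<in> sa_trace_class" by (rule sa_trace_class_zero)
  have n0: "trace_norm (0 :: 'a op) = 0"
    using le[OF z, of 0] nuc_bound_nonneg[OF nuc_bound_trace_norm[OF z]] by simp
  show "norm a = 0 \<longleftrightarrow> a = 0"
  proof transfer
    fix A :: "'a op" assume A: "A \<in> sa_trace_class"
    show "trace_norm A = 0 \<longleftrightarrow> A = 0"
      using op_norm_le_nuc_bound[OF nuc_bound_trace_norm[OF A]] n0 by auto
  qed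
  show "norm (r *\<^sub>R a) = \<bar>r\<bar> * norm a"
  proof transfer
    fix r and A :: "'a op" assume A: "A \<in> sa_trace_class"
    show "trace_norm (r *\<^sub>R A) = \<bar>r\<bar> * trace_norm A"
    proof (cases "r = 0")
      case False
      have "\<bar>r\<bar> * trace_norm A = \<bar>r\<bar> * trace_norm (inverse r *\<^sub>R r *\<^sub>R A)" using False by simp
      also have "\<dots> \<le> \<bar>r\<bar> * (\<bar>inverse r\<bar> * trace_norm (r *\<^sub>R A))"
        using A by (intro mult_left_mono le sa_trace_class_scaleR) auto
      also have "\<dots> = trace_norm (r *\<^sub>R A)" using False by (simp flip: mult.assoc add: abs_mult[symmetric])
      finally show ?thesis using le[OF A, of r] by simp
    qed (simp add: n0)
  qed
qed

end

lemmas tc_op_simps = zero_sa_tc.rep_eq plus_sa_tc.rep_eq minus_sa_tc.rep_eq uminus_sa_tc.rep_eq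
  scaleR_sa_tc.rep_eq

lemma tc_op_sum: "tc_op (\<Sum>i\<in>I. f i) = (\<Sum>i\<in>I. tc_op (f i))"
  by (induction I rule: infinite_finite_induct) (simp_all add: tc_op_simps)

lemma tc_op_selfadjoint: "selfadjoint (tc_op X)"
  using tc_op sa_trace_class_selfadjoint by blast

lemma tc_op_clinear [clinear]: "clinear_op (tc_op X)"
  by (rule selfadjoint_clinear[OF tc_op_selfadjoint])

lemma adj_tc_op: "adj (tc_op X) = tc_op X"
  by (rule tc_op_selfadjoint[unfolded selfadjoint_iff, THEN conjunct2])

lemma adj_proj: "adj (proj F) = proj F"
  by (rule selfadjoint_proj[unfolded selfadjoint_iff, THEN conjunct2])

lemma nuc_bound_norm: "nuc_bound (tc_op X) (norm X)"
  using nuc_bound_trace_norm[OF tc_op] by (simp add: norm_sa_tc.rep_eq)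

lemma norm_tc_le: "nuc_bound (tc_op X) c \<Longrightarrow> norm X \<le> c"
  by (simp add: norm_sa_tc.rep_eq sa_trace_classI(2) tc_op_selfadjoint)

lemma tc_op_Abs: "selfadjoint A \<Longrightarrow> nuc_bound A c \<Longrightarrow> tc_op (Abs_tc A) = A"
  by (simp add: Abs_tc_inverse sa_trace_classI(1))

lemma tc_eqI: "tc_op X = tc_op Y \<Longrightarrow> X = Y"
  by (simp add: tc_op_inject)

text \<open>A Cauchy sequence in trace norm is Cauchy in operator norm.
  \<open>nuc_bound_limit\<close> shows that its operator-norm limit has finite trace norm and is
  also the limit in trace norm.\<close>

instance sa_tc :: (type) banach
proof
  fix X :: "nat \<Rightarrow> 'a sa_tc" assume X: "Cauchy X"
  have d: "dist (tc_op A) (tc_op B) \<le> dist A B" for A B :: "'a sa_tc"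
    using op_norm_le_nuc_bound[OF nuc_bound_norm[of "A - B"]] by (simp add: dist_norm tc_op_simps)
  have "Cauchy (\<lambda>n. tc_op (X n))"
    using X unfolding Cauchy_def by (meson d le_less_trans)
  then obtain A where A: "(\<lambda>n. tc_op (X n)) \<longlonglongrightarrow> A" using Cauchy_convergent convergent_def by blast
  have sa: "selfadjoint A" by (rule tendsto_selfadjoint[OF tc_op_selfadjoint A])
  have nb: "\<exists>N. \<forall>n\<ge>N. nuc_bound (tc_op (X n) - A) e" if e: "e > 0" for e
  proof -
    obtain N where N: "\<forall>m\<ge>N. \<forall>n\<ge>N. dist (X m) (X n) < e"
      using X e unfolding Cauchy_def by blast
    have "nuc_bound (tc_op (X n) - A) e" if n: "n \<ge> N" for n
    proof (rule nuc_bound_limit)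
      show "(\<lambda>m. tc_op (X n) - tc_op (X m)) \<longlonglongrightarrow> tc_op (X n) - A" by (intro tendsto_intros A)
      have "nuc_bound (tc_op (X n) - tc_op (X m)) e" if "m \<ge> N" for m
        using nuc_bound_mono[OF nuc_bound_norm[of "X n - X m"], of e] N n that
        by (auto simp: tc_op_simps dist_norm less_imp_le)
      then show "\<forall>\<^sub>F m in sequentially. nuc_bound (tc_op (X n) - tc_op (X m)) e"
        by (auto simp: eventually_sequentially)
    qed
    then show ?thesis by blast
  qed
  obtain N where N: "nuc_bound (tc_op (X N) - A) 1" using nb[of 1] by auto
  have "nuc_bound (tc_op (X N) + (-1) *\<^sub>R (tc_op (X N) - A)) (norm (X N) + \<bar>-1\<bar> * 1)"
    by (intro nuc_bound_add nuc_bound_scaleR nuc_bound_norm N)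
  then have op: "tc_op (Abs_tc A) = A" by (intro tc_op_Abs sa) (simp add: algebra_simps)
  have "X \<longlonglongrightarrow> Abs_tc A"
  proof (rule metric_LIMSEQ_I)
    fix e :: real assume e: "e > 0"
    then obtain N where N: "\<forall>n\<ge>N. nuc_bound (tc_op (X n) - A) (e/2)" using nb[of "e/2"] by auto
    have "dist (X n) (Abs_tc A) < e" if "n \<ge> N" for n
    proof -
      have "norm (X n - Abs_tc A) \<le> e/2" using N that by (intro norm_tc_le) (simp add: tc_op_simps op)
      then show ?thesis using e by (simp add: dist_norm)
    qed
    then show "\<exists>N. \<forall>n\<ge>N. dist (X n) (Abs_tc A) < e" by blast
  qed
  then show "convergent X" by (auto simp: convergent_def)
qed

section \<open>Rank-one elements and sandwich maps on the trace-class space\<close>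

lemma nuc_bound_proj:
  assumes F: "finite F" shows "nuc_bound (proj F) (card F)"
proof (rule nuc_bound_positive)
  have eq: "proj F o\<^sub>L proj F = proj F"
    using F by (auto intro!: blinfun_eqI ell2_eqI simp: coeff_proj)
  show "positive_op (proj F)" using positive_square[OF selfadjoint_proj[of F]] by (simp add: eq)
  fix G :: "'a set" assume G: "finite G"
  have "(\<Sum>x\<in>G. diag (proj F) x) = (\<Sum>x\<in>G. if x \<in> F then 1 else 0)"
    using F by (intro sum.cong) (simp_all add: diag_def coeff_proj coeff_simps)
  also have "\<dots> = real (card (G \<inter> F))" using G by (simp add: sum.If_cases Int_def)
  also have "\<dots> \<le> card F" using F by (simp add: card_mono)
  finally show "(\<Sum>x\<in>G. diag (proj F) x) \<le> card F" .
qed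

lemma nuc_bound_rank1:
  fixes \<phi> \<psi> :: "'a ell2" obtains c where "nuc_bound (rank1 \<phi> \<psi>) c"
proof -
  let ?e = "basis_vec undefined :: 'a ell2" and ?P = "proj {undefined} :: 'a op"
  have "nuc_bound (rank1 \<phi> ?e o\<^sub>L ?P o\<^sub>L rank1 ?e \<psi>) (norm (rank1 \<phi> ?e) * card {undefined :: 'a} * norm (rank1 ?e \<psi>))"
    by (intro nuc_bound_sandwich nuc_bound_proj clinear) simp
  moreover have "rank1 \<phi> ?e o\<^sub>L ?P o\<^sub>L rank1 ?e \<psi> = rank1 \<phi> \<psi>"
    by (rule blinfun_eqI)
      (simp add: proj_def cinner_basis_vec coeff_simps)
  ultimately show thesis using that by metis
qed

text \<open>Real combinations of these, with \<open>\<i> *\<^sub>C \<phi>\<close> in the first slot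
  for the imaginary parts, will span the self-adjoint operators on a finite block.\<close>

definition sym_rank :: "'a ell2 \<Rightarrow> 'a ell2 \<Rightarrow> 'a sa_tc" where
  "sym_rank \<phi> \<psi> = Abs_tc (rank1 \<phi> \<psi> + rank1 \<psi> \<phi>)"

lemma tc_op_sym_rank: "tc_op (sym_rank \<phi> \<psi>) = rank1 \<phi> \<psi> + rank1 \<psi> \<phi>"
proof -
  obtain a b where "nuc_bound (rank1 \<phi> \<psi>) a" "nuc_bound (rank1 \<psi> \<phi>) b"
    using nuc_bound_rank1 by metis
  then have "nuc_bound (rank1 \<phi> \<psi> + rank1 \<psi> \<phi>) (a + b)" by (rule nuc_bound_add)
  moreover have "selfadjoint (rank1 \<phi> \<psi> + rank1 \<psi> \<phi>)"
  proof -
    have "cnj (cinner \<psi> \<xi>) = cinner \<xi> \<psi>" for \<xi> \<psi> :: "'a ell2" by (metis cinner_commute)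
    then show ?thesis
      by (simp add: selfadjoint_def clinear blinfun.bilinear_simps cinner_simps mult.commute)
  qed
  ultimately show ?thesis unfolding sym_rank_def by (intro tc_op_Abs)
qed

text \<open>Needed to form \<open>endo\<close> over this space; one non-zero element prevents
  isolated points.\<close>

instance sa_tc :: (type) perfect_space
proof
  fix X :: "'a sa_tc"
  show "\<not> open {X}"
  proof
    assume "open {X}"
    then obtain e where e: "e > 0" "ball X e \<subseteq> {X}" by (meson insertI1 open_contains_ball)
    let ?e = "basis_vec undefined :: 'a ell2"
    define U where "U = sym_rank ?e ?e"
    have "tc_op U ?e = 2 *\<^sub>R ?e"
      by (simp add: U_def tc_op_sym_rank blinfun.bilinear_simps cinner_basis_vec coeff_simps scaleR_2)
    moreover have "?e \<noteq> 0" by (metis norm_basis_vec norm_zero zero_neq_one)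
    ultimately have "U \<noteq> 0" by (auto simp: tc_op_simps)
    define Z where "Z = X + (e / (2 * norm U)) *\<^sub>R U"
    have "dist X Z < e" using e \<open>U \<noteq> 0\<close> by (simp add: Z_def dist_norm)
    then have "Z = X" using e(2) by auto
    then show False using e(1) \<open>U \<noteq> 0\<close> by (simp add: Z_def)
  qed
qed

text \<open>The symmetrized sandwich stays self-adjoint for arbitrary \<open>A\<close> and
  \<open>B\<close>. It covers the drift term (\<open>B\<close> the identity or the resolvent), the
  jump terms (\<open>A = B\<close>, halved in \<open>conj_tc\<close>) and the polarized difference
  in \<open>Lb_diff_G\<close>.\<close>

definition mix :: "'a op \<Rightarrow> 'a op \<Rightarrow> 'a sa_tc \<Rightarrow> 'a sa_tc" where
  "mix A B X = Abs_tc ((A o\<^sub>L tc_op X o\<^sub>L adj B) + (B o\<^sub>L tc_op X o\<^sub>L adj A))"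

lemma mix:
  assumes "clinear_op A" "clinear_op B"
  shows "tc_op (mix A B X) = (A o\<^sub>L tc_op X o\<^sub>L adj B) + (B o\<^sub>L tc_op X o\<^sub>L adj A)"
    and "norm (mix A B X) \<le> 2 * norm A * norm B * norm X"
proof -
  have "nuc_bound (A o\<^sub>L tc_op X o\<^sub>L adj B) (norm A * norm X * norm (adj B))"
    "nuc_bound (B o\<^sub>L tc_op X o\<^sub>L adj A) (norm B * norm X * norm (adj A))"
    by (rule nuc_bound_sandwich[OF nuc_bound_norm]; simp add: assms clinear)+
  from nuc_bound_add[OF this]
  have nb: "nuc_bound ((A o\<^sub>L tc_op X o\<^sub>L adj B) + (B o\<^sub>L tc_op X o\<^sub>L adj A)) (2 * norm A * norm B * norm X)"
    using assms by (simp add: norm_adj mult_ac)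
  have "selfadjoint ((A o\<^sub>L tc_op X o\<^sub>L adj B) + (B o\<^sub>L tc_op X o\<^sub>L adj A))"
    unfolding selfadjoint_iff using assms
    by (simp add: clinear adj_add adj_compose adj_adj adj_tc_op blinfun_compose_assoc add.commute)
  then show "tc_op (mix A B X) = (A o\<^sub>L tc_op X o\<^sub>L adj B) + (B o\<^sub>L tc_op X o\<^sub>L adj A)"
    unfolding mix_def by (rule tc_op_Abs[OF _ nb])
  with nb show "norm (mix A B X) \<le> 2 * norm A * norm B * norm X" by (simp add: norm_tc_le)
qed

lemma bounded_linear_mix:
  assumes "clinear_op A" "clinear_op B" shows "bounded_linear (mix A B)"
  by (rule bounded_linear_intro[where K = "2 * norm A * norm B"])
    (use mix(2)[OF assms] in \<open>auto intro!: tc_eqI blinfun_eqI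
      simp: mix(1)[OF assms] tc_op_simps blinfun.bilinear_simps scaleR_add_right mult_ac\<close>)

definition conj_tc :: "'a op \<Rightarrow> 'a sa_tc \<Rightarrow> 'a sa_tc" where
  "conj_tc A X = (1/2) *\<^sub>R mix A A X"

lemma tc_op_conj: "clinear_op A \<Longrightarrow> tc_op (conj_tc A X) = A o\<^sub>L tc_op X o\<^sub>L adj A"
  by (simp add: conj_tc_def tc_op_simps mix(1) flip: scaleR_2)

lemma bounded_linear_conj: "clinear_op A \<Longrightarrow> bounded_linear (conj_tc A)"
  unfolding conj_tc_def by (rule bounded_linear_const_scaleR[OF bounded_linear_mix])

section \<open>Trace, Jordan decomposition and approximation by finite sections\<close>

definition tr :: "'a sa_tc \<Rightarrow> real" where
  "tr X = infsum (diag (tc_op X)) UNIV"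

lemma diag_summable: "diag (tc_op X) summable_on UNIV"
  by (rule sa_trace_class_diag_summable(1)[OF tc_op])

lemma bounded_linear_tr: "bounded_linear tr"
proof (rule bounded_linear_intro[where K = 1])
  have add: "diag (tc_op (x + y)) = (\<lambda>i. diag (tc_op x) i + diag (tc_op y) i)" for x y :: "'a sa_tc"
    by (auto simp: tc_op_simps diag_simps)
  show "tr (x + y) = tr x + tr y" for x y :: "'a sa_tc"
    unfolding tr_def add by (intro infsum_add diag_summable)
  have scale: "diag (tc_op (r *\<^sub>R x)) = (\<lambda>i. r * diag (tc_op x) i)" for r and x :: "'a sa_tc"
    by (auto simp: tc_op_simps diag_simps)
  show "tr (r *\<^sub>R x) = r *\<^sub>R tr x" for r and x :: "'a sa_tc"
    unfolding tr_def scale by (simp add: infsum_cmult_right')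
  show "norm (tr x) \<le> norm x * 1" for x :: "'a sa_tc"
    using sa_trace_class_diag_summable(2)[OF tc_op] by (simp add: tr_def norm_sa_tc.rep_eq)
qed

lemma norm_positive: "positive_op (tc_op X) \<Longrightarrow> norm X = tr X"
  using trace_norm_has_sum[OF tc_op, of X]
  by (simp add: tr_def norm_sa_tc.rep_eq abs_op_positive_eq infsumI)

text \<open>The last clause keeps both parts in any block that contains \<open>X\<close>: the
  modulus has the same square as \<open>X\<close>, hence annihilates the basis vectors that
  \<open>X\<close> annihilates.\<close>

lemma jordan_decomposition:
  obtains Y Z where "X = Y - Z" "positive_op (tc_op Y)" "positive_op (tc_op Z)"
    "norm X = tr Y + tr Z"
    "\<And>x. tc_op X (basis_vec x) = 0 \<Longrightarrow> tc_op Y (basis_vec x) = 0 \<and> tc_op Z (basis_vec x) = 0"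
proof -
  define P where "P = abs_op (tc_op X)"
  note P = abs_op_selfadjoint[OF tc_op_selfadjoint[of X], folded P_def]
  have "nuc_bound P (norm X)"
  proof (rule nuc_bound_positive[OF P(1)])
    fix F :: "'a set" assume "finite F"
    then show "(\<Sum>x\<in>F. diag P x) \<le> norm X"
      using trace_norm_has_sum[OF tc_op, of X] P(1)
      unfolding norm_sa_tc.rep_eq P_def
      by (intro has_sum_mono2[OF has_sum_finite]) (auto simp: diag_nonneg)
  qed
  then have opP: "tc_op (Abs_tc P) = P" by (rule tc_op_Abs[OF positive_selfadjoint[OF P(1)]])
  define Y where "Y = (1/2) *\<^sub>R (Abs_tc P + X)"
  define Z where "Z = (1/2) *\<^sub>R (Abs_tc P - X)"
  have op: "tc_op Y = (1/2) *\<^sub>R (P + tc_op X)" "tc_op Z = (1/2) *\<^sub>R (P - tc_op X)"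
    by (simp_all add: Y_def Z_def tc_op_simps opP)
  show thesis
  proof (rule that[of Y Z])
    show "X = Y - Z" by (simp add: Y_def Z_def scaleR_diff_right scaleR_add_right flip: scaleR_add_left)
    show "positive_op (tc_op Y)" "positive_op (tc_op Z)"
      unfolding op P_def
      by (intro positive_scaleR positive_abs_add positive_abs_diff tc_op_selfadjoint; simp)+
    have "tr Y + tr Z = tr (Y + Z)"
      by (simp add: linear_add[OF bounded_linear.linear[OF bounded_linear_tr]])
    also have "Y + Z = Abs_tc P" by (simp add: Y_def Z_def scaleR_diff_right scaleR_add_right flip: scaleR_add_left)
    also have "tr (Abs_tc P) = norm X"
      using trace_norm_has_sum[OF tc_op, of X] opP by (simp add: tr_def norm_sa_tc.rep_eq P_def infsumI)
    finally show "norm X = tr Y + tr Z" by simp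
    fix x assume x: "tc_op X (basis_vec x) = 0"
    have "P (P (basis_vec x)) = 0" using P(2) x by (metis blinfun_apply_blinfun_compose blinfun.zero_right)
    then have "P (basis_vec x) \<bullet> P (basis_vec x) = 0"
      by (simp add: selfadjoint_inner[OF positive_selfadjoint[OF P(1)]])
    then show "tc_op Y (basis_vec x) = 0 \<and> tc_op Z (basis_vec x) = 0"
      using x by (simp add: op blinfun.bilinear_simps)
  qed
qed

lemma finite_sections:
  fixes X :: "'a sa_tc" assumes e: "e > 0"
  obtains F\<^sub>0 where "finite F\<^sub>0" "\<And>F. finite F \<Longrightarrow> F\<^sub>0 \<subseteq> F \<Longrightarrow> norm (X - conj_tc (proj F) X) \<le> e"
proof -
  obtain Y Z where YZ: "X = Y - Z" "positive_op (tc_op Y)" "positive_op (tc_op Z)"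
    using jordan_decomposition by metis
  have *: "\<exists>F\<^sub>0. finite F\<^sub>0 \<and> (\<forall>F. finite F \<longrightarrow> F\<^sub>0 \<subseteq> F \<longrightarrow> norm (Y - conj_tc (proj F) Y) \<le> e/2)"
    if Y: "positive_op (tc_op Y)" for Y :: "'a sa_tc"
  proof -
    have "e/2 > 0" using e by simp
    obtain F\<^sub>0 where F0: "finite F\<^sub>0" "\<And>F. finite F \<Longrightarrow> F\<^sub>0 \<subseteq> F \<Longrightarrow>
        nuc_bound (tc_op Y - (proj F o\<^sub>L tc_op Y o\<^sub>L proj F)) (e/2)"
      using positive_finite_sections[OF Y tc_op \<open>e/2 > 0\<close>] by metis
    have "tc_op (Y - conj_tc (proj F) Y) = tc_op Y - (proj F o\<^sub>L tc_op Y o\<^sub>L proj F)" for F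
      by (simp add: tc_op_simps tc_op_conj clinear adj_proj)
    with F0 show ?thesis by (metis norm_tc_le)
  qed
  obtain F G where F: "finite F" "\<forall>F'. finite F' \<longrightarrow> F \<subseteq> F' \<longrightarrow> norm (Y - conj_tc (proj F') Y) \<le> e/2"
    and G: "finite G" "\<forall>F'. finite F' \<longrightarrow> G \<subseteq> F' \<longrightarrow> norm (Z - conj_tc (proj F') Z) \<le> e/2"
    using *[OF YZ(2)] *[OF YZ(3)] by metis
  show thesis
  proof (rule that[of "F \<union> G"])
    show "finite (F \<union> G)" using F G by simp
    fix F' assume F': "finite F'" "F \<union> G \<subseteq> F'"
    have "X - conj_tc (proj F') X = (Y - conj_tc (proj F') Y) - (Z - conj_tc (proj F') Z)"
      by (simp add: YZ(1) linear_diff[OF bounded_linear.linear[OF bounded_linear_conj]] clinear)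
    then have "norm (X - conj_tc (proj F') X)
        \<le> norm (Y - conj_tc (proj F') Y) + norm (Z - conj_tc (proj F') Z)"
      by (metis norm_triangle_ineq4)
    then show "norm (X - conj_tc (proj F') X) \<le> e"
      using F F' G by (smt (verit) field_sum_of_halves le_sup_iff)
  qed
qed

subsection \<open>Operators supported on a finite block\<close>

text \<open>Only columns are constrained; the corresponding rows vanish by self-adjointness, see
  \<open>block_proj\<close>.\<close>

definition block :: "'a set \<Rightarrow> 'a sa_tc set" where
  "block F = {X. \<forall>x. x \<notin> F \<longrightarrow> tc_op X (basis_vec x) = 0}"

lemma subspace_block: "subspace (block F)"
  by (auto simp: subspace_def block_def tc_op_simps blinfun.bilinear_simps)

lemma block_mono: "F \<subseteq> G \<Longrightarrow> block F \<subseteq> block G"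
  by (auto simp: block_def)

lemma block_proj:
  assumes "finite F" "X \<in> block F"
  shows "proj F (tc_op X \<psi>) = tc_op X \<psi>" "tc_op X (proj F \<psi>) = tc_op X \<psi>"
proof -
  have "coeff (tc_op X \<psi>) x = 0" if "x \<notin> F" for x \<psi>
  proof -
    have "coeff (tc_op X \<psi>) x = cinner (tc_op X (basis_vec x)) \<psi>"
      by (simp add: selfadjoint_cinner[OF tc_op_selfadjoint] cinner_basis_vec)
    then show ?thesis using assms(2) that by (simp add: block_def)
  qed
  then have 1: "proj F (tc_op X \<psi>) = tc_op X \<psi>" for \<psi>
    by (auto intro!: ell2_eqI simp: coeff_proj assms(1))
  then show "proj F (tc_op X \<psi>) = tc_op X \<psi>" .
  show "tc_op X (proj F \<psi>) = tc_op X \<psi>"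
  proof (rule cinner_ext)
    show "cinner \<xi> (tc_op X (proj F \<psi>)) = cinner \<xi> (tc_op X \<psi>)" for \<xi>
      using 1[of \<xi>] by (metis selfadjoint_cinner tc_op_selfadjoint selfadjoint_proj)
  qed
qed

lemma conj_proj_in_block: "finite F \<Longrightarrow> conj_tc (proj F) X \<in> block F"
  by (simp add: block_def tc_op_conj clinear adj_proj proj_basis_vec)

lemma conj_proj_block: "finite F \<Longrightarrow> X \<in> block F \<Longrightarrow> conj_tc (proj F) X = X"
  by (intro tc_eqI blinfun_eqI) (simp add: tc_op_conj clinear adj_proj block_proj)

lemma block_span:
  assumes F: "finite F"
  shows "block F \<subseteq> span ((\<lambda>(x, y). sym_rank (basis_vec x) (basis_vec y)) ` (F \<times> F) \<union>
    (\<lambda>(x, y). sym_rank (\<i> *\<^sub>C basis_vec x) (basis_vec y)) ` (F \<times> F))"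
    (is "_ \<subseteq> span ?Z")
proof
  fix X assume X: "X \<in> block F"
  let ?m = "\<lambda>x y. coeff (tc_op X (basis_vec y)) x"
  \<comment> \<open>Each entry meets its mirror image when the indices are swapped, so this double
    sum is twice \<open>X\<close>.\<close>
  define Y where "Y = (\<Sum>x\<in>F. \<Sum>y\<in>F. Re (?m x y) *\<^sub>R sym_rank (basis_vec x) (basis_vec y)
    + Im (?m x y) *\<^sub>R sym_rank (\<i> *\<^sub>C basis_vec x) (basis_vec y))"
  have sym: "?m x y = cnj (?m y x)" for x y
    by (metis cinner_basis_vec cinner_commute selfadjoint_cinner tc_op_selfadjoint)
  have PXP: "tc_op X \<psi> = (\<Sum>x\<in>F. \<Sum>y\<in>F. (?m x y * coeff \<psi> y) *\<^sub>C basis_vec x)" for \<psi>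
  proof (rule ell2_eqI)
    fix z
    have "coeff (tc_op X \<psi>) z = coeff (proj F (tc_op X (proj F \<psi>))) z" by (simp add: block_proj F X)
    also have "\<dots> = (if z \<in> F then \<Sum>y\<in>F. ?m z y * coeff \<psi> y else 0)"
      by (simp add: coeff_proj F) (simp add: proj_def blinfun.sum_left blinfun.sum_right
          clinear_opD[OF tc_op_clinear] cinner_basis_vec coeff_sum coeff_simps mult.commute)
    also have "\<dots> = coeff (\<Sum>x\<in>F. \<Sum>y\<in>F. (?m x y * coeff \<psi> y) *\<^sub>C basis_vec x) z"
    proof -
      have "(\<Sum>y\<in>F. ?m x y * coeff \<psi> y * (if x = z then 1 else 0))
          = (if x = z then \<Sum>y\<in>F. ?m x y * coeff \<psi> y else 0)" for x
        by simp
      then show ?thesis using F by (simp add: coeff_sum coeff_simps)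
    qed
    finally show "coeff (tc_op X \<psi>) z = coeff (\<Sum>x\<in>F. \<Sum>y\<in>F. (?m x y * coeff \<psi> y) *\<^sub>C basis_vec x) z" .
  qed
  have entry: "tc_op (Re c *\<^sub>R sym_rank (basis_vec x) (basis_vec y)
      + Im c *\<^sub>R sym_rank (\<i> *\<^sub>C basis_vec x) (basis_vec y)) \<psi>
      = (c * coeff \<psi> y) *\<^sub>C basis_vec x + (cnj c * coeff \<psi> x) *\<^sub>C basis_vec y" for c x y \<psi>
    by (rule ell2_eqI) (simp add: tc_op_simps tc_op_sym_rank blinfun.bilinear_simps cinner_simps
        cinner_basis_vec coeff_simps complex_eq_iff algebra_simps)
  have "2 *\<^sub>R X = Y"
  proof (intro tc_eqI blinfun_eqI)
    fix \<psi>
    have "tc_op Y \<psi> = (\<Sum>x\<in>F. \<Sum>y\<in>F. (?m x y * coeff \<psi> y) *\<^sub>C basis_vec x)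
        + (\<Sum>x\<in>F. \<Sum>y\<in>F. (cnj (?m x y) * coeff \<psi> x) *\<^sub>C basis_vec y)"
      by (simp only: Y_def tc_op_sum blinfun.sum_left entry) (simp only: sum.distrib)
    also have "(\<Sum>x\<in>F. \<Sum>y\<in>F. (cnj (?m x y) * coeff \<psi> x) *\<^sub>C basis_vec y) = tc_op X \<psi>"
      unfolding PXP[of \<psi>] by (subst sum.swap) (simp flip: sym)
    finally show "tc_op (2 *\<^sub>R X) \<psi> = tc_op Y \<psi>"
      by (simp add: tc_op_simps blinfun.bilinear_simps scaleR_2 flip: PXP[of \<psi>])
  qed
  moreover have "Y \<in> span ?Z"
    unfolding Y_def
    by (intro span_sum span_add span_scale; rule span_base; force)
  ultimately have "(1/2) *\<^sub>R (2 *\<^sub>R X) \<in> span ?Z" by (metis span_scale)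
  then show "X \<in> span ?Z" by simp
qed

text \<open>The image of a basis of \<open>W\<close> is independent of the same cardinality; a
  vector of \<open>W\<close> outside its span would give an independent set that is too
  large.\<close>

lemma finite_dim_inj_imp_surj:
  fixes f :: "'v::real_vector \<Rightarrow> 'v"
  assumes W: "subspace W" "W \<subseteq> span Z" "finite Z"
    and f: "linear f" "f ` W \<subseteq> W" "\<And>w. w \<in> W \<Longrightarrow> f w = 0 \<Longrightarrow> w = 0"
    and w: "w \<in> W"
  obtains u where "u \<in> W" "f u = w"
proof -
  obtain B where B: "B \<subseteq> W" "independent B" "W \<subseteq> span B"
    using maximal_independent_subset[of W] by metis
  have spB: "span B = W" using B W(1) by (metis span_minimal subset_antisym)
  have finB: "finite B" using independent_span_bound[OF W(3) B(2)] B(1) W(2) by auto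
  have inj: "inj_on f (span B)"
    using f W(1) unfolding spB
    by (intro inj_onI) (metis linear_diff subspace_diff right_minus_eq)
  have ind: "independent (f ` B)"
    by (rule linear_independent_injective_image[OF f(1) B(2) inj])
  have "w \<in> span (f ` B)"
  proof (rule ccontr)
    assume n: "w \<notin> span (f ` B)"
    then have "independent (insert w (f ` B))" using ind by (simp add: independent_insertI)
    moreover have "insert w (f ` B) \<subseteq> span B" using w f(2) B(1) by (auto simp: spB)
    ultimately have "card (insert w (f ` B)) \<le> card B"
      using independent_span_bound[OF finB] by blast
    moreover have "w \<notin> f ` B" using n span_base[of w "f ` B"] by blast
    moreover have "card (f ` B) = card B"
      using inj span_superset[of B] by (intro card_image) (rule inj_on_subset)
    ultimately show False using finB by simp
  qed
  then have "w \<in> f ` W" using linear_span_image[OF f(1), of B] by (simp add: spB)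
  then show thesis using that by blast
qed

section \<open>Weighted shifts and the mode operators\<close>

text \<open>Guarantees that composing coefficients with \<open>g\<close> and multiplying by
  \<open>w\<close> is bounded by \<open>c\<close>. Injectivity is confined to the support of the
  weight because \<open>dn\<close> merges the occupation numbers 0 and 1.\<close>

definition admissible :: "('a \<Rightarrow> complex) \<Rightarrow> ('a \<Rightarrow> 'a) \<Rightarrow> real \<Rightarrow> bool" where
  "admissible w g c \<longleftrightarrow> inj_on g {x. w x \<noteq> 0} \<and> (\<forall>x. cmod (w x) \<le> c)"

definition shift_op :: "'a op \<Rightarrow> ('a \<Rightarrow> complex) \<Rightarrow> ('a \<Rightarrow> 'a) \<Rightarrow> bool" where
  "shift_op A w g \<longleftrightarrow> (\<forall>\<psi> x. coeff (A \<psi>) x = w x * coeff \<psi> (g x))"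

lemma admissible_sum:
  assumes a: "admissible w g c" and F: "finite F"
  shows "(\<Sum>x\<in>F. (cmod (w x * coeff \<psi> (g x)))\<^sup>2) \<le> c\<^sup>2 * (norm \<psi>)\<^sup>2"
proof -
  let ?G = "{x \<in> F. w x \<noteq> 0}"
  have inj: "inj_on g ?G" using a unfolding admissible_def by (auto intro: inj_on_subset)
  have "(\<Sum>x\<in>F. (cmod (w x * coeff \<psi> (g x)))\<^sup>2) = (\<Sum>x\<in>?G. (cmod (w x))\<^sup>2 * (cmod (coeff \<psi> (g x)))\<^sup>2)"
    using F by (intro sum.mono_neutral_cong_right) (auto simp: norm_mult power_mult_distrib)
  also have "\<dots> \<le> (\<Sum>x\<in>?G. c\<^sup>2 * (cmod (coeff \<psi> (g x)))\<^sup>2)"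
    using a by (intro sum_mono mult_right_mono power_mono) (auto simp: admissible_def)
  also have "\<dots> = c\<^sup>2 * (\<Sum>y\<in>g ` ?G. (cmod (coeff \<psi> y))\<^sup>2)"
    by (simp add: sum.reindex[OF inj] sum_distrib_left)
  also have "\<dots> \<le> c\<^sup>2 * (norm \<psi>)\<^sup>2" using F by (intro mult_left_mono sum_coeff_le_norm) auto
  finally show ?thesis .
qed

lemma admissible_square_summable:
  "admissible w g c \<Longrightarrow> square_summable (\<lambda>x. w x * coeff \<psi> (g x))"
  by (rule square_summable_bounded) (rule admissible_sum)

lemma shift_op_norm_apply:
  assumes "shift_op A w g" "admissible w g c" shows "norm (A \<psi>) \<le> c * norm \<psi>"
proof (rule power2_le_imp_le)
  have "0 \<le> c" using assms(2) unfolding admissible_def by (metis norm_ge_zero order_trans)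
  then show "0 \<le> c * norm \<psi>" by simp
  show "(norm (A \<psi>))\<^sup>2 \<le> (c * norm \<psi>)\<^sup>2"
    unfolding norm_ell2_sq[of "A \<psi>"] power_mult_distrib
    using assms square_summable_coeff[of "A \<psi>"]
    by (intro infsum_le_finite_sums) (auto simp: square_summable_def shift_op_def admissible_sum)
qed

lemma shift_op_norm: "shift_op A w g \<Longrightarrow> admissible w g c \<Longrightarrow> norm A \<le> c"
  using shift_op_norm_apply[of A w g c]
  by (intro op_norm_le) (auto simp: admissible_def intro: order_trans[OF norm_ge_zero])

lemma shift_op_clinear: "shift_op A w g \<Longrightarrow> clinear_op A"
  unfolding clinear_op_def shift_op_def by (intro allI ell2_eqI) (simp add: coeff_simps)

lemma shift_op_adj_basis:
  assumes A: "shift_op A w g"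
  shows "adj A (basis_vec x) = cnj (w x) *\<^sub>C basis_vec (g x)"
proof (rule ell2_eqI)
  fix y
  have "coeff (adj A (basis_vec x)) y = cnj (coeff (A (basis_vec y)) x)"
    by (metis adj_cinner cinner_basis_vec cinner_commute shift_op_clinear[OF A])
  then show "coeff (adj A (basis_vec x)) y = coeff (cnj (w x) *\<^sub>C basis_vec (g x)) y"
    using A by (auto simp: shift_op_def coeff_simps)
qed

text \<open>Jumps act on the diagonal alone, without coherences. This is what makes the occupation
  numbers follow a classical birth-death process.\<close>

lemma diag_shift_sandwich:
  assumes A: "shift_op A w g" and X: "clinear_op X"
  shows "diag (A o\<^sub>L X o\<^sub>L adj A) x = (cmod (w x))\<^sup>2 * diag X (g x)"
proof -
  have "coeff ((A o\<^sub>L X o\<^sub>L adj A) (basis_vec x)) x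
      = (w x * cnj (w x)) * coeff (X (basis_vec (g x))) (g x)"
    using A by (simp add: shift_op_adj_basis[OF A] clinear_opD[OF X] clinear_opD[OF shift_op_clinear[OF A]]
        shift_op_def coeff_simps mult_ac)
  then show ?thesis by (simp add: diag_def complex_norm_square[symmetric] del: of_real_power)
qed

lemma shift_op_adj:
  assumes A: "shift_op A w g" and B: "shift_op B w' g'"
    and wg: "\<And>x. w x \<noteq> 0 \<Longrightarrow> g' (g x) = x \<and> w' (g x) = cnj (w x)"
    and wg': "\<And>y. w' y \<noteq> 0 \<Longrightarrow> g (g' y) = y \<and> w (g' y) = cnj (w' y)"
  shows "adj A = B"
proof (rule adj_eqI)
  fix \<phi> \<psi>
  let ?f = "\<lambda>y. cnj (coeff \<phi> y) * (w' y * coeff \<psi> (g' y))"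
  have bij: "bij_betw g {x. w x \<noteq> 0} {y. w' y \<noteq> 0}"
  proof (rule bij_betw_byWitness[where f' = g'])
    show "\<forall>x\<in>{x. w x \<noteq> 0}. g' (g x) = x" "\<forall>y\<in>{y. w' y \<noteq> 0}. g (g' y) = y" using wg wg' by auto
    show "g ` {x. w x \<noteq> 0} \<subseteq> {y. w' y \<noteq> 0}" using wg by (metis (mono_tags) complex_cnj_zero_iff image_subsetI mem_Collect_eq)
    show "g' ` {y. w' y \<noteq> 0} \<subseteq> {x. w x \<noteq> 0}" using wg' by (metis (mono_tags) complex_cnj_zero_iff image_subsetI mem_Collect_eq)
  qed
  have "cinner (A \<phi>) \<psi> = (\<Sum>\<^sub>\<infinity>x. cnj (w x * coeff \<phi> (g x)) * coeff \<psi> x)"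
    using A by (simp add: cinner.rep_eq shift_op_def)
  also have "\<dots> = (\<Sum>\<^sub>\<infinity>x\<in>{x. w x \<noteq> 0}. ?f (g x))"
    using wg by (intro infsum_cong_neutral) auto
  also have "\<dots> = (\<Sum>\<^sub>\<infinity>y\<in>{y. w' y \<noteq> 0}. ?f y)" by (rule infsum_reindex_bij_betw[OF bij])
  also have "\<dots> = (\<Sum>\<^sub>\<infinity>y. ?f y)" by (rule infsum_cong_neutral) auto
  also have "\<dots> = cinner \<phi> (B \<psi>)" using B by (simp add: cinner.rep_eq shift_op_def)
  finally show "cinner (A \<phi>) \<psi> = cinner \<phi> (B \<psi>)" .
qed

definition wshift :: "('a \<Rightarrow> complex) \<Rightarrow> ('a \<Rightarrow> 'a) \<Rightarrow> 'a op" where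
  "wshift w g = Blinfun (\<lambda>\<psi>. Abs_ell2 (\<lambda>x. w x * coeff \<psi> (g x)))"

lemma shift_op_wshift: 
  assumes a: "admissible w g c" shows "shift_op (wshift w g) w g"
proof -
  let ?f = "\<lambda>\<psi>. Abs_ell2 (\<lambda>x. w x * coeff \<psi> (g x))"
  have c: "coeff (?f \<psi>) x = w x * coeff \<psi> (g x)" for \<psi> x
    by (simp add: Abs_ell2_inverse admissible_square_summable[OF a])
  have "bounded_linear ?f"
  proof (rule bounded_linear_intro[where K = c])
    fix \<psi>
    have "0 \<le> c" using a unfolding admissible_def by (metis norm_ge_zero order_trans)
    show "norm (?f \<psi>) \<le> norm \<psi> * c"
    proof (rule power2_le_imp_le)
      show "0 \<le> norm \<psi> * c" using \<open>0 \<le> c\<close> by simp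
      show "(norm (?f \<psi>))\<^sup>2 \<le> (norm \<psi> * c)\<^sup>2"
        unfolding norm_ell2_sq[of "?f \<psi>"] mult.commute[of "norm \<psi>" c] power_mult_distrib
        using a square_summable_coeff[of "?f \<psi>"]
        by (intro infsum_le_finite_sums) (auto simp: square_summable_def c admissible_sum)
    qed
  next
    show "?f (\<phi> + \<psi>) = ?f \<phi> + ?f \<psi>" for \<phi> \<psi>
      by (rule ell2_eqI, subst c) (simp only: c coeff_simps distrib_left)
    show "?f (r *\<^sub>R \<psi>) = r *\<^sub>R ?f \<psi>" for r \<psi>
      by (rule ell2_eqI, subst c) (simp only: c coeff_simps mult.left_commute)
  qed
  then show ?thesis by (simp add: shift_op_def wshift_def bounded_linear_Blinfun_apply c)
qed

lemmas coeff_wshift = shift_op_wshift[unfolded shift_op_def, rule_format]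

section \<open>Multi-indices and their total degree\<close>

definition deg :: "('k::finite \<Rightarrow> nat) \<Rightarrow> nat" where "deg m = (\<Sum>k\<in>UNIV. m k)"

definition up :: "'k \<Rightarrow> ('k \<Rightarrow> nat) \<Rightarrow> 'k \<Rightarrow> nat" where "up k m = m(k := m k + 1)"

text \<open>Subtraction is truncated, so \<open>dn k\<close> fixes indices with
  \<open>m k = 0\<close>; the weight \<open>sqrt (m k)\<close> that accompanies it vanishes
  there.\<close>

definition dn :: "'k \<Rightarrow> ('k \<Rightarrow> nat) \<Rightarrow> 'k \<Rightarrow> nat" where "dn k m = m(k := m k - 1)"

lemma up_dn_apply: "up k m j = (if j = k then m k + 1 else m j)" "dn k m j = (if j = k then m k - 1 else m j)"
  by (simp_all add: up_def dn_def)

lemma dn_up [simp]: "dn k (up k m) = m"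
  by (simp add: up_def dn_def)

lemma up_dn [simp]: "m k > 0 \<Longrightarrow> up k (dn k m) = m"
  by (simp add: up_def dn_def)

lemma le_deg: "m k \<le> deg m"
  unfolding deg_def by (rule member_le_sum) auto

lemma deg_up [simp]: "deg (up k m) = deg m + 1"
  using sum.remove[of UNIV k m] sum.remove[of UNIV k "up k m"]
  by (simp add: deg_def up_dn_apply)

lemma deg_dn: "m k > 0 \<Longrightarrow> deg m = deg (dn k m) + 1"
  using deg_up[of k "dn k m"] by simp

lemma finite_deg_le: "finite {m :: 'k::finite \<Rightarrow> nat. deg m \<le> M}"
proof (rule finite_subset)
  show "{m :: 'k \<Rightarrow> nat. deg m \<le> M} \<subseteq> {m. \<forall>k. (k \<in> UNIV \<longrightarrow> m k \<in> {..M}) \<and> (k \<notin> UNIV \<longrightarrow> m k = 0)}"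
    using le_deg order_trans by fastforce
  show "finite {m :: 'k \<Rightarrow> nat. \<forall>k. (k \<in> UNIV \<longrightarrow> m k \<in> {..M}) \<and> (k \<notin> UNIV \<longrightarrow> m k = 0)}"
    by (rule finite_set_of_finite_funs) auto
qed

lemma inj_on_up: "inj_on (up k) S"
  by (metis dn_up inj_onI)

lemma inj_on_dn: "(\<And>m. m \<in> S \<Longrightarrow> m k > 0) \<Longrightarrow> inj_on (dn k) S"
  by (metis up_dn inj_onI)

section \<open>Mode operators in coordinates and the resolvent of the number operator\<close>

lemma annih_coeff_up: "annih_coeff k f m = of_real (sqrt (real (m k + 1))) * f (up k m)"
  by (simp add: annih_coeff_def up_def)

lemma create_coeff_dn: "create_coeff k f m = of_real (sqrt (real (m k))) * f (dn k m)"
  by (simp add: create_coeff_def dn_def)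

lemma coeff_b_op: "\<psi> \<in> dom_b k \<Longrightarrow> coeff (b_op k \<psi>) m = of_real (sqrt (real (m k + 1))) * coeff \<psi> (up k m)"
  by (simp add: b_op_def dom_b_def Abs_ell2_inverse annih_coeff_up)

lemma coeff_bdag_op: "\<psi> \<in> dom_bdag k \<Longrightarrow> coeff (bdag_op k \<psi>) m = of_real (sqrt (real (m k))) * coeff \<psi> (dn k m)"
  by (simp add: bdag_op_def dom_bdag_def Abs_ell2_inverse create_coeff_dn)

lemma of_real_sqrt_mult_self: "0 \<le> r \<Longrightarrow> complex_of_real (sqrt r) * (of_real (sqrt r) * z) = of_real r * z"
  by (metis mult.assoc of_real_mult real_sqrt_mult_self abs_of_nonneg)

lemma of_real_sqrt_mult_self_Suc:
  "complex_of_real (sqrt (1 + real n)) * (of_real (sqrt (1 + real n)) * z) = (1 + of_nat n) * z"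
  using of_real_sqrt_mult_self[of "1 + real n" z] by simp

lemma sqrt_nat_le: "sqrt (real n) \<le> real n"
  by (cases n) (auto intro!: real_le_lsqrt simp: power2_eq_square algebra_simps)

lemma coeff_bdag_b:
  assumes "\<psi> \<in> dom_b k" "b_op k \<psi> \<in> dom_bdag k"
  shows "coeff (bdag_op k (b_op k \<psi>)) m = of_nat (m k) * coeff \<psi> m"
proof (cases "m k > 0")
  case True
  then have "real (dn k m k + 1) = real (m k)" by (simp add: up_dn_apply)
  with True show ?thesis
    using assms of_real_sqrt_mult_self[of "real (m k)" "coeff \<psi> m"]
    by (simp add: coeff_b_op coeff_bdag_op del: of_nat_Suc of_nat_add)
qed (simp add: assms coeff_bdag_op)

lemma coeff_number_op:
  assumes "\<psi> \<in> D0" shows "coeff (\<psi> + number_op \<psi>) m = of_nat (1 + deg m) * coeff \<psi> m"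
  using assms
  by (simp add: number_op_def D0_def coeff_simps coeff_sum coeff_bdag_b deg_def distrib_right
      sum_distrib_right)

definition res_weight :: "('k::finite \<Rightarrow> nat) \<Rightarrow> complex" where
  "res_weight m = of_real (1 / (1 + real (deg m)))"

definition res_op :: "('k::finite \<Rightarrow> nat) op" where
  "res_op = wshift res_weight id"

lemma coeff_res_op: "coeff (res_op \<psi>) m = of_real (1 / (1 + real (deg m))) * coeff \<psi> m"
proof -
  have "admissible res_weight id (1::real)"
    unfolding admissible_def res_weight_def norm_of_real by simp
  from coeff_wshift[OF this] show ?thesis by (simp only: res_op_def res_weight_def id_apply)
qed

lemma sqrt_mult_le: "0 \<le> a \<Longrightarrow> 0 \<le> b \<Longrightarrow> a \<le> c \<Longrightarrow> b \<le> c \<Longrightarrow> sqrt a * sqrt b \<le> c"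
  using mult_mono[of "sqrt a" "sqrt c" "sqrt b" "sqrt c"] by simp

text \<open>This and the next two are the weights of \<open>b\<^sub>k\<close>,
  \<open>b\<^sub>k\<^sup>*\<close> and \<open>b\<^sub>j\<^sup>* b\<^sub>k\<close> applied after the
  resolvent. The resolvent acts first, so its factor is taken at the shifted index.\<close>

definition b_weight :: "'k::finite \<Rightarrow> ('k \<Rightarrow> nat) \<Rightarrow> complex" where
  "b_weight k m = of_real (sqrt (real (m k + 1)) / (1 + real (deg (up k m))))"

definition bdag_weight :: "'k::finite \<Rightarrow> ('k \<Rightarrow> nat) \<Rightarrow> complex" where
  "bdag_weight k m = of_real (sqrt (real (m k)) / (1 + real (deg (dn k m))))"

definition hop_weight :: "'k::finite \<Rightarrow> 'k \<Rightarrow> ('k \<Rightarrow> nat) \<Rightarrow> complex" where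
  "hop_weight j k m =
    of_real (sqrt (real (m j)) * sqrt (real (dn j m k + 1)) / (1 + real (deg (up k (dn j m)))))"

lemma admissible_b_weight: "admissible (b_weight k) (up k) 1"
  unfolding admissible_def
proof (intro conjI allI inj_on_up)
  fix m :: "'a \<Rightarrow> nat"
  have "sqrt (real (m k + 1)) \<le> real (m k + 1)" by (rule sqrt_nat_le)
  also have "\<dots> \<le> 1 + real (deg (up k m))" using le_deg[of m k] by simp
  finally show "cmod (b_weight k m) \<le> 1"
    unfolding b_weight_def norm_of_real by (simp add: abs_of_nonneg del: deg_up)
qed

lemma admissible_bdag_weight: "admissible (bdag_weight k) (dn k) 1"
  unfolding admissible_def
proof (intro conjI allI inj_on_dn)
  fix m :: "'a \<Rightarrow> nat"
  show "m k > 0" if "m \<in> {m. bdag_weight k m \<noteq> 0}"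
    using that by (cases "m k") (auto simp: bdag_weight_def)
  show "cmod (bdag_weight k m) \<le> 1"
  proof (cases "m k > 0")
    case True
    have "sqrt (real (m k)) \<le> real (m k)" by (rule sqrt_nat_le)
    also have "\<dots> \<le> 1 + real (deg (dn k m))" using le_deg[of m k] deg_dn[of m k, OF True] by simp
    finally show ?thesis unfolding bdag_weight_def norm_of_real by (simp add: abs_of_nonneg)
  qed (simp add: bdag_weight_def)
qed

lemma admissible_hop_weight: "admissible (hop_weight j k) (\<lambda>m. up k (dn j m)) 1"
  unfolding admissible_def
proof (intro conjI allI)
  have pos: "m j > 0" if "hop_weight j k m \<noteq> 0" for m
    using that by (cases "m j") (auto simp: hop_weight_def)
  show "inj_on (\<lambda>m. up k (dn j m)) {m. hop_weight j k m \<noteq> 0}"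
  proof (rule inj_onI)
    fix x y assume xy: "x \<in> {m. hop_weight j k m \<noteq> 0}" "y \<in> {m. hop_weight j k m \<noteq> 0}"
      "up k (dn j x) = up k (dn j y)"
    from arg_cong[OF xy(3), of "dn k"] have "up j (dn j x) = up j (dn j y)" by simp
    moreover have "x j > 0" "y j > 0" using pos xy(1,2) by simp_all
    ultimately show "x = y" using up_dn[of x j] up_dn[of y j] by simp
  qed
  fix m :: "'a \<Rightarrow> nat"
  show "cmod (hop_weight j k m) \<le> 1"
  proof (cases "m j > 0")
    case True
    have "sqrt (real (m j)) * sqrt (real (dn j m k + 1)) \<le> real (deg m)"
      using le_deg[of m j] le_deg[of "dn j m" k] deg_dn[of m j, OF True] by (intro sqrt_mult_le) auto
    also have "\<dots> \<le> 1 + real (deg (up k (dn j m)))" using deg_dn[of m j, OF True] by simp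
    finally show ?thesis unfolding hop_weight_def norm_of_real by (simp add: abs_of_nonneg del: deg_up)
  qed (simp add: hop_weight_def)
qed

lemma res_dom_b: "res_op \<psi> \<in> dom_b k"
  using admissible_square_summable[OF admissible_b_weight, of k \<psi>]
  by (simp add: dom_b_def annih_coeff_up[abs_def] coeff_res_op b_weight_def)

lemma res_dom_bdag: "res_op \<psi> \<in> dom_bdag k"
  using admissible_square_summable[OF admissible_bdag_weight, of k \<psi>]
  by (simp add: dom_bdag_def create_coeff_dn[abs_def] coeff_res_op bdag_weight_def)

lemma b_res_dom_bdag: "b_op k (res_op \<psi>) \<in> dom_bdag j"
  using admissible_square_summable[OF admissible_hop_weight, of j k \<psi>]
  by (simp add: dom_bdag_def create_coeff_dn[abs_def] coeff_b_op[OF res_dom_b] coeff_res_op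
      hop_weight_def mult_ac)

lemma bdag_res_dom_b: "bdag_op k (res_op \<psi>) \<in> dom_b k"
proof -
  let ?w = "\<lambda>m. complex_of_real (real (m k + 1) / (1 + real (deg m)))"
  have "admissible ?w id 1"
    unfolding admissible_def
  proof (intro conjI allI)
    fix m :: "'a \<Rightarrow> nat"
    have "real (m k + 1) \<le> 1 + real (deg m)" using le_deg[of m k] by simp
    then show "cmod (?w m) \<le> 1" unfolding norm_of_real by simp
  qed simp
  from admissible_square_summable[OF this, of \<psi>] show ?thesis
    by (simp add: dom_b_def annih_coeff_up[abs_def] coeff_bdag_op[OF res_dom_bdag] coeff_res_op
        up_dn_apply of_real_sqrt_mult_self_Suc)
qed

lemma res_op_D0: "res_op \<psi> \<in> D0"
  by (simp add: D0_def res_dom_b b_res_dom_bdag)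

text \<open>\<open>1 + n\<close> multiplies each coefficient by the non-zero number
  \<open>1 + deg m\<close>, so it is injective on \<open>D0\<close> and \<open>inv_into\<close> is
  determined by a single preimage.\<close>

lemma number_resolvent_eq: "number_resolvent \<psi> = res_op \<psi>"
  unfolding number_resolvent_def
proof (rule inv_into_f_eq)
  have "\<phi> = \<xi>" if "\<phi> \<in> D0" "\<xi> \<in> D0" "\<phi> + number_op \<phi> = \<xi> + number_op \<xi>" for \<phi> \<xi> :: "'a fock"
  proof (rule ell2_eqI)
    fix m
    have "of_nat (1 + deg m) * coeff \<phi> m = of_nat (1 + deg m) * coeff \<xi> m"
      using that by (metis coeff_number_op)
    then show "coeff \<phi> m = coeff \<xi> m" by (simp del: of_nat_Suc of_nat_add)
  qed
  then show "inj_on (\<lambda>\<psi> :: 'a fock. \<psi> + number_op \<psi>) D0" by (auto intro: inj_onI)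
  show "res_op \<psi> + number_op (res_op \<psi>) = \<psi>"
  proof (rule ell2_eqI)
    fix m :: "'a \<Rightarrow> nat"
    have "complex_of_real (1 + real (deg m)) \<noteq> 0" unfolding of_real_eq_0_iff by simp
    then show "coeff (res_op \<psi> + number_op (res_op \<psi>)) m = coeff \<psi> m"
      by (simp add: coeff_number_op[OF res_op_D0] coeff_res_op)
  qed
qed (rule res_op_D0)

lemma R_op_eq: "R_op = res_op"
  unfolding R_op_def number_resolvent_eq[abs_def] by (rule blinfun_apply_inverse)

lemma resolvent_product_eq:
  assumes "\<And>\<psi>. X (res_op \<psi>) = blinfun_apply A \<psi>" shows "resolvent_product X = A"
  unfolding resolvent_product_def number_resolvent_eq assms by (rule blinfun_apply_inverse)

lemma shift_op_b: "shift_op (resolvent_product (b_op k)) (b_weight k) (up k)"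
proof -
  have "b_op k (res_op \<psi>) = wshift (b_weight k) (up k) \<psi>" for \<psi>
    by (rule ell2_eqI) (simp add: coeff_wshift[OF admissible_b_weight] coeff_b_op[OF res_dom_b]
        coeff_res_op b_weight_def)
  then show ?thesis
    using shift_op_wshift[OF admissible_b_weight] by (simp add: resolvent_product_eq)
qed

lemma shift_op_bdag: "shift_op (resolvent_product (bdag_op k)) (bdag_weight k) (dn k)"
proof -
  have "bdag_op k (res_op \<psi>) = wshift (bdag_weight k) (dn k) \<psi>" for \<psi>
    by (rule ell2_eqI) (simp add: coeff_wshift[OF admissible_bdag_weight] coeff_bdag_op[OF res_dom_bdag]
        coeff_res_op bdag_weight_def)
  then show ?thesis
    using shift_op_wshift[OF admissible_bdag_weight] by (simp add: resolvent_product_eq)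
qed

lemma coeff_hop: "coeff (bdag_op j (b_op k (res_op \<psi>))) m = hop_weight j k m * coeff \<psi> (up k (dn j m))"
  by (simp add: coeff_bdag_op[OF b_res_dom_bdag] coeff_b_op[OF res_dom_b] coeff_res_op hop_weight_def)

lemma coeff_b_bdag: "coeff (b_op k (bdag_op k (res_op \<psi>))) m = of_nat (m k + 1) * coeff (res_op \<psi>) m"
  by (simp add: coeff_b_op[OF bdag_res_dom_b] coeff_bdag_op[OF res_dom_bdag] up_dn_apply
      of_real_sqrt_mult_self_Suc)

section \<open>Positivity of resolvents of bounded Lindblad operators\<close>

text \<open>
  If \<open>X\<close> had negative bottom \<open>\<mu>\<close>, testing the hypothesis against an approximate eigenvector would
  give \<open>0 \<le> \<mu> (l - c) + o(1)\<close>, because \<open>X \<ge> \<mu>\<close> under the jump terms.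
\<close>

lemma lindblad_resolvent_positive:
  fixes X K B C :: "'a op"
  assumes X: "selfadjoint X" and cl: "clinear_op K" "clinear_op B" "clinear_op C"
    and st: "0 \<le> s" "0 \<le> t" and lc: "c < l" "0 \<le> l"
    and form: "\<And>v. s * (norm (adj B v))\<^sup>2 + t * (norm (adj C v))\<^sup>2 - 2 * (v \<bullet> K v) \<le> c * (norm v)\<^sup>2"
    and pos: "positive_op (l *\<^sub>R X - (- ((K o\<^sub>L X) + (X o\<^sub>L adj K))
      + s *\<^sub>R (B o\<^sub>L X o\<^sub>L adj B) + t *\<^sub>R (C o\<^sub>L X o\<^sub>L adj C)))"
  shows "positive_op X"
proof (rule ccontr)
  assume "\<not> positive_op X"
  then obtain \<mu> where \<mu>: "\<mu> < 0" "\<And>\<psi>. \<mu> * (norm \<psi>)\<^sup>2 \<le> \<psi> \<bullet> X \<psi>"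
    and ap: "\<And>e. e > 0 \<Longrightarrow> \<exists>\<psi>. norm \<psi> = 1 \<and> norm (X \<psi> - \<mu> *\<^sub>R \<psi>) < e"
    using not_positive_approx[OF X] by metis
  have adj: "v \<bullet> A w = adj A v \<bullet> w" "v \<bullet> adj A w = A v \<bullet> w" if "clinear_op A" for A :: "'a op" and v w
    using adj_cinner[OF that, of v w] adj_cinner'[OF that, of v w] by (simp_all flip: Re_cinner)
  \<comment> \<open>\<open>D - 1\<close> bounds all contributions of the residual \<open>r\<close>;
    the added 1 makes \<open>D\<close> positive. The tolerance \<open>e\<close> is then set so that
    \<open>D * e\<close> exactly cancels \<open>\<mu> * (l - c)\<close>.\<close>
  define D where "D = l + 2 * norm K + 1"
  have D: "D > 0" using lc norm_ge_zero[of K] unfolding D_def by linarith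
  define e where "e = - \<mu> * (l - c) / D"
  have "e > 0" using \<mu>(1) lc D by (simp add: e_def mult_neg_pos divide_neg_pos)
  then obtain v where v: "norm v = 1" "norm (X v - \<mu> *\<^sub>R v) < e" using ap by blast
  define r where "r = X v - \<mu> *\<^sub>R v"
  have Xv: "X v = \<mu> *\<^sub>R v + r" by (simp add: r_def)
  have "0 \<le> l * (v \<bullet> X v) - (- (v \<bullet> K (X v) + v \<bullet> X (adj K v))
      + s * (v \<bullet> B (X (adj B v))) + t * (v \<bullet> C (X (adj C v))))"
    using positive_inner[OF pos, of v]
    by (simp add: blinfun.bilinear_simps inner_diff inner_add algebra_simps)
  also have "v \<bullet> X (adj K v) = v \<bullet> K (X v)"
    using adj(2)[OF cl(1), of "X v" v] by (simp add: inner_commute flip: selfadjoint_inner[OF X])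
  also have "v \<bullet> K (X v) = \<mu> * (v \<bullet> K v) + v \<bullet> K r"
    by (simp add: Xv blinfun.bilinear_simps inner_add)
  also have "v \<bullet> B (X (adj B v)) = adj B v \<bullet> X (adj B v)" by (rule adj(1)[OF cl(2)])
  also have "v \<bullet> C (X (adj C v)) = adj C v \<bullet> X (adj C v)" by (rule adj(1)[OF cl(3)])
  also have "v \<bullet> X v = \<mu> + v \<bullet> r"
    using v(1) by (simp add: Xv inner_add flip: power2_norm_eq_inner)
  finally have "0 \<le> l * (\<mu> + v \<bullet> r) + 2 * (\<mu> * (v \<bullet> K v) + v \<bullet> K r)
      - s * (adj B v \<bullet> X (adj B v)) - t * (adj C v \<bullet> X (adj C v))"
    by simp
  also have "\<dots> \<le> l * (\<mu> + v \<bullet> r) + 2 * (\<mu> * (v \<bullet> K v) + v \<bullet> K r)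
      - s * (\<mu> * (norm (adj B v))\<^sup>2) - t * (\<mu> * (norm (adj C v))\<^sup>2)"
    using st \<mu>(2) by (intro diff_mono mult_left_mono) auto
  also have "\<dots> = l * \<mu> - \<mu> * (s * (norm (adj B v))\<^sup>2 + t * (norm (adj C v))\<^sup>2 - 2 * (v \<bullet> K v))
      + (l * (v \<bullet> r) + 2 * (v \<bullet> K r))"
    by (simp add: algebra_simps)
  also have "\<dots> \<le> l * \<mu> - \<mu> * (c * (norm v)\<^sup>2) + (l * norm r + 2 * (norm K * norm r))"
  proof -
    have "\<mu> * (c * (norm v)\<^sup>2) \<le> \<mu> * (s * (norm (adj B v))\<^sup>2 + t * (norm (adj C v))\<^sup>2 - 2 * (v \<bullet> K v))"
      using \<mu>(1) form[of v] by (intro mult_left_mono_neg) auto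
    moreover have "l * (v \<bullet> r) \<le> l * norm r"
      using norm_cauchy_schwarz[of v r] v(1) lc by (intro mult_left_mono) auto
    moreover have "v \<bullet> K r \<le> norm K * norm r"
      using norm_cauchy_schwarz[of v "K r"] norm_blinfun[of K r] v(1) by simp
    ultimately show ?thesis by linarith
  qed
  also have "\<dots> = \<mu> * (l - c) + (D - 1) * norm r"
    using v(1) by (simp add: D_def algebra_simps)
  also have "\<dots> \<le> \<mu> * (l - c) + D * norm r" by (simp add: mult_right_mono)
  also have "\<dots> < \<mu> * (l - c) + D * e"
    using v(2) D by (simp add: r_def)
  also have "\<dots> = 0" using D by (simp add: e_def)
  finally show False by simp
qed

lemma inner_diagonal_le:
  assumes A: "\<And>\<psi> x. coeff (A \<psi>) x = of_real (d x) * coeff \<psi> x" and d: "\<And>x. d x \<le> c"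
  shows "v \<bullet> A v \<le> c * (norm v)\<^sup>2"
proof -
  have "0 \<le> (\<Sum>\<^sub>\<infinity>x. Re (cnj (coeff v x) * coeff (c *\<^sub>R v - A v) x))"
  proof (rule infsum_nonneg)
    fix x
    have "cnj (coeff v x) * coeff (c *\<^sub>R v - A v) x = of_real (c - d x) * (coeff v x * cnj (coeff v x))"
      by (simp add: A coeff_simps algebra_simps)
    also have "\<dots> = of_real ((c - d x) * (cmod (coeff v x))\<^sup>2)"
      by (simp only: of_real_mult complex_norm_square)
    finally show "0 \<le> Re (cnj (coeff v x) * coeff (c *\<^sub>R v - A v) x)" using d by simp
  qed
  also have "\<dots> = v \<bullet> (c *\<^sub>R v - A v)"
    using infsum_Re[OF square_summable_product[OF square_summable_coeff square_summable_coeff],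
        of v "c *\<^sub>R v - A v"]
    by (simp add: cinner.rep_eq flip: Re_cinner)
  finally show ?thesis by (simp add: inner_diff power2_norm_eq_inner)
qed

section \<open>The truncated model\<close>

lemma deg_option: "deg m = m None + (\<Sum>k\<in>UNIV. m (Some k))" for m :: "'n::finite option \<Rightarrow> nat"
  by (simp add: deg_def UNIV_option_conv sum.reindex)

locale boson_model =
  fixes E \<epsilon> \<eta> \<sigma>p \<sigma>m :: real and n :: "'n::finite"
  assumes sp: "0 \<le> \<sigma>p" and sm: "\<sigma>p < \<sigma>m"
begin

text \<open>The diagonal part of \<open>K\<^sub>n\<close>; what remains is the hopping between
  factors 0 and \<open>n\<close>.\<close>

definition kap :: "('n option \<Rightarrow> nat) \<Rightarrow> complex" where
  "kap m = of_real (\<sigma>p / 2 * real (m None + 1) + \<sigma>m / 2 * real (m None))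
    + \<i> * of_real (E * real (m None) + \<epsilon> * real (\<Sum>k\<in>UNIV. m (Some k)))"

definition kap_bound :: real where "kap_bound = \<sigma>p + \<sigma>m + \<bar>E\<bar> + \<bar>\<epsilon>\<bar>"

lemma cmod_kap_le: "cmod (kap m) \<le> kap_bound * (1 + real (deg m))"
proof -
  let ?a = "real (m None)" and ?s = "real (\<Sum>k\<in>UNIV. m (Some k))"
  have le: "?a + ?s = real (deg m)" by (simp add: deg_option)
  have s0: "?s \<ge> 0" by (rule of_nat_0_le_iff)
  have "cmod (kap m) \<le> \<bar>\<sigma>p / 2 * real (m None + 1) + \<sigma>m / 2 * ?a\<bar> + \<bar>E * ?a + \<epsilon> * ?s\<bar>"
    unfolding kap_def
    by (rule order_trans[OF norm_triangle_ineq]) (simp only: norm_mult norm_ii norm_of_real mult_1 order_refl)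
  also have "\<dots> \<le> (\<sigma>p + \<sigma>m) * (1 + real (deg m)) + (\<bar>E\<bar> + \<bar>\<epsilon>\<bar>) * (1 + real (deg m))"
  proof (rule add_mono)
    have "\<sigma>p / 2 * real (m None + 1) \<le> \<sigma>p * (1 + real (deg m))"
      using sp s0 le by (intro mult_mono) auto
    moreover have "\<sigma>m / 2 * ?a \<le> \<sigma>m * (1 + real (deg m))"
      using sp sm s0 le by (intro mult_mono) auto
    moreover have "0 \<le> \<sigma>p / 2 * real (m None + 1) + \<sigma>m / 2 * ?a" using sp sm by simp
    ultimately show "\<bar>\<sigma>p / 2 * real (m None + 1) + \<sigma>m / 2 * ?a\<bar> \<le> (\<sigma>p + \<sigma>m) * (1 + real (deg m))"
      by (simp only: distrib_right abs_of_nonneg)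
    have "\<bar>E * ?a\<bar> \<le> \<bar>E\<bar> * (1 + real (deg m))" "\<bar>\<epsilon> * ?s\<bar> \<le> \<bar>\<epsilon>\<bar> * (1 + real (deg m))"
      unfolding abs_mult using s0 le by (intro mult_mono; simp)+
    then show "\<bar>E * ?a + \<epsilon> * ?s\<bar> \<le> (\<bar>E\<bar> + \<bar>\<epsilon>\<bar>) * (1 + real (deg m))"
      unfolding distrib_right by linarith
  qed
  finally show ?thesis by (simp add: kap_bound_def algebra_simps)
qed

definition KR :: "('n option \<Rightarrow> nat) op" where "KR = resolvent_product (K_op E \<epsilon> \<eta> \<sigma>p \<sigma>m n)"
definition BR :: "('n option \<Rightarrow> nat) op" where "BR = resolvent_product (b_op None)"
definition CR :: "('n option \<Rightarrow> nat) op" where "CR = resolvent_product (bdag_op None)"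

lemma shift_BR: "shift_op BR (b_weight None) (up None)" unfolding BR_def by (rule shift_op_b)
lemma shift_CR: "shift_op CR (bdag_weight None) (dn None)" unfolding CR_def by (rule shift_op_bdag)

lemma clinear_BR [clinear]: "clinear_op BR" by (rule shift_op_clinear[OF shift_BR])
lemma clinear_CR [clinear]: "clinear_op CR" by (rule shift_op_clinear[OF shift_CR])

lemma coeff_K_op:
  "coeff (K_op E \<epsilon> \<eta> \<sigma>p \<sigma>m n (res_op \<psi>)) m = kap m * coeff (res_op \<psi>) m
    + \<i> * of_real \<eta> * (hop_weight None (Some n) m * coeff \<psi> (up (Some n) (dn None m))
        + hop_weight (Some n) None m * coeff \<psi> (up None (dn (Some n) m)))"
proof -
  have 1: "coeff (bdag_op k (b_op k (res_op \<psi>))) m = of_nat (m k) * coeff (res_op \<psi>) m" for k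
    by (rule coeff_bdag_b[OF res_dom_b b_res_dom_bdag])
  show ?thesis
    unfolding K_op_def H_op_def
    by (simp add: coeff_simps coeff_sum 1 coeff_b_bdag coeff_hop[of None "Some n"]
        coeff_hop[of "Some n" None] kap_def sum_distrib_left
        sum_distrib_right distrib_left distrib_right mult_ac add_ac del: of_nat_Suc)
qed

lemma KR:
  "coeff (KR \<psi>) m = kap m * coeff (res_op \<psi>) m
    + \<i> * of_real \<eta> * (hop_weight None (Some n) m * coeff \<psi> (up (Some n) (dn None m))
        + hop_weight (Some n) None m * coeff \<psi> (up None (dn (Some n) m)))"
  "clinear_op KR"
proof -
  let ?w0 = "\<lambda>m. kap m * of_real (1 / (1 + real (deg m)))"
  define w where "w j k m = \<i> * of_real \<eta> * hop_weight j k m" for j k :: "'n option" and m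
  have a0: "admissible ?w0 id kap_bound"
    unfolding admissible_def
  proof (intro conjI allI)
    fix m
    have "cmod (?w0 m) = cmod (kap m) / (1 + real (deg m))"
      unfolding norm_mult norm_of_real by simp
    also have "\<dots> \<le> kap_bound" using cmod_kap_le[of m] by (simp add: divide_simps)
    finally show "cmod (?w0 m) \<le> kap_bound" .
  qed simp
  have a: "admissible (w j k) (\<lambda>m. up k (dn j m)) \<bar>\<eta>\<bar>" for j k
    using admissible_hop_weight[of j k] mult_left_mono[of "cmod (hop_weight j k m)" 1 "\<bar>\<eta>\<bar>" for m]
    unfolding admissible_def w_def by (auto simp: norm_mult intro: inj_on_subset)
  let ?A = "wshift ?w0 id + wshift (w None (Some n)) (\<lambda>m. up (Some n) (dn None m))
      + wshift (w (Some n) None) (\<lambda>m. up None (dn (Some n) m))"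
  have c: "coeff (?A \<psi>) m = kap m * coeff (res_op \<psi>) m
    + \<i> * of_real \<eta> * (hop_weight None (Some n) m * coeff \<psi> (up (Some n) (dn None m))
        + hop_weight (Some n) None m * coeff \<psi> (up None (dn (Some n) m)))" for \<psi> m
    by (simp only: blinfun.add_left plus_ell2.rep_eq coeff_wshift[OF a0] coeff_wshift[OF a] id_apply)
      (simp add: coeff_res_op w_def distrib_left mult.assoc)
  have "KR = ?A" unfolding KR_def
    by (rule resolvent_product_eq, rule ell2_eqI) (simp only: c coeff_K_op)
  then show "coeff (KR \<psi>) m = kap m * coeff (res_op \<psi>) m
    + \<i> * of_real \<eta> * (hop_weight None (Some n) m * coeff \<psi> (up (Some n) (dn None m))
        + hop_weight (Some n) None m * coeff \<psi> (up None (dn (Some n) m)))" "clinear_op KR"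
    using c shift_op_clinear[OF shift_op_wshift[OF a0]] shift_op_clinear[OF shift_op_wshift[OF a]]
    by (simp_all add: clinear_add)
qed

definition sec :: "nat \<Rightarrow> ('n option \<Rightarrow> nat) set" where "sec M = {m. deg m \<le> M}"

lemma finite_sec [simp]: "finite (sec M)" unfolding sec_def by (rule finite_deg_le)

lemma sec_iff [simp]: "m \<in> sec M \<longleftrightarrow> deg m \<le> M" by (simp add: sec_def)

text \<open>\<open>Q M\<close> is the truncation of \<open>1 + n\<close>. It undoes the resolvent on
  the block, turning the bounded products of the model back into the mode operators.\<close>

definition q_weight :: "nat \<Rightarrow> ('n option \<Rightarrow> nat) \<Rightarrow> complex" where
  "q_weight M m = (if deg m \<le> M then of_real (1 + real (deg m)) else 0)"

definition Q :: "nat \<Rightarrow> ('n option \<Rightarrow> nat) op" where "Q M = wshift (q_weight M) id"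

lemma shift_Q: "shift_op (Q M) (q_weight M) id"
proof -
  have "admissible (q_weight M) id (1 + real M)"
    unfolding admissible_def q_weight_def by (auto simp del: of_real_add)
  then show ?thesis unfolding Q_def by (rule shift_op_wshift)
qed

lemma coeff_Q: "coeff (Q M \<psi>) m = (if deg m \<le> M then of_real (1 + real (deg m)) * coeff \<psi> m else 0)"
  using shift_Q[of M] by (simp add: shift_op_def q_weight_def)

lemma clinear_Q [clinear]: "clinear_op (Q M)" by (rule shift_op_clinear[OF shift_Q])

lemma adj_Q: "adj (Q M) = Q M"
  by (rule shift_op_adj[OF shift_Q shift_Q]) (simp_all add: q_weight_def)

lemma res_Q: "res_op o\<^sub>L Q M = proj (sec M)" "Q M o\<^sub>L res_op = proj (sec M)"
proof -
  have *: "complex_of_real (1 / (1 + real d)) * (of_real (1 + real d) * z) = z"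
    "complex_of_real (1 + real d) * (of_real (1 / (1 + real d)) * z) = z" for d z
    unfolding mult.assoc[symmetric] of_real_mult[symmetric] by simp_all
  show "res_op o\<^sub>L Q M = proj (sec M)" "Q M o\<^sub>L res_op = proj (sec M)"
    by (auto intro!: blinfun_eqI ell2_eqI simp: coeff_res_op coeff_Q coeff_proj *
        simp del: of_real_add of_real_divide)
qed

text \<open>The mode operators \<open>b\<^sub>0\<close>, \<open>b\<^sub>0\<^sup>*\<close> and \<open>K\<^sub>n\<close> after projection to total occupation number at most \<open>M\<close>.\<close>

definition B :: "nat \<Rightarrow> ('n option \<Rightarrow> nat) op" where "B M = BR o\<^sub>L Q M"
definition C :: "nat \<Rightarrow> ('n option \<Rightarrow> nat) op" where "C M = CR o\<^sub>L Q M"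
definition K :: "nat \<Rightarrow> ('n option \<Rightarrow> nat) op" where "K M = KR o\<^sub>L Q M"

lemma clinear_BCK [clinear]: "clinear_op (B M)" "clinear_op (C M)" "clinear_op (K M)"
  by (simp_all add: B_def C_def K_def clinear KR(2))

lemma cancel_weight: "complex_of_real (r / (1 + real d)) * (of_real (1 + real d) * z) = of_real r * z"
proof -
  have "r / (1 + real d) * (1 + real d) = r" by simp
  then show ?thesis by (metis mult.assoc of_real_mult)
qed

text \<open>The bound on \<open>deg m\<close> is strict because lowering ends at degree
  \<open>M - 1\<close> at most, whereas creation in \<open>shift_C\<close> reaches
  \<open>M + 1\<close>.\<close>

lemma shift_B: "shift_op (B M) (\<lambda>m. if deg m < M then of_real (sqrt (real (m None + 1))) else 0) (up None)"
proof -
  have "deg (up None m) \<le> M \<longleftrightarrow> deg m < M" for m :: "'n option \<Rightarrow> nat" by auto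
  then show ?thesis
    using shift_BR by (simp add: shift_op_def B_def coeff_Q b_weight_def cancel_weight
        del: of_real_add of_real_divide deg_up)
qed

lemma shift_C: "shift_op (C M) (\<lambda>m. if deg m \<le> M + 1 then of_real (sqrt (real (m None))) else 0) (dn None)"
  unfolding shift_op_def
proof (intro allI)
  fix \<psi> m
  show "coeff (C M \<psi>) m = (if deg m \<le> M + 1 then of_real (sqrt (real (m None))) else 0) * coeff \<psi> (dn None m)"
  proof (cases "m None > 0")
    case True
    then show ?thesis
      using shift_CR cancel_weight[of _ "deg (dn None m)"] deg_dn[of m None, OF True]
      by (simp add: shift_op_def C_def coeff_Q bdag_weight_def del: of_real_add of_real_divide)
  next
    case False
    then show ?thesis using shift_CR by (simp add: shift_op_def C_def bdag_weight_def)
  qed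
qed

end

text \<open>Reindexing with boundary terms: \<open>j\<close> and \<open>i\<close> are inverse only
  between the indices selected by \<open>P\<close> and \<open>R\<close>, and all terms outside
  vanish.\<close>

lemma sum_reindex_neutral:
  fixes g :: "'a \<Rightarrow> 'c::comm_monoid_add" and h :: "'b \<Rightarrow> 'c"
  assumes "finite S" "finite T"
    and "\<And>a. a \<in> S \<Longrightarrow> P a \<Longrightarrow> i (j a) = a" "\<And>a. a \<in> S \<Longrightarrow> P a \<Longrightarrow> j a \<in> T"
      "\<And>a. a \<in> S \<Longrightarrow> P a \<Longrightarrow> R (j a)" "\<And>a. a \<in> S \<Longrightarrow> P a \<Longrightarrow> h (j a) = g a"
    and "\<And>b. b \<in> T \<Longrightarrow> R b \<Longrightarrow> j (i b) = b" "\<And>b. b \<in> T \<Longrightarrow> R b \<Longrightarrow> i b \<in> S"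
      "\<And>b. b \<in> T \<Longrightarrow> R b \<Longrightarrow> P (i b)"
    and "\<And>a. a \<in> S \<Longrightarrow> \<not> P a \<Longrightarrow> g a = 0" "\<And>b. b \<in> T \<Longrightarrow> \<not> R b \<Longrightarrow> h b = 0"
  shows "sum g S = sum h T"
proof -
  have "sum g S = sum g {a \<in> S. P a}" using assms by (intro sum.mono_neutral_right) auto
  also have "\<dots> = sum h {b \<in> T. R b}"
    by (rule sum.reindex_bij_witness[where i = i and j = j]) (use assms in auto)
  also have "\<dots> = sum h T" using assms by (intro sum.mono_neutral_left) auto
  finally show ?thesis .
qed

context boson_model
begin

section \<open>Hopping terms and the dissipation form of the truncated operators\<close>

abbreviation zero_to_n :: "('n option \<Rightarrow> nat) \<Rightarrow> 'n option \<Rightarrow> nat" where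
  "zero_to_n m \<equiv> up (Some n) (dn None m)"

abbreviation n_to_zero :: "('n option \<Rightarrow> nat) \<Rightarrow> 'n option \<Rightarrow> nat" where
  "n_to_zero m \<equiv> up None (dn (Some n) m)"

definition hop_amp :: "'n option \<Rightarrow> 'n option \<Rightarrow> ('n option \<Rightarrow> nat) \<Rightarrow> real" where
  "hop_amp j k m = \<eta> * (sqrt (real (m j)) * sqrt (real (m k + 1)))"

lemma hop_amp_pos: "hop_amp j k m \<noteq> 0 \<Longrightarrow> m j > 0"
  by (rule ccontr) (simp add: hop_amp_def)

lemma deg_hop: "m j > 0 \<Longrightarrow> deg (up k (dn j m)) = deg m"
  using deg_dn[of m j] by simp

lemma hop_hop:
  assumes "j \<noteq> k" "m j > 0" shows "up j (dn k (up k (dn j m))) = m"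
  using assms by simp

lemma up_dn_at: "j \<noteq> k \<Longrightarrow> up k (dn j m) k = m k + 1" "j \<noteq> k \<Longrightarrow> up k (dn j m) j = m j - 1"
  by (simp_all add: up_dn_apply)

lemma hop_weight_Q:
  assumes "j \<noteq> k"
  shows "of_real \<eta> * (hop_weight j k m * coeff (Q M \<psi>) (up k (dn j m)))
    = (if deg m \<le> M then of_real (hop_amp j k m) * coeff \<psi> (up k (dn j m)) else 0)"
proof (cases "m j > 0")
  case True
  have "hop_weight j k m * coeff (Q M \<psi>) (up k (dn j m))
      = (if deg m \<le> M then of_real (sqrt (real (m j)) * sqrt (real (m k + 1))) * coeff \<psi> (up k (dn j m)) else 0)"
    using assms by (simp add: hop_weight_def coeff_Q deg_hop[of m j, OF True] up_dn_apply(2) cancel_weight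
        del: of_real_add of_real_divide of_real_mult deg_up)
  then show ?thesis by (simp add: hop_amp_def)
qed (simp add: hop_weight_def hop_amp_def)

lemma coeff_K:
  "coeff (K M \<psi>) m = (if deg m \<le> M then kap m * coeff \<psi> m
    + \<i> * (of_real (hop_amp None (Some n) m) * coeff \<psi> (zero_to_n m)
          + of_real (hop_amp (Some n) None m) * coeff \<psi> (n_to_zero m)) else 0)"
proof -
  have "coeff (K M \<psi>) m = kap m * coeff (res_op (Q M \<psi>)) m
      + \<i> * (of_real \<eta> * (hop_weight None (Some n) m * coeff (Q M \<psi>) (zero_to_n m))
          + of_real \<eta> * (hop_weight (Some n) None m * coeff (Q M \<psi>) (n_to_zero m)))"
    by (simp add: K_def KR(1) distrib_left mult.assoc)
  also have "res_op (Q M \<psi>) = proj (sec M) \<psi>"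
    using res_Q(1)[of M] by (metis blinfun_apply_blinfun_compose)
  finally show ?thesis by (simp add: hop_weight_Q coeff_proj)
qed

definition hop :: "nat \<Rightarrow> 'n option \<Rightarrow> 'n option \<Rightarrow> ('n option \<Rightarrow> nat) op" where
  "hop M j k = wshift (\<lambda>m. if deg m \<le> M then \<i> * of_real (hop_amp j k m) else 0) (\<lambda>m. up k (dn j m))"

lemma shift_hop:
  assumes "j \<noteq> k"
  shows "shift_op (hop M j k) (\<lambda>m. if deg m \<le> M then \<i> * of_real (hop_amp j k m) else 0) (\<lambda>m. up k (dn j m))"
    (is "shift_op _ ?w ?g")
  unfolding hop_def
proof (rule shift_op_wshift)
  have pos: "m j > 0" if "?w m \<noteq> 0" for m
    using that hop_amp_pos[of j k m] by (auto split: if_splits)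
  show "admissible ?w ?g (\<bar>\<eta>\<bar> * (real M + 1))"
    unfolding admissible_def
  proof (intro conjI allI inj_onI)
    fix x y assume xy: "x \<in> {m. ?w m \<noteq> 0}" "y \<in> {m. ?w m \<noteq> 0}" "?g x = ?g y"
    then have "x j > 0" "y j > 0" using pos by blast+
    then show "x = y" using hop_hop[of j k x] hop_hop[of j k y] assms xy(3) by metis
  next
    fix m
    have "sqrt (real (m j)) * sqrt (real (m k + 1)) \<le> real (deg m) + 1"
      using le_deg[of m j] le_deg[of m k] by (intro sqrt_mult_le) auto
    then have "\<bar>\<eta>\<bar> * (sqrt (real (m j)) * sqrt (real (m k + 1))) \<le> \<bar>\<eta>\<bar> * (real M + 1)" if "deg m \<le> M"
      using that by (intro mult_left_mono) auto
    then show "cmod (?w m) \<le> \<bar>\<eta>\<bar> * (real M + 1)"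
      by (simp add: hop_amp_def norm_mult abs_mult)
  qed
qed

lemma adj_hop:
  assumes "j \<noteq> k" shows "adj (hop M j k) = - hop M k j"
proof (rule shift_op_adj[OF shift_hop[OF assms]])
  show "shift_op (- hop M k j) (\<lambda>m. - (if deg m \<le> M then \<i> * of_real (hop_amp k j m) else 0)) (\<lambda>m. up j (dn k m))"
    using shift_hop[of k j M] assms by (auto simp: shift_op_def blinfun.bilinear_simps coeff_simps)
  have amp: "hop_amp k j (up k (dn j m)) = hop_amp j k m" if "m j > 0" "j \<noteq> k" for m j k
    using that by (simp add: hop_amp_def up_dn_at of_nat_diff mult_ac)
  show "up j (dn k (up k (dn j x))) = x \<and> - (if deg (up k (dn j x)) \<le> M then \<i> * of_real (hop_amp k j (up k (dn j x))) else 0)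
      = cnj (if deg x \<le> M then \<i> * of_real (hop_amp j k x) else 0)"
    if "(if deg x \<le> M then \<i> * of_real (hop_amp j k x) else 0) \<noteq> 0" for x
  proof -
    have x: "x j > 0" using that hop_amp_pos[of j k x] by (auto split: if_splits)
    show ?thesis using hop_hop[of j k x, OF assms x] amp[where m = x and j = j and k = k, OF x assms] deg_hop[of x j, OF x] by (simp del: deg_up up_dn)
  qed
  show "up k (dn j (up j (dn k y))) = y \<and> (if deg (up j (dn k y)) \<le> M then \<i> * of_real (hop_amp j k (up j (dn k y))) else 0)
      = cnj (- (if deg y \<le> M then \<i> * of_real (hop_amp k j y) else 0))"
    if "- (if deg y \<le> M then \<i> * of_real (hop_amp k j y) else 0) \<noteq> 0" for y
  proof -
    have y: "y k > 0" using that hop_amp_pos[of k j y] by (auto split: if_splits)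
    show ?thesis using hop_hop[of k j y] amp[where m = y and j = k and k = j, OF y] deg_hop[of y k, OF y] assms y by (simp del: deg_up up_dn)
  qed
qed

text \<open>The hopping carries a factor \<open>\<i>\<close>, so its two directions are negative
  adjoints of each other and cancel. Truncation does not disturb this since hopping preserves the
  degree.\<close>

lemma coeff_K_plus_adj:
  "coeff ((K M + adj (K M)) \<psi>) m = of_real (if deg m \<le> M then 2 * Re (kap m) else 0) * coeff \<psi> m"
proof -
  let ?k = "\<lambda>m. if deg m \<le> M then kap m else 0"
  have adm: "admissible ?k id (\<bar>kap_bound\<bar> * (1 + real M))" "admissible (\<lambda>m. cnj (?k m)) id (\<bar>kap_bound\<bar> * (1 + real M))"
  proof -
    have "cmod (?k m) \<le> \<bar>kap_bound\<bar> * (1 + real M)" for m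
      using order_trans[OF cmod_kap_le mult_mono[of kap_bound "\<bar>kap_bound\<bar>" "1 + real (deg m)" "1 + real M"]]
      by auto
    then show "admissible ?k id (\<bar>kap_bound\<bar> * (1 + real M))" "admissible (\<lambda>m. cnj (?k m)) id (\<bar>kap_bound\<bar> * (1 + real M))"
      by (auto simp: admissible_def)
  qed
  define k0 where "k0 = wshift ?k id"
  define k1 where "k1 = wshift (\<lambda>m. cnj (?k m)) id"
  note sh = shift_op_wshift[OF adm(1), folded k0_def] shift_op_wshift[OF adm(2), folded k1_def]
  have k1: "adj k0 = k1" by (rule shift_op_adj[OF sh]) auto
  let ?h = "hop M None (Some n)" and ?h' = "hop M (Some n) None"
  have "K M = k0 + (?h + ?h')"
    using sh(1) shift_hop[of None "Some n" M] shift_hop[of "Some n" None M]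
    by (intro blinfun_eqI ell2_eqI)
      (simp add: coeff_K blinfun.bilinear_simps coeff_simps shift_op_def algebra_simps)
  moreover have "adj (k0 + (?h + ?h')) = k1 + (- ?h' + - ?h)"
    using shift_op_clinear[OF sh(1)] shift_op_clinear[OF shift_hop[of None "Some n" M]]
      shift_op_clinear[OF shift_hop[of "Some n" None M]]
    by (simp add: adj_add clinear_add k1 adj_hop)
  ultimately have "K M + adj (K M) = k0 + k1" by simp
  then show ?thesis using sh
    by (simp add: shift_op_def blinfun.bilinear_simps coeff_simps complex_add_cnj flip: distrib_right)
qed

text \<open>Creation cut back to the block. This, and not \<open>C M\<close>, is the adjoint of
  \<open>B M\<close>.\<close>

definition Bd :: "nat \<Rightarrow> ('n option \<Rightarrow> nat) op" where "Bd M = proj (sec M) o\<^sub>L C M"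

lemma shift_Bd: "shift_op (Bd M) (\<lambda>m. if deg m \<le> M then of_real (sqrt (real (m None))) else 0) (dn None)"
  using shift_C[of M] by (auto simp: shift_op_def Bd_def coeff_proj)

lemma clinear_Bd [clinear]: "clinear_op (Bd M)" by (rule shift_op_clinear[OF shift_Bd])

lemma adj_B: "adj (B M) = Bd M"
proof (rule shift_op_adj[OF shift_B shift_Bd])
  show "dn None (up None x) = x \<and> (if deg (up None x) \<le> M then of_real (sqrt (real (up None x None))) else 0)
      = cnj (if deg x < M then of_real (sqrt (real (x None + 1))) else 0)"
    if "(if deg x < M then of_real (sqrt (real (x None + 1))) else 0) \<noteq> (0 :: complex)" for x
    using that by (auto simp: up_dn_apply split: if_splits)
  show "up None (dn None y) = y \<and> (if deg (dn None y) < M then of_real (sqrt (real (dn None y None + 1))) else 0)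
      = cnj (if deg y \<le> M then of_real (sqrt (real (y None))) else 0)"
    if "(if deg y \<le> M then of_real (sqrt (real (y None))) else 0) \<noteq> (0 :: complex)" for y
  proof -
    have y: "y None > 0" "deg y \<le> M" using that by (cases "y None"; auto split: if_splits)+
    then show ?thesis using deg_dn[of y None, OF y(1)] by (simp add: up_dn_apply of_nat_diff)
  qed
qed

lemma coeff_B_Bd: "coeff (B M (Bd M \<psi>)) m = of_real (if deg m < M then real (m None + 1) else 0) * coeff \<psi> m"
  using shift_B[of M] shift_Bd[of M] of_real_sqrt_mult_self_Suc[of "m None" "coeff \<psi> m"]
  by (simp add: shift_op_def up_dn_apply)

lemma coeff_Bd_B: "coeff (Bd M (B M \<psi>)) m = of_real (if deg m \<le> M then real (m None) else 0) * coeff \<psi> m"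
proof (cases "m None > 0")
  case True
  then have "complex_of_real (sqrt (real (dn None m None + 1))) = of_real (sqrt (real (m None)))"
    by (simp add: up_dn_apply)
  moreover have "deg (dn None m) < M \<longleftrightarrow> deg m \<le> M" using deg_dn[of m None, OF True] by auto
  ultimately show ?thesis
    using shift_B[of M] shift_Bd[of M] of_real_sqrt_mult_self[of "real (m None)" "coeff \<psi> m"] True
    by (simp add: shift_op_def)
next
  case False
  then show ?thesis using shift_Bd[of M] by (simp add: shift_op_def)
qed

text \<open>The left side is the form of the truncated generator evaluated at the identity, a
  diagonal operator. With \<open>a = m None\<close> its entry below the top level is
  \<open>\<sigma>m (a + 1) + \<sigma>p a - \<sigma>p (a + 1) - \<sigma>m a = \<sigma>m -
  \<sigma>p\<close>; on the top level the first term drops out and the entry is non-positive; above,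
  it is 0.\<close>

lemma dissipation_form:
  "\<sigma>m * (norm (adj (B M) v))\<^sup>2 + \<sigma>p * (norm (adj (Bd M) v))\<^sup>2 - 2 * (v \<bullet> K M v) \<le> \<sigma>m * (norm v)\<^sup>2"
proof -
  define Z where "Z = \<sigma>m *\<^sub>R (B M o\<^sub>L Bd M) + \<sigma>p *\<^sub>R (Bd M o\<^sub>L B M) - (K M + adj (K M))"
  define d where "d m = \<sigma>m * (if deg m < M then real (m None + 1) else 0)
    + \<sigma>p * (if deg m \<le> M then real (m None) else 0) - (if deg m \<le> M then 2 * Re (kap m) else 0)" for m
  have Bd: "adj (Bd M) = B M" using adj_B adj_adj clinear_BCK(1) by metis
  have ad: "v \<bullet> adj A w = A v \<bullet> w" if "clinear_op A" for A :: "('n option \<Rightarrow> nat) op" and v w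
    using adj_cinner[OF that, of v w] by (simp flip: Re_cinner)
  have "(norm (adj (B M) v))\<^sup>2 = v \<bullet> B M (Bd M v)"
    using ad[OF clinear_Bd, of v M "Bd M v"] by (simp add: Bd adj_B power2_norm_eq_inner)
  moreover have "(norm (adj (Bd M) v))\<^sup>2 = v \<bullet> Bd M (B M v)"
    using ad[OF clinear_BCK(1), of v M "B M v"] by (simp add: Bd adj_B power2_norm_eq_inner)
  moreover have "2 * (v \<bullet> K M v) = v \<bullet> (K M + adj (K M)) v"
    using ad[OF clinear_BCK(3), of v M v] by (simp add: blinfun.bilinear_simps inner_add inner_commute)
  ultimately have "\<sigma>m * (norm (adj (B M) v))\<^sup>2 + \<sigma>p * (norm (adj (Bd M) v))\<^sup>2 - 2 * (v \<bullet> K M v) = v \<bullet> Z v"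
    by (simp add: Z_def blinfun.bilinear_simps inner_add inner_diff)
  also have "\<dots> \<le> \<sigma>m * (norm v)\<^sup>2"
  proof (rule inner_diagonal_le)
    show "coeff (Z \<psi>) m = of_real (d m) * coeff \<psi> m" for \<psi> m
    proof -
      have "coeff (Z \<psi>) m = of_real \<sigma>m * coeff (B M (Bd M \<psi>)) m + of_real \<sigma>p * coeff (Bd M (B M \<psi>)) m
          - coeff ((K M + adj (K M)) \<psi>) m"
        by (simp add: Z_def blinfun.bilinear_simps coeff_simps)
      then show ?thesis
        by (simp only: coeff_B_Bd coeff_Bd_B coeff_K_plus_adj d_def of_real_add of_real_diff of_real_mult)
          (simp only: algebra_simps)
    qed
    show "d m \<le> \<sigma>m" for m
      using sp sm by (auto simp: d_def kap_def field_simps)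
  qed
  finally show ?thesis .
qed

subsection \<open>Galerkin approximation\<close>

text \<open>
  On operators supported on the block \<open>sec M\<close>, \<open>Lb M\<close> is \<open>L\<close> itself; \<open>G M\<close> suppresses the jumps
  that leave the block.
\<close>

definition Lb :: "nat \<Rightarrow> ('n option \<Rightarrow> nat) sa_tc \<Rightarrow> ('n option \<Rightarrow> nat) sa_tc" where
  "Lb M X = \<sigma>m *\<^sub>R conj_tc (B M) X + \<sigma>p *\<^sub>R conj_tc (C M) X - mix (K M) id_blinfun X"

definition G :: "nat \<Rightarrow> ('n option \<Rightarrow> nat) sa_tc \<Rightarrow> ('n option \<Rightarrow> nat) sa_tc" where
  "G M X = conj_tc (proj (sec M)) (Lb M X)"

lemma bounded_linear_Lb: "bounded_linear (Lb M)"
  unfolding Lb_def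
  by (intro bounded_linear_sub bounded_linear_add bounded_linear_const_scaleR bounded_linear_conj
      bounded_linear_mix clinear)

lemma linear_G: "linear (G M)"
  unfolding G_def
  by (intro bounded_linear.linear bounded_linear_compose[OF bounded_linear_conj bounded_linear_Lb] clinear)

lemma G_in_block: "G M X \<in> block (sec M)"
  unfolding G_def by (intro conj_proj_in_block) simp

lemma adj_id: "adj id_blinfun = id_blinfun"
  by (rule adj_eqI) simp

lemma proj_BK: "proj (sec M) o\<^sub>L B M = B M" "proj (sec M) o\<^sub>L K M = K M"
  using shift_B[of M] by (auto intro!: blinfun_eqI ell2_eqI simp: coeff_proj shift_op_def coeff_K)

lemma tc_op_G:
  assumes X: "X \<in> block (sec M)"
  shows "tc_op (G M X) = - ((K M o\<^sub>L tc_op X) + (tc_op X o\<^sub>L adj (K M)))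
      + \<sigma>m *\<^sub>R (B M o\<^sub>L tc_op X o\<^sub>L adj (B M)) + \<sigma>p *\<^sub>R (Bd M o\<^sub>L tc_op X o\<^sub>L adj (Bd M))"
proof (rule blinfun_eqI)
  fix \<psi>
  let ?P = "proj (sec M)"
  have PK: "?P (K M v) = K M v" "?P (B M v) = B M v" "?P (C M v) = Bd M v" for v
    using proj_BK[of M] unfolding Bd_def by (metis blinfun_apply_blinfun_compose)+
  have PK': "adj (K M) (?P v) = adj (K M) v" "adj (B M) (?P v) = adj (B M) v" "adj (C M) (?P v) = adj (Bd M) v" for v
    using arg_cong[OF proj_BK(1)[of M], of adj] arg_cong[OF proj_BK(2)[of M], of adj]
      adj_compose[OF clinear_proj clinear_BCK(1), of "sec M" M] adj_compose[OF clinear_proj clinear_BCK(3), of "sec M" M]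
      adj_compose[OF clinear_proj clinear_BCK(2), of "sec M" M]
    unfolding adj_proj Bd_def by (metis blinfun_apply_blinfun_compose)+
  show "tc_op (G M X) \<psi> = (- ((K M o\<^sub>L tc_op X) + (tc_op X o\<^sub>L adj (K M)))
      + \<sigma>m *\<^sub>R (B M o\<^sub>L tc_op X o\<^sub>L adj (B M)) + \<sigma>p *\<^sub>R (Bd M o\<^sub>L tc_op X o\<^sub>L adj (Bd M))) \<psi>"
    by (simp add: G_def Lb_def tc_op_simps tc_op_conj mix(1) clinear adj_proj adj_id
        blinfun.bilinear_simps PK PK' block_proj[OF _ X])
qed

lemma galerkin_positive:
  assumes X: "X \<in> block (sec M)" and l: "\<sigma>m < l" and pos: "positive_op (tc_op (l *\<^sub>R X - G M X))"
  shows "positive_op (tc_op X)"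
proof (rule lindblad_resolvent_positive)
  show "positive_op (l *\<^sub>R tc_op X - (- ((K M o\<^sub>L tc_op X) + (tc_op X o\<^sub>L adj (K M)))
      + \<sigma>m *\<^sub>R (B M o\<^sub>L tc_op X o\<^sub>L adj (B M)) + \<sigma>p *\<^sub>R (Bd M o\<^sub>L tc_op X o\<^sub>L adj (Bd M))))"
    using pos by (simp add: tc_op_simps tc_op_G[OF X])
qed (use sp sm l in \<open>auto simp: clinear tc_op_selfadjoint intro: dissipation_form\<close>)

lemma positive_neg_zero:
  assumes "positive_op A" "positive_op (- A)" shows "A = 0"
proof (rule blinfun_eqI)
  fix \<psi>
  have "\<psi> \<bullet> A \<psi> = 0" using positive_inner[OF assms(1), of \<psi>] positive_inner[OF assms(2), of \<psi>]
    by (simp add: blinfun.bilinear_simps)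
  then show "blinfun_apply A \<psi> = blinfun_apply 0 \<psi>" using positive_inner_eq_0[OF assms(1)] by simp
qed

text \<open>Positivity of the resolvent applies to both \<open>X\<close> and
  \<open>- X\<close>.\<close>

lemma galerkin_injective:
  assumes X: "X \<in> block (sec M)" and l: "\<sigma>m < l" and zero: "l *\<^sub>R X - G M X = 0"
  shows "X = 0"
proof -
  have p0: "positive_op (tc_op (0 :: ('n option \<Rightarrow> nat) sa_tc))"
    by (simp add: tc_op_simps positive_iff selfadjoint_zero)
  have "l *\<^sub>R (- X) - G M (- X) = 0"
    using zero linear_neg[OF linear_G[of M], of X] by (metis minus_zero minus_diff_eq scaleR_minus_right diff_minus_eq_add neg_equal_iff_equal minus_diff_commute uminus_add_conv_diff)
  then have "positive_op (tc_op (- X))"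
    using X l p0 subspace_neg[OF subspace_block] by (intro galerkin_positive[of "- X" M l]) auto
  moreover have "positive_op (tc_op X)" using zero p0 X l by (intro galerkin_positive[of X M l]) auto
  ultimately have "tc_op X = 0" by (simp add: tc_op_simps positive_neg_zero)
  then show ?thesis by (intro tc_eqI) (simp add: tc_op_simps)
qed

lemma galerkin_solve:
  assumes "\<rho> \<in> block (sec M)" and l: "\<sigma>m < l"
  obtains X where "X \<in> block (sec M)" "l *\<^sub>R X - G M X = \<rho>"
proof (rule finite_dim_inj_imp_surj[OF subspace_block block_span[OF finite_sec, of M], of "\<lambda>X. l *\<^sub>R X - G M X"])
  show "linear (\<lambda>X. l *\<^sub>R X - G M X)"
    by (intro linear_compose_sub linear_G) (simp add: linear_iff algebra_simps)
  show "(\<lambda>X. l *\<^sub>R X - G M X) ` block (sec M) \<subseteq> block (sec M)"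
    using subspace_diff[OF subspace_block] subspace_scale[OF subspace_block] G_in_block by blast
qed (use assms galerkin_injective that in auto)

subsection \<open>Weighted traces\<close>

lemma tr_block: "finite F \<Longrightarrow> X \<in> block F \<Longrightarrow> tr X = (\<Sum>m\<in>F. diag (tc_op X) m)"
proof -
  assume F: "finite F" "X \<in> block F"
  have "infsum (diag (tc_op X)) UNIV = infsum (diag (tc_op X)) F"
    using F by (intro infsum_cong_neutral) (auto simp: block_def diag_def coeff_simps)
  then show ?thesis using F by (simp add: tr_def)
qed

lemma diag_K_adj:
  assumes "clinear_op K'"
  shows "diag ((K' o\<^sub>L tc_op X) + (tc_op X o\<^sub>L adj K')) m = 2 * Re (coeff (K' (tc_op X (basis_vec m))) m)"
proof -
  have "cinner (basis_vec m) (tc_op X (adj K' (basis_vec m))) = cinner (K' (tc_op X (basis_vec m))) (basis_vec m)"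
    by (metis adj_cinner assms selfadjoint_cinner tc_op_selfadjoint)
  then have "coeff (tc_op X (adj K' (basis_vec m))) m = cnj (coeff (K' (tc_op X (basis_vec m))) m)"
    by (metis cinner_basis_vec cinner_commute)
  then show ?thesis by (simp add: diag_def blinfun.bilinear_simps coeff_simps)
qed

lemma diag_Lb:
  assumes X: "X \<in> block (sec M)" and m: "m \<in> sec (M + 1)"
  shows "diag (tc_op (Lb M X)) m =
    \<sigma>m * (real (m None + 1) * diag (tc_op X) (up None m)) + \<sigma>p * (real (m None) * diag (tc_op X) (dn None m))
    - (\<sigma>p * real (m None + 1) + \<sigma>m * real (m None)) * diag (tc_op X) m
    + 2 * (hop_amp None (Some n) m * Im (coeff (tc_op X (basis_vec m)) (zero_to_n m)))
    + 2 * (hop_amp (Some n) None m * Im (coeff (tc_op X (basis_vec m)) (n_to_zero m)))"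
proof -
  have z: "tc_op X (basis_vec m) = 0" if "M < deg m" for m
    using X that by (simp add: block_def)
  then have dz: "diag (tc_op X) m = 0" if "M < deg m" for m
    using that by (simp add: diag_def coeff_simps)
  \<comment> \<open>The cut-off in \<open>shift_B\<close> leaves no trace here: beyond it the
    diagonal of \<open>X\<close> vanishes at \<open>up None m\<close>.\<close>
  have 1: "diag (tc_op (conj_tc (B M) X)) m = real (m None + 1) * diag (tc_op X) (up None m)"
    using dz[of "up None m"] by (simp add: tc_op_conj clinear diag_shift_sandwich[OF shift_B])
  have 2: "diag (tc_op (conj_tc (C M) X)) m = real (m None) * diag (tc_op X) (dn None m)"
    using m by (simp add: tc_op_conj clinear diag_shift_sandwich[OF shift_C])
  have "tc_op (mix (K M) id_blinfun X) = (K M o\<^sub>L tc_op X) + (tc_op X o\<^sub>L adj (K M))"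
    by (simp add: mix(1) clinear adj_id) (auto intro!: blinfun_eqI simp: blinfun.bilinear_simps)
  then have "diag (tc_op (mix (K M) id_blinfun X)) m = 2 * Re (coeff (K M (tc_op X (basis_vec m))) m)"
    by (simp add: diag_K_adj clinear)
  also have "\<dots> = (\<sigma>p * real (m None + 1) + \<sigma>m * real (m None)) * diag (tc_op X) m
    - 2 * (hop_amp None (Some n) m * Im (coeff (tc_op X (basis_vec m)) (zero_to_n m)))
    - 2 * (hop_amp (Some n) None m * Im (coeff (tc_op X (basis_vec m)) (n_to_zero m)))"
  proof (cases "deg m \<le> M")
    case True
    have "Im (coeff (tc_op X (basis_vec m)) m) = 0"
      using diag_selfadjoint[OF tc_op_selfadjoint[of X], of m] by (simp add: cinner_basis_vec)
    with True show ?thesis by (simp add: coeff_K kap_def diag_def field_simps)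
  next
    case False
    then show ?thesis by (simp add: coeff_K z dz coeff_simps)
  qed
  finally show ?thesis
    by (simp add: Lb_def tc_op_simps diag_simps 1 2)
qed

text \<open>Gains are summed at the level they come from, giving the backward birth-death operator
  applied to \<open>z\<close>. The hopping terms cancel in pairs: hopping keeps \<open>deg\<close>,
  on which alone \<open>z\<close> depends, and the imaginary part of a coherence changes sign when
  its indices are swapped. Where \<open>deg m - 1\<close> is truncated, its factor
  \<open>m None\<close> is 0. The sum runs to \<open>M + 1\<close> to catch the births out of the
  block.\<close>

lemma weighted_trace_Lb:
  fixes z :: "nat \<Rightarrow> real"
  assumes X: "X \<in> block (sec M)"
  shows "(\<Sum>m\<in>sec (M + 1). z (deg m) * diag (tc_op (Lb M X)) m)
    = (\<Sum>m\<in>sec (M + 1). (\<sigma>m * real (m None) * (z (deg m - 1) - z (deg m))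
        + \<sigma>p * real (m None + 1) * (z (deg m + 1) - z (deg m))) * diag (tc_op X) m)"
proof -
  let ?S = "sec (M + 1)" and ?d = "diag (tc_op X)"
  let ?x = "\<lambda>m m'. coeff (tc_op X (basis_vec m)) m'"
  have dz: "?d m = 0" if "M < deg m" for m
    using X that by (simp add: block_def diag_def coeff_simps)
  have up: "(\<Sum>m\<in>?S. z (deg m) * (real (m None + 1) * ?d (up None m)))
      = (\<Sum>m\<in>?S. z (deg m - 1) * (real (m None) * ?d m))"
  proof (rule sum_reindex_neutral[where i = "dn None" and j = "up None"
        and P = "\<lambda>m. deg m \<noteq> M + 1" and R = "\<lambda>m. m None \<noteq> 0"])
    fix m assume "m \<in> ?S" "m None \<noteq> 0"
    then show "up None (dn None m) = m" "dn None m \<in> ?S" "deg (dn None m) \<noteq> M + 1"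
      using deg_dn[of m None] by auto
  qed (auto simp: up_dn_apply dz)
  have dn: "(\<Sum>m\<in>?S. z (deg m) * (real (m None) * ?d (dn None m)))
      = (\<Sum>m\<in>?S. z (deg m + 1) * (real (m None + 1) * ?d m))"
  proof (rule sum_reindex_neutral[where i = "up None" and j = "dn None"
        and P = "\<lambda>m. m None \<noteq> 0" and R = "\<lambda>m. deg m \<noteq> M + 1"])
    fix m assume "m \<in> ?S" "m None \<noteq> 0"
    then show "up None (dn None m) = m" "dn None m \<in> ?S" "deg (dn None m) \<noteq> M + 1"
      "z (deg (dn None m) + 1) * (real (dn None m None + 1) * ?d (dn None m)) = z (deg m) * (real (m None) * ?d (dn None m))"
      using deg_dn[of m None] by (auto simp: up_dn_apply of_nat_diff)
  qed (auto simp: up_dn_apply dz)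
  have hop: "(\<Sum>m\<in>?S. - (z (deg m) * (hop_amp None (Some n) m * Im (?x m (zero_to_n m)))))
      = (\<Sum>m\<in>?S. z (deg m) * (hop_amp (Some n) None m * Im (?x m (n_to_zero m))))"
  proof (rule sum_reindex_neutral[where i = "n_to_zero" and j = "zero_to_n"
        and P = "\<lambda>m. m None \<noteq> 0" and R = "\<lambda>m. m (Some n) \<noteq> 0"])
    fix m assume m: "m \<in> ?S" "m None \<noteq> 0"
    then have pos: "m None > 0" by auto
    show nz: "n_to_zero (zero_to_n m) = m" using pos by simp
    show "zero_to_n m \<in> ?S" "zero_to_n m (Some n) \<noteq> 0"
      using m deg_hop[of m None, OF pos] by (simp_all add: up_dn_apply del: deg_up)
    have "?x (zero_to_n m) m = cnj (?x m (zero_to_n m))"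
      by (metis cinner_basis_vec cinner_commute selfadjoint_cinner tc_op_selfadjoint)
    moreover have "hop_amp (Some n) None (zero_to_n m) = hop_amp None (Some n) m"
      using pos by (simp add: hop_amp_def up_dn_apply of_nat_diff mult_ac)
    ultimately show "z (deg (zero_to_n m)) * (hop_amp (Some n) None (zero_to_n m) * Im (?x (zero_to_n m) (n_to_zero (zero_to_n m))))
        = - (z (deg m) * (hop_amp None (Some n) m * Im (?x m (zero_to_n m))))"
      using nz deg_hop[of m None, OF pos] by (simp del: deg_up dn_up up_dn)
  next
    fix m assume m: "m \<in> ?S" "m (Some n) \<noteq> 0"
    then have pos: "m (Some n) > 0" by auto
    show "zero_to_n (n_to_zero m) = m" using pos by simp
    show "n_to_zero m \<in> ?S" "n_to_zero m None \<noteq> 0"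
      using m deg_hop[of m "Some n", OF pos] by (simp_all add: up_dn_apply del: deg_up)
  qed (auto simp: hop_amp_def)
  have "(\<Sum>m\<in>?S. z (deg m) * diag (tc_op (Lb M X)) m)
      = \<sigma>m * (\<Sum>m\<in>?S. z (deg m) * (real (m None + 1) * ?d (up None m)))
      + \<sigma>p * (\<Sum>m\<in>?S. z (deg m) * (real (m None) * ?d (dn None m)))
      - (\<Sum>m\<in>?S. z (deg m) * ((\<sigma>p * real (m None + 1) + \<sigma>m * real (m None)) * ?d m))
      + 2 * ((\<Sum>m\<in>?S. z (deg m) * (hop_amp (Some n) None m * Im (?x m (n_to_zero m))))
        - (\<Sum>m\<in>?S. - (z (deg m) * (hop_amp None (Some n) m * Im (?x m (zero_to_n m))))))"
    unfolding sum_distrib_left sum.distrib[symmetric] sum_subtractf[symmetric]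
    by (intro sum.cong refl) (simp add: diag_Lb[OF X] algebra_simps del: sec_iff)
  also have "\<dots> = \<sigma>m * (\<Sum>m\<in>?S. z (deg m - 1) * (real (m None) * ?d m))
      + \<sigma>p * (\<Sum>m\<in>?S. z (deg m + 1) * (real (m None + 1) * ?d m))
      - (\<Sum>m\<in>?S. z (deg m) * ((\<sigma>p * real (m None + 1) + \<sigma>m * real (m None)) * ?d m))"
    unfolding up dn hop by simp
  also have "\<dots> = (\<Sum>m\<in>?S. (\<sigma>m * real (m None) * (z (deg m - 1) - z (deg m))
        + \<sigma>p * real (m None + 1) * (z (deg m + 1) - z (deg m))) * ?d m)"
    unfolding sum_distrib_left sum.distrib[symmetric] sum_subtractf[symmetric]
    by (intro sum.cong refl) (simp add: algebra_simps)
  finally show ?thesis .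
qed

end

lemma closure_range_bounded_linear:
  assumes f: "bounded_linear f" and D: "closure D = UNIV"
  shows "range f \<subseteq> closure (f ` D)"
proof -
  have "f ` closure D \<subseteq> closure (f ` D)"
    using linear_continuous_on[OF f] closed_closure closure_subset by (rule image_closure_subset)
  then show ?thesis by (simp add: D)
qed

context boson_model
begin

section \<open>The operator of the model on blocks\<close>

lemma clinear_res [clinear]: "clinear_op (res_op :: ('n option \<Rightarrow> nat) op)"
  unfolding clinear_op_def by (intro allI ell2_eqI) (simp add: coeff_res_op coeff_simps)

lemma shift_res: "shift_op (res_op :: ('n option \<Rightarrow> nat) op) res_weight id"
  unfolding shift_op_def by (simp add: coeff_res_op res_weight_def)

lemma adj_res: "adj (res_op :: ('n option \<Rightarrow> nat) op) = res_op"
  by (rule shift_op_adj[OF shift_res shift_res]) (simp_all add: res_weight_def)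

text \<open>The value of \<open>L\<close> as a bounded function of the parameter
  \<open>\<rho>\<close>, the element of the domain being
  \<open>conj_tc res_op \<rho>\<close>.\<close>

definition LV :: "('n option \<Rightarrow> nat) sa_tc \<Rightarrow> ('n option \<Rightarrow> nat) sa_tc" where
  "LV \<rho> = \<sigma>m *\<^sub>R conj_tc BR \<rho> + \<sigma>p *\<^sub>R conj_tc CR \<rho> - mix KR res_op \<rho>"

lemma bounded_linear_LV: "bounded_linear LV"
  unfolding LV_def
  by (intro bounded_linear_sub bounded_linear_add bounded_linear_const_scaleR bounded_linear_conj
      bounded_linear_mix clinear KR(2))

text \<open>Blocks lie in the domain of \<open>L\<close>: the parameter that represents
  \<open>X\<close> is \<open>conj_tc (Q M) X\<close>.\<close>

lemma LV_Q:
  assumes X: "X \<in> block (sec M)"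
  shows "LV (conj_tc (Q M) X) = Lb M X" "conj_tc res_op (conj_tc (Q M) X) = X"
proof -
  have Qres: "Q M (res_op v) = proj (sec M) v" and resQ: "res_op (Q M v) = proj (sec M) v" for v
    using res_Q[of M] by (metis blinfun_apply_blinfun_compose)+
  have adjs: "adj (B M) v = Q M (adj BR v)" "adj (C M) v = Q M (adj CR v)" "adj (K M) v = Q M (adj KR v)" for v
    by (simp_all add: B_def C_def K_def adj_compose clinear KR(2) adj_Q)
  have ops: "B M v = BR (Q M v)" "C M v = CR (Q M v)" "K M v = KR (Q M v)" for v
    by (simp_all add: B_def C_def K_def)
  show "LV (conj_tc (Q M) X) = Lb M X"
    by (intro tc_eqI blinfun_eqI)
      (simp add: LV_def Lb_def tc_op_simps tc_op_conj mix(1) clinear clinear_BCK KR(2) adj_Q adj_res adj_id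
        blinfun.bilinear_simps adjs ops Qres resQ block_proj[OF _ X])
  show "conj_tc res_op (conj_tc (Q M) X) = X"
    by (intro tc_eqI blinfun_eqI)
      (simp add: tc_op_conj clinear adj_Q adj_res Qres resQ block_proj[OF _ X])
qed

lemma conj_Q_mono:
  assumes X: "X \<in> block (sec M)" and M: "M \<le> M'"
  shows "conj_tc (Q M') X = conj_tc (Q M) X"
proof (intro tc_eqI blinfun_eqI)
  fix \<psi>
  have 1: "Q M' (proj (sec M) v) = Q M v" "proj (sec M) (Q M' v) = Q M v" "Q M (proj (sec M) v) = Q M v" for v
    using M by (auto intro!: ell2_eqI simp: coeff_Q coeff_proj)
  have "Q M' (tc_op X (Q M' \<psi>)) = Q M' (proj (sec M) (tc_op X (proj (sec M) (Q M' \<psi>))))"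
    by (simp add: block_proj[OF _ X])
  also have "\<dots> = Q M (tc_op X (Q M \<psi>))" by (simp only: 1)
  finally show "tc_op (conj_tc (Q M') X) \<psi> = tc_op (conj_tc (Q M) X) \<psi>"
    by (simp add: tc_op_conj clinear adj_Q)
qed

text \<open>Both sides are \<open>LV\<close> of the same parameter, by
  \<open>conj_Q_mono\<close>.\<close>

lemma Lb_mono:
  assumes X: "X \<in> block (sec M)" and M: "M \<le> M'"
  shows "Lb M' X = Lb M X"
proof -
  have "block (sec M) \<subseteq> block (sec M')" using M by (intro block_mono) auto
  then have "X \<in> block (sec M')" using X by blast
  then show ?thesis using LV_Q(1)[of X M'] LV_Q(1)[OF X] conj_Q_mono[OF assms] by metis
qed

lemma Lb_in_block:
  assumes X: "X \<in> block (sec M)" shows "Lb M X \<in> block (sec (M + 1))"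
  unfolding block_def
proof (intro CollectI allI impI)
  fix m :: "'n option \<Rightarrow> nat" assume "m \<notin> sec (M + 1)"
  then have m: "deg m > M + 1" by simp
  have B: "adj (B M) (basis_vec m) = 0" and C: "adj (C M) (basis_vec m) = 0"
    using m by (simp_all add: shift_op_adj_basis[OF shift_B] shift_op_adj_basis[OF shift_C])
  have "adj (K M) (basis_vec m) = adj (K M) (proj (sec M) (basis_vec m))"
    using arg_cong[OF proj_BK(2)[of M], of adj] adj_compose[OF clinear_proj clinear_BCK(3), of "sec M" M]
    unfolding adj_proj by (metis blinfun_apply_blinfun_compose)
  then have K: "adj (K M) (basis_vec m) = 0" using m by (simp add: proj_basis_vec)
  have "tc_op X (basis_vec m) = 0" using X m by (simp add: block_def)
  then show "tc_op (Lb M X) (basis_vec m) = 0"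
    by (simp add: Lb_def tc_op_simps tc_op_conj mix(1) clinear clinear_BCK adj_id blinfun.bilinear_simps B C K)
qed

text \<open>\<open>Lb M X\<close> reaches at most level \<open>M + 1\<close>, so truncation at that
  level loses nothing. Resolvent estimates for \<open>G\<close> thereby become estimates for
  \<open>L\<close>.\<close>

lemma G_eq_Lb: "X \<in> block (sec M) \<Longrightarrow> G (M + 1) X = Lb M X"
  unfolding G_def using Lb_mono[of X M "M + 1"] Lb_in_block[of X M] by (simp add: conj_proj_block)

lemma tr_Lb: "X \<in> block (sec M) \<Longrightarrow> tr (Lb M X) = 0"
  using weighted_trace_Lb[of X M "\<lambda>_. 1"] tr_block[OF _ Lb_in_block, of M X] by simp

text \<open>The truncation of \<open>G\<close> is encoded in the weight: with \<open>z\<close> cut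
  off above \<open>M\<close>, births out of the top level appear as pure loss.\<close>

lemma weighted_trace_G:
  assumes X: "X \<in> block (sec M)" and z: "\<And>j. M < j \<Longrightarrow> z j = 0"
  shows "(\<Sum>m\<in>sec M. z (deg m) * diag (tc_op (G M X)) m)
    = (\<Sum>m\<in>sec M. (\<sigma>m * real (m None) * (z (deg m - 1) - z (deg m))
        + \<sigma>p * real (m None + 1) * (z (deg m + 1) - z (deg m))) * diag (tc_op X) m)"
proof -
  have "diag (tc_op (G M X)) m = diag (tc_op (Lb M X)) m" if "m \<in> sec M" for m
    using that by (simp add: G_def tc_op_conj clinear adj_proj diag_def proj_basis_vec coeff_proj)
  then have "(\<Sum>m\<in>sec M. z (deg m) * diag (tc_op (G M X)) m)
      = (\<Sum>m\<in>sec M. z (deg m) * diag (tc_op (Lb M X)) m)" by (intro sum.cong refl) simp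
  also have "\<dots> = (\<Sum>m\<in>sec (M + 1). z (deg m) * diag (tc_op (Lb M X)) m)"
    by (rule sum.mono_neutral_left) (auto simp: z)
  also have "\<dots> = (\<Sum>m\<in>sec (M + 1). (\<sigma>m * real (m None) * (z (deg m - 1) - z (deg m))
        + \<sigma>p * real (m None + 1) * (z (deg m + 1) - z (deg m))) * diag (tc_op X) m)"
    by (rule weighted_trace_Lb[OF X])
  also have "\<dots> = (\<Sum>m\<in>sec M. (\<sigma>m * real (m None) * (z (deg m - 1) - z (deg m))
        + \<sigma>p * real (m None + 1) * (z (deg m + 1) - z (deg m))) * diag (tc_op X) m)"
    using X by (intro sum.mono_neutral_right) (auto simp: block_def diag_def coeff_simps)
  finally show ?thesis .
qed

section \<open>Trace and moment bounds for the truncated resolvent\<close>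

lemma linear_tr: "tr (x + y) = tr x + tr y" "tr (x - y) = tr x - tr y" "tr (r *\<^sub>R x) = r * tr x"
  using bounded_linear.linear[OF bounded_linear_tr] linear_add linear_diff linear_scale
  by (metis, metis, metis real_scaleR_def)

text \<open>For the indicator weight the deaths contribute 0 and the births a loss at level
  \<open>M\<close> only.\<close>

lemma tr_resolvent_le:
  assumes X: "X \<in> block (sec M)" and pos: "positive_op (tc_op X)" and eq: "l *\<^sub>R X - G M X = \<rho>"
  shows "l * tr X \<le> tr \<rho>"
proof -
  define z :: "nat \<Rightarrow> real" where "z j = (if j \<le> M then 1 else 0)" for j
  have "tr (G M X) = (\<Sum>m\<in>sec M. z (deg m) * diag (tc_op (G M X)) m)"
    by (simp add: tr_block[OF finite_sec G_in_block] z_def)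
  also have "\<dots> = (\<Sum>m\<in>sec M. (\<sigma>m * real (m None) * (z (deg m - 1) - z (deg m))
        + \<sigma>p * real (m None + 1) * (z (deg m + 1) - z (deg m))) * diag (tc_op X) m)"
    by (rule weighted_trace_G[OF X]) (simp add: z_def)
  also have "\<dots> \<le> 0"
    using sp by (intro sum_nonpos mult_nonpos_nonneg diag_nonneg[OF pos])
      (auto simp: z_def intro!: mult_nonneg_nonpos)
  finally show ?thesis by (simp flip: eq add: linear_tr)
qed

definition moment :: "nat \<Rightarrow> ('n option \<Rightarrow> nat) sa_tc \<Rightarrow> real" where
  "moment M X = (\<Sum>m\<in>sec M. (1 + real (deg m))^4 * diag (tc_op X) m)"

text \<open>Origin of the constant 15, which is sharp at \<open>x = 0\<close>; the remaining
  difference has non-negative coefficients.\<close>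

lemma fourth_power_diff: "(2 + x)^4 - (1 + x)^4 \<le> 15 * (1 + x)^3" if "0 \<le> x" for x :: real
proof -
  have "15 * (1 + x)^3 - ((2 + x)^4 - (1 + x)^4) = x * (17 + 27 * x + 11 * x\<^sup>2)"
    by (simp add: eval_nat_numeral algebra_simps)
  moreover have "0 \<le> x * (17 + 27 * x + 11 * x\<^sup>2)" using that by simp
  ultimately show ?thesis by linarith
qed

text \<open>\<open>(1 + deg m)^4\<close> is a Lyapunov function. Deaths lower it; births occur at
  rate \<open>\<sigma>p * (m None + 1)\<close> and raise it by at most
  \<open>15 * (1 + deg m)^3\<close>, or drop it to 0 at the top level. Hence the bound does not
  depend on \<open>M\<close>.\<close>

lemma moment_resolvent_le:
  assumes X: "X \<in> block (sec M)" and pos: "positive_op (tc_op X)" and eq: "l *\<^sub>R X - G M X = \<rho>"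
  shows "(l - 15 * \<sigma>p) * moment M X \<le> moment M \<rho>"
proof -
  define z :: "nat \<Rightarrow> real" where "z j = (if j \<le> M then (1 + real j)^4 else 0)" for j
  have "(\<Sum>m\<in>sec M. (1 + real (deg m))^4 * diag (tc_op (G M X)) m)
      = (\<Sum>m\<in>sec M. z (deg m) * diag (tc_op (G M X)) m)"
    by (simp add: z_def)
  also have "\<dots> = (\<Sum>m\<in>sec M. (\<sigma>m * real (m None) * (z (deg m - 1) - z (deg m))
        + \<sigma>p * real (m None + 1) * (z (deg m + 1) - z (deg m))) * diag (tc_op X) m)"
    by (rule weighted_trace_G[OF X]) (simp add: z_def)
  also have "\<dots> \<le> (\<Sum>m\<in>sec M. (15 * \<sigma>p * (1 + real (deg m))^4) * diag (tc_op X) m)"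
  proof (intro sum_mono mult_right_mono diag_nonneg[OF pos])
    fix m assume m: "m \<in> sec M"
    let ?d = "real (deg m)"
    have "\<sigma>m * real (m None) * (z (deg m - 1) - z (deg m)) \<le> 0"
      using m sp sm by (intro mult_nonneg_nonpos) (auto simp: z_def intro: power_mono)
    moreover have "\<sigma>p * real (m None + 1) * (z (deg m + 1) - z (deg m)) \<le> \<sigma>p * (15 * (1 + ?d)^4)"
      unfolding mult.assoc
    proof (rule mult_left_mono[OF _ sp])
      have "z (deg m + 1) - z (deg m) \<le> (2 + ?d)^4 - (1 + ?d)^4" using m by (simp add: z_def)
      also have "\<dots> \<le> 15 * (1 + ?d)^3" by (rule fourth_power_diff) simp
      finally have "real (m None + 1) * (z (deg m + 1) - z (deg m)) \<le> real (m None + 1) * (15 * (1 + ?d)^3)"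
        by (intro mult_left_mono) auto
      also have "\<dots> \<le> (1 + ?d) * (15 * (1 + ?d)^3)"
        using le_deg[of m None] by (intro mult_right_mono) auto
      also have "\<dots> = 15 * (1 + ?d)^4" by (simp add: eval_nat_numeral)
      finally show "real (m None + 1) * (z (deg m + 1) - z (deg m)) \<le> 15 * (1 + ?d)^4" .
    qed
    ultimately show "\<sigma>m * real (m None) * (z (deg m - 1) - z (deg m))
        + \<sigma>p * real (m None + 1) * (z (deg m + 1) - z (deg m)) \<le> 15 * \<sigma>p * (1 + ?d)^4"
      by (simp add: mult_ac)
  qed
  also have "\<dots> = 15 * \<sigma>p * moment M X" by (simp add: moment_def sum_distrib_left mult_ac)
  finally have "(\<Sum>m\<in>sec M. (1 + real (deg m))^4 * diag (tc_op (G M X)) m) \<le> 15 * \<sigma>p * moment M X" .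
  moreover have "moment M \<rho> = l * moment M X - (\<Sum>m\<in>sec M. (1 + real (deg m))^4 * diag (tc_op (G M X)) m)"
    unfolding eq[symmetric] moment_def sum_distrib_left sum_subtractf[symmetric]
    by (intro sum.cong refl) (simp add: tc_op_simps diag_simps algebra_simps)
  ultimately show ?thesis by (simp add: algebra_simps)
qed

text \<open>One level up, \<open>L\<close> on the block is \<open>G\<close>, which has a positive
  resolvent. It is applied separately to the positive and negative parts of \<open>\<rho>\<close>,
  both of which stay in the block, and for positive solutions norm and trace agree.\<close>

lemma Lb_dissipative:
  assumes X: "X \<in> block (sec M)" and l: "\<sigma>m < l"
  shows "l * norm X \<le> norm (l *\<^sub>R X - Lb M X)"
proof -
  let ?M = "M + 1"
  have sub: "block (sec M) \<subseteq> block (sec ?M)" by (rule block_mono) auto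
  have X': "X \<in> block (sec ?M)" using X sub by blast
  define \<rho> where "\<rho> = l *\<^sub>R X - Lb M X"
  have \<rho>: "\<rho> = l *\<^sub>R X - G ?M X" by (simp only: \<rho>_def G_eq_Lb[OF X])
  have \<rho>b: "\<rho> \<in> block (sec ?M)"
    unfolding \<rho> by (intro subspace_diff subspace_scale subspace_block X' G_in_block)
  obtain Y Z where YZ: "\<rho> = Y - Z" "positive_op (tc_op Y)" "positive_op (tc_op Z)" "norm \<rho> = tr Y + tr Z"
      "\<And>m. tc_op \<rho> (basis_vec m) = 0 \<Longrightarrow> tc_op Y (basis_vec m) = 0 \<and> tc_op Z (basis_vec m) = 0"
    using jordan_decomposition[of \<rho>] by metis
  have "Y \<in> block (sec ?M)" "Z \<in> block (sec ?M)" using \<rho>b YZ(5) by (auto simp: block_def)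
  then obtain X1 X2 where X1: "X1 \<in> block (sec ?M)" "l *\<^sub>R X1 - G ?M X1 = Y"
    and X2: "X2 \<in> block (sec ?M)" "l *\<^sub>R X2 - G ?M X2 = Z"
    using galerkin_solve[OF _ l] by metis
  have p: "positive_op (tc_op X1)" "positive_op (tc_op X2)"
    using galerkin_positive[OF X1(1) l] galerkin_positive[OF X2(1) l] X1(2) X2(2) YZ(2,3) by simp_all
  have "X - (X1 - X2) = 0"
  proof (rule galerkin_injective[OF _ l])
    show "X - (X1 - X2) \<in> block (sec ?M)" by (intro subspace_diff subspace_block X' X1(1) X2(1))
    have "l *\<^sub>R (X - (X1 - X2)) - G ?M (X - (X1 - X2))
        = (l *\<^sub>R X - G ?M X) - ((l *\<^sub>R X1 - G ?M X1) - (l *\<^sub>R X2 - G ?M X2))"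
      unfolding linear_diff[OF linear_G] by (simp add: algebra_simps)
    then show "l *\<^sub>R (X - (X1 - X2)) - G ?M (X - (X1 - X2)) = 0"
      using X1(2) X2(2) \<rho> YZ(1) by simp
  qed
  then have "norm X \<le> norm X1 + norm X2" by (simp add: norm_triangle_ineq4)
  also have "\<dots> = tr X1 + tr X2" by (simp add: norm_positive p)
  finally have "l * norm X \<le> l * tr X1 + l * tr X2"
    using l sp sm by (simp flip: distrib_left)
  also have "\<dots> \<le> tr Y + tr Z"
    by (intro add_mono tr_resolvent_le[OF X1(1) p(1) X1(2)] tr_resolvent_le[OF X2(1) p(2) X2(2)])
  finally show ?thesis by (simp add: YZ(4)[symmetric] \<rho>_def)
qed

lemma moment_nonneg: "positive_op (tc_op X) \<Longrightarrow> 0 \<le> moment M X"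
  unfolding moment_def by (intro sum_nonneg mult_nonneg_nonneg diag_nonneg) auto

text \<open>The difference is \<open>\<sigma>p\<close> times the jump term of \<open>C M\<close>
  minus that of its truncation \<open>Bd M\<close>. Writing it through \<open>Z\<close>, which is
  \<open>X\<close> with \<open>(1 + n)\<^sup>2\<close> on both sides and has the fourth moment as
  its norm, replaces \<open>C M\<close> by \<open>C'\<close>, in which two resolvents tame the
  creation operator.\<close>

lemma Lb_diff_G:
  assumes X: "X \<in> block (sec M)" and pos: "positive_op (tc_op X)"
  shows "norm (Lb M X - G M X) \<le> 2 * \<sigma>p / (real M + 1) * moment M X"
proof -
  let ?P = "proj (sec M)"
  define Q2 where "Q2 = Q M o\<^sub>L Q M"
  define Z where "Z = conj_tc Q2 X"
  define C' where "C' = C M o\<^sub>L res_op o\<^sub>L res_op"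
  \<comment> \<open>Polarization: with \<open>a = C'\<close> and \<open>p\<close> its truncation,
    \<open>a Z a\<^sup>* - p Z p\<^sup>*\<close> is \<open>mix (a - p) ((a + p) / 2) Z\<close>. The
    factor \<open>D = a - p\<close> sees only the jump from level \<open>M\<close> to
    \<open>M + 1\<close> and supplies the decay \<open>1 / (M + 1)\<close>; the factor
    \<open>E'\<close> is merely bounded by 1.\<close>
  define D where "D = C' - (?P o\<^sub>L C')"
  define E' where "E' = (1/2) *\<^sub>R (C' + (?P o\<^sub>L C'))"
  define w :: "('n option \<Rightarrow> nat) \<Rightarrow> real" where
    "w m = sqrt (real (m None)) * (1 / (1 + real (deg (dn None m))))\<^sup>2" for m
  have cl: "clinear_op Q2" "clinear_op C'" "clinear_op D" "clinear_op E'"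
    unfolding Q2_def C'_def D_def E'_def by (intro clinear)+
  have w: "0 \<le> w m" "w m \<le> 1" "deg m = M + 1 \<Longrightarrow> w m \<le> 1 / (real M + 1)" for m
  proof -
    show "0 \<le> w m" by (simp add: w_def)
    have *: "w m \<le> 1 / (1 + real (deg (dn None m)))"
    proof (cases "m None > 0")
      case True
      have "sqrt (real (m None)) \<le> real (m None)" by (rule sqrt_nat_le)
      also have "\<dots> \<le> 1 + real (deg (dn None m))" using le_deg[of m None] deg_dn[of m None, OF True] by simp
      finally show ?thesis by (simp add: w_def power2_eq_square divide_simps)
    qed (simp add: w_def)
    then show "w m \<le> 1" by (rule order_trans) simp
    show "w m \<le> 1 / (real M + 1)" if d: "deg m = M + 1"
    proof (cases "m None > 0")
      case True
      then show ?thesis using * deg_dn[of m None, OF True] d by (simp add: add.commute)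
    qed (simp add: w_def)
  qed
  have C': "coeff (C' \<psi>) m = (if deg m \<le> M + 1 then of_real (w m) else 0) * coeff \<psi> (dn None m)" for \<psi> m
    using shift_C[of M] by (simp add: C'_def shift_op_def coeff_res_op w_def power2_eq_square)
  have inj: "inj_on (dn None) {m. (if R m then complex_of_real (w m) else 0) \<noteq> 0}" for R
    by (rule inj_on_dn) (auto simp: w_def split: if_splits)
  have "norm C' \<le> 1"
    by (rule shift_op_norm[of _ "\<lambda>m. if deg m \<le> M + 1 then of_real (w m) else 0" "dn None"])
      (use w inj[of "\<lambda>m. deg m \<le> M + 1"] in \<open>auto simp: shift_op_def C' admissible_def abs_of_nonneg\<close>)
  moreover have "norm D \<le> 1 / (real M + 1)"
  proof (rule shift_op_norm[of _ "\<lambda>m. if deg m = M + 1 then of_real (w m) else 0" "dn None"])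
    show "shift_op D (\<lambda>m. if deg m = M + 1 then of_real (w m) else 0) (dn None)"
      by (auto simp: shift_op_def D_def blinfun.bilinear_simps coeff_simps coeff_proj C')
    show "admissible (\<lambda>m. if deg m = M + 1 then complex_of_real (w m) else 0) (dn None) (1 / (real M + 1))"
      using w inj[of "\<lambda>m. deg m = M + 1"] by (auto simp: admissible_def abs_of_nonneg)
  qed
  moreover have "norm E' \<le> 1"
  proof -
    have "norm (?P o\<^sub>L C') \<le> 1 * 1"
      using \<open>norm C' \<le> 1\<close> norm_proj_le[OF finite_sec, of M]
      by (intro order_trans[OF norm_blinfun_compose] mult_mono) auto
    then show ?thesis using \<open>norm C' \<le> 1\<close> norm_triangle_ineq[of C' "?P o\<^sub>L C'"] by (simp add: E'_def)
  qed
  ultimately have "norm (mix D E' Z) \<le> 2 * (1 / (real M + 1)) * 1 * norm Z"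
    by (intro order_trans[OF mix(2)[OF cl(3,4)]] mult_right_mono mult_mono) auto
  moreover have "norm Z = moment M X"
  proof -
    have sh: "shift_op Q2 (\<lambda>m. q_weight M m * q_weight M m) id"
      using shift_Q[of M] by (simp add: shift_op_def Q2_def)
    have opZ: "tc_op Z = Q2 o\<^sub>L tc_op X o\<^sub>L adj Q2" by (simp add: Z_def tc_op_conj cl)
    have posZ: "positive_op (tc_op Z)" unfolding opZ by (rule positive_sandwich[OF cl(1) pos])
    have "Z \<in> block (sec M)"
      by (simp add: block_def opZ shift_op_adj_basis[OF sh] q_weight_def)
    then have "norm Z = (\<Sum>m\<in>sec M. diag (tc_op Z) m)"
      by (simp add: norm_positive[OF posZ] tr_block)
    also have "\<dots> = moment M X"
      unfolding moment_def
    proof (intro sum.cong refl)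
      fix m assume "m \<in> sec M"
      then have "cmod (q_weight M m * q_weight M m) = (1 + real (deg m)) * (1 + real (deg m))"
        unfolding norm_mult by (simp add: q_weight_def del: of_real_add)
      then show "diag (tc_op Z) m = (1 + real (deg m))^4 * diag (tc_op X) m"
        unfolding opZ diag_shift_sandwich[OF sh tc_op_clinear]
        by (simp add: eval_nat_numeral)
    qed
    finally show ?thesis .
  qed
  moreover have "Lb M X - G M X = \<sigma>p *\<^sub>R mix D E' Z"
  proof (intro tc_eqI blinfun_eqI)
    fix \<psi>
    have Qres: "Q M (res_op v) = ?P v" and resQ: "res_op (Q M v) = ?P v" for v
      using res_Q[of M] by (metis blinfun_apply_blinfun_compose)+
    have PQ: "?P (Q M v) = Q M v" "Q M (?P v) = Q M v" for v
      by (auto intro!: ell2_eqI simp: coeff_Q coeff_proj)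
    have CX: "C' (Q2 (tc_op X v)) = C M (tc_op X v)" for v
      by (simp add: C'_def Q2_def resQ PQ block_proj[OF _ X])
    have adjC': "adj C' v = res_op (res_op (adj (C M) v))" for v
      by (simp add: C'_def adj_compose clinear clinear_BCK adj_res)
    have adjQ2: "adj Q2 v = Q M (Q M v)" for v by (simp add: Q2_def adj_compose clinear adj_Q)
    have XC: "tc_op X (adj Q2 (adj C' v)) = tc_op X (adj (C M) v)" for v
      using block_proj(2)[OF finite_sec X] by (simp add: adjC' adjQ2 Qres PQ)
    have adjP: "adj (?P o\<^sub>L C') v = adj C' (?P v)" "adj (Bd M) v = adj (C M) (?P v)" for v
      by (simp_all add: Bd_def adj_compose clinear clinear_BCK cl adj_proj)
    have adjDE: "adj D v = adj C' v - adj C' (?P v)" "adj E' v = (1/2) *\<^sub>R (adj C' v + adj C' (?P v))" for v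
      using adjP(1) by (simp_all add: D_def E'_def adj_diff adj_add adj_scaleR clinear cl blinfun.bilinear_simps)
    have DE: "D v = C' v - ?P (C' v)" "E' v = (1/2) *\<^sub>R (C' v + ?P (C' v))" for v
      by (simp_all add: D_def E'_def blinfun.bilinear_simps)
    have half: "(1/2) *\<^sub>R ((a - p) + (b - q)) + ((1/2) *\<^sub>R (a + p) - (1/2) *\<^sub>R (b + q)) = a - q"
      for a b p q :: "('n option \<Rightarrow> nat) ell2"
      by (rule ell2_eqI) (simp add: coeff_simps field_simps)
    have "tc_op (mix D E' Z) \<psi> = C' (tc_op Z (adj C' \<psi>)) - ?P (C' (tc_op Z (adj C' (?P \<psi>))))"
      using half[of "C' (tc_op Z (adj C' \<psi>))" "?P (C' (tc_op Z (adj C' \<psi>)))"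
          "C' (tc_op Z (adj C' (?P \<psi>)))" "?P (C' (tc_op Z (adj C' (?P \<psi>))))"]
      by (simp only: mix(1)[OF cl(3,4)] blinfun.add_left blinfun_apply_blinfun_compose adjDE DE
          blinfun.scaleR_right blinfun.add_right blinfun.diff_right)
    also have "\<dots> = C M (tc_op X (adj (C M) \<psi>)) - Bd M (tc_op X (adj (Bd M) \<psi>))"
      by (simp add: Z_def tc_op_conj cl CX XC adjP) (simp add: Bd_def)
    finally have mixDE: "tc_op (mix D E' Z) \<psi> = C M (tc_op X (adj (C M) \<psi>)) - Bd M (tc_op X (adj (Bd M) \<psi>))" .
    show "tc_op (Lb M X - G M X) \<psi> = tc_op (\<sigma>p *\<^sub>R mix D E' Z) \<psi>"
      by (simp add: tc_op_G[OF X] tc_op_simps Lb_def tc_op_conj mix(1) clinear clinear_BCK adj_id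
          blinfun.bilinear_simps mixDE scaleR_diff_right)
  qed
  ultimately show ?thesis using sp mult_left_mono[of "norm (mix D E' Z)" "2 * (1 / (real M + 1)) * moment M X" \<sigma>p]
    by (simp add: mult_ac)
qed

end

lemma subspace_closure:
  fixes S :: "'a::real_normed_vector set"
  assumes "subspace S" shows "subspace (closure S)"
  unfolding subspace_def
proof (intro conjI ballI allI)
  show "0 \<in> closure S" using subspace_0[OF assms] closure_subset by blast
  fix x y and r :: real assume x: "x \<in> closure S"
  then obtain f where f: "\<And>n. f n \<in> S" "f \<longlonglongrightarrow> x" unfolding closure_sequential by blast
  show "r *\<^sub>R x \<in> closure S" unfolding closure_sequential
    using f subspace_scale[OF assms] by (intro exI[of _ "\<lambda>n. r *\<^sub>R f n"]) (auto intro!: tendsto_intros)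
  assume "y \<in> closure S"
  then obtain g where g: "\<And>n. g n \<in> S" "g \<longlonglongrightarrow> y" unfolding closure_sequential by blast
  show "x + y \<in> closure S" unfolding closure_sequential
    using f g subspace_add[OF assms] by (intro exI[of _ "\<lambda>n. f n + g n"]) (auto intro!: tendsto_intros)
qed

text \<open>Dissipativity bounds differences of the \<open>x\<close> by differences of the values
  \<open>l x - y\<close>, so convergent values have convergent preimages, and closedness of
  \<open>A\<close> catches the limit.\<close>

lemma dissipative_range_closed:
  fixes A :: "('v::banach \<times> 'v) set"
  assumes A: "subspace A" "closed A" and l: "l > 0"
    and diss: "\<And>x y. (x, y) \<in> A \<Longrightarrow> l * norm x \<le> norm (l *\<^sub>R x - y)"
  shows "closed {l *\<^sub>R x - y |x y. (x, y) \<in> A}"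
  unfolding closed_sequential_limits
proof (intro allI impI, elim conjE)
  fix z w assume z: "\<forall>n. z n \<in> {l *\<^sub>R x - y |x y. (x, y) \<in> A}" and lim: "z \<longlonglongrightarrow> w"
  then have "\<forall>n. \<exists>x y. (x, y) \<in> A \<and> z n = l *\<^sub>R x - y" by blast
  then obtain x y where xy: "\<And>n. (x n, y n) \<in> A" "\<And>n. z n = l *\<^sub>R x n - y n" by metis
  have "Cauchy x"
  proof (rule metric_CauchyI)
    fix e :: real assume "e > 0"
    then have "l * e > 0" using l by simp
    then obtain N where N: "\<forall>m\<ge>N. \<forall>n\<ge>N. dist (z m) (z n) < l * e"
      using LIMSEQ_imp_Cauchy[OF lim] unfolding Cauchy_def by blast
    have "dist (x m) (x n) < e" if "m \<ge> N" "n \<ge> N" for m n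
    proof -
      have "(x m - x n, y m - y n) \<in> A"
        using subspace_diff[OF A(1) xy(1)[of m] xy(1)[of n]] by simp
      from diss[OF this] have "l * norm (x m - x n) \<le> norm (z m - z n)"
        by (simp add: xy(2) algebra_simps)
      also have "\<dots> < l * e" using N that by (simp add: dist_norm)
      finally show ?thesis using l by (simp add: dist_norm)
    qed
    then show "\<exists>N. \<forall>m\<ge>N. \<forall>n\<ge>N. dist (x m) (x n) < e" by blast
  qed
  then obtain u where u: "x \<longlonglongrightarrow> u" using Cauchy_convergent convergent_def by blast
  have "(\<lambda>n. l *\<^sub>R x n - z n) \<longlonglongrightarrow> l *\<^sub>R u - w" by (intro tendsto_intros u lim)
  then have v: "y \<longlonglongrightarrow> l *\<^sub>R u - w" by (simp add: xy(2))
  have "(u, l *\<^sub>R u - w) \<in> A"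
    by (rule closed_sequentially[OF A(2), of "\<lambda>n. (x n, y n)"]) (auto intro: xy tendsto_Pair u v)
  then show "w \<in> {l *\<^sub>R x - y |x y. (x, y) \<in> A}" by force
qed

context boson_model
begin

section \<open>The closure of the graph as a dissipative relation\<close>

definition graph :: "(('n option \<Rightarrow> nat) sa_tc \<times> ('n option \<Rightarrow> nat) sa_tc) set" where
  "graph = range (\<lambda>\<rho>. (conj_tc res_op \<rho>, LV \<rho>))"

lemma bounded_linear_graph: "bounded_linear (\<lambda>\<rho>. (conj_tc res_op \<rho>, LV \<rho>))"
  by (intro bounded_linear_Pair bounded_linear_conj bounded_linear_LV clinear)

lemma Lb_graph: "X \<in> block (sec M) \<Longrightarrow> (X, Lb M X) \<in> graph"
  unfolding graph_def
  using rangeI[of "\<lambda>\<rho>. (conj_tc res_op \<rho>, LV \<rho>)" "conj_tc (Q M) X"] LV_Q[of X M] by simp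

definition blocks :: "('n option \<Rightarrow> nat) sa_tc set" where
  "blocks = (\<Union>M. block (sec M))"

lemma closure_blocks: "closure blocks = UNIV"
proof -
  have "X \<in> closure blocks" for X
    unfolding closure_approachable
  proof (intro allI impI)
    fix e :: real assume "e > 0"
    then have "e/2 > 0" by simp
    obtain F where F: "finite F" "\<And>F'. finite F' \<Longrightarrow> F \<subseteq> F' \<Longrightarrow> norm (X - conj_tc (proj F') X) \<le> e/2"
      using finite_sections[OF \<open>e/2 > 0\<close>] by metis
    define M where "M = Max (insert 0 (deg ` F))"
    have "F \<subseteq> sec M" using F(1) by (auto simp: M_def)
    then have "norm (X - conj_tc (proj (sec M)) X) \<le> e/2" by (intro F(2)) auto
    then have "dist (conj_tc (proj (sec M)) X) X < e"
      using \<open>e > 0\<close> by (simp add: dist_norm norm_minus_commute)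
    moreover have "conj_tc (proj (sec M)) X \<in> blocks"
      unfolding blocks_def using conj_proj_in_block[OF finite_sec] by blast
    ultimately show "\<exists>Y\<in>blocks. dist Y X < e" by blast
  qed
  then show ?thesis by blast
qed

text \<open>Blocks form a core. The graph is the range of a bounded map of the parameter
  \<open>\<rho>\<close>, so density of blocks among the parameters passes to the graph, and
  parameters from a block yield elements of the same block.\<close>

lemma graph_core: "graph \<subseteq> closure {(X, Lb M X) |X M. X \<in> block (sec M)}"
proof -
  have "(conj_tc res_op \<rho>, LV \<rho>) \<in> {(X, Lb M X) |X M. X \<in> block (sec M)}" if \<rho>: "\<rho> \<in> block (sec M)" for \<rho> M
  proof -
    define X where "X = conj_tc res_op \<rho>"
    have "tc_op X (basis_vec m) = 0" if "m \<notin> sec M" for m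
    proof -
      have "res_op (basis_vec m) = res_weight m *\<^sub>C basis_vec m"
        using shift_op_adj_basis[OF shift_res, of m] by (simp add: adj_res res_weight_def)
      then show ?thesis using \<rho> that
        by (simp add: X_def tc_op_conj clinear adj_res clinear_opD[OF tc_op_clinear] block_def)
    qed
    then have X: "X \<in> block (sec M)" by (simp add: block_def)
    have "conj_tc (Q M) X = \<rho>"
    proof (intro tc_eqI blinfun_eqI)
      have Qres: "Q M (res_op v) = proj (sec M) v" and resQ: "res_op (Q M v) = proj (sec M) v" for v
        using res_Q[of M] by (metis blinfun_apply_blinfun_compose)+
      show "tc_op (conj_tc (Q M) X) \<psi> = tc_op \<rho> \<psi>" for \<psi>
        by (simp add: X_def tc_op_conj clinear adj_Q adj_res Qres resQ block_proj[OF _ \<rho>])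
    qed
    then have "LV \<rho> = Lb M X" using LV_Q(1)[OF X] by simp
    then show ?thesis using X by (auto simp: X_def)
  qed
  then have "(\<lambda>\<rho>. (conj_tc res_op \<rho>, LV \<rho>)) ` blocks \<subseteq> {(X, Lb M X) |X M. X \<in> block (sec M)}"
    unfolding blocks_def by blast
  then show ?thesis
    unfolding graph_def
    using closure_range_bounded_linear[OF bounded_linear_graph closure_blocks] closure_mono by blast
qed

lemma closure_graph: "closure graph = closure {(X, Lb M X) |X M. X \<in> block (sec M)}"
proof
  show "closure graph \<subseteq> closure {(X, Lb M X) |X M. X \<in> block (sec M)}"
    using graph_core by (simp add: closure_minimal)
  show "closure {(X, Lb M X) |X M. X \<in> block (sec M)} \<subseteq> closure graph"
    using Lb_graph by (intro closure_mono) blast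
qed

lemma graph_dissipative:
  assumes "(X, Y) \<in> closure graph" "\<sigma>m < l"
  shows "l * norm X \<le> norm (l *\<^sub>R X - Y)"
proof -
  have "closed {p :: ('n option \<Rightarrow> nat) sa_tc \<times> ('n option \<Rightarrow> nat) sa_tc. l * norm (fst p) \<le> norm (l *\<^sub>R fst p - snd p)}"
    by (intro closed_Collect_le continuous_intros)
  then have "closure {(X, Lb M X) |X M. X \<in> block (sec M)}
      \<subseteq> {p. l * norm (fst p) \<le> norm (l *\<^sub>R fst p - snd p)}"
    using Lb_dissipative assms(2) by (intro closure_minimal) auto
  then show ?thesis using assms(1) by (auto simp: closure_graph)
qed

lemma graph_range_approx:
  assumes \<rho>: "\<rho> \<in> block (sec M\<^sub>0)" "positive_op (tc_op \<rho>)"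
    and l: "\<sigma>m < l" "15 * \<sigma>p < l" and e: "e > 0"
  shows "\<exists>X Y. (X, Y) \<in> graph \<and> dist (l *\<^sub>R X - Y) \<rho> < e"
proof -
  \<comment> \<open>\<open>c / (real M + 1)\<close> will bound the truncation error at level
    \<open>M\<close>. The moment of \<open>\<rho>\<close> is the same at all levels from
    \<open>M\<^sub>0\<close> on, so \<open>c\<close> is independent of \<open>M\<close>.\<close>
  define c where "c = 2 * \<sigma>p * (moment M\<^sub>0 \<rho> / (l - 15 * \<sigma>p))"
  have "c \<ge> 0" unfolding c_def using sp l moment_nonneg[OF \<rho>(2)] by (intro mult_nonneg_nonneg divide_nonneg_pos) auto
  obtain k :: nat where k: "c / e < real k" using reals_Archimedean2 by blast
  define M where "M = max M\<^sub>0 k"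
  have "block (sec M\<^sub>0) \<subseteq> block (sec M)" by (intro block_mono) (auto simp: M_def)
  then have "\<rho> \<in> block (sec M)" using \<rho> by blast
  then obtain X where X: "X \<in> block (sec M)" "l *\<^sub>R X - G M X = \<rho>" using galerkin_solve[OF _ l(1)] by metis
  have pos: "positive_op (tc_op X)" using galerkin_positive[OF X(1) l(1)] X(2) \<rho>(2) by simp
  have "moment M \<rho> = moment M\<^sub>0 \<rho>"
    unfolding moment_def using \<rho>(1)
    by (intro sum.mono_neutral_right) (auto simp: M_def block_def diag_def coeff_simps)
  then have "moment M X \<le> moment M\<^sub>0 \<rho> / (l - 15 * \<sigma>p)"
    using moment_resolvent_le[OF X(1) pos X(2)] l(2) by (simp add: field_simps)
  then have "2 * \<sigma>p / (real M + 1) * moment M X \<le> 2 * \<sigma>p / (real M + 1) * (moment M\<^sub>0 \<rho> / (l - 15 * \<sigma>p))"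
    using sp by (intro mult_left_mono) auto
  then have "norm (Lb M X - G M X) \<le> c / (real M + 1)"
    using order_trans[OF Lb_diff_G[OF X(1) pos]] by (simp add: c_def mult_ac)
  also have "\<dots> < e"
  proof -
    have "c < e * real k" using k e by (simp add: field_simps)
    also have "\<dots> \<le> e * (real M + 1)" using e by (intro mult_left_mono) (auto simp: M_def)
    finally show ?thesis by (simp add: field_simps)
  qed
  finally have "norm (Lb M X - G M X) < e" .
  moreover have "l *\<^sub>R X - Lb M X - \<rho> = - (Lb M X - G M X)" using X(2) by (simp add: algebra_simps)
  ultimately have "dist (l *\<^sub>R X - Lb M X) \<rho> < e"
    unfolding dist_norm by (metis norm_minus_cancel)
  then show ?thesis using Lb_graph[OF X(1)] by blast
qed

lemma subspace_graph: "subspace graph"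
  unfolding graph_def
  by (rule linear_subspace_image[OF bounded_linear.linear[OF bounded_linear_graph] subspace_UNIV])

text \<open>\<open>\<sigma>m\<close> is the threshold of the positivity argument,
  \<open>15 * \<sigma>p\<close> that of the moment bound. The range of \<open>l - L\<close> is a
  closed subspace; approximate solvability for positive blocks puts these inside, differences give
  all blocks, and density gives everything.\<close>

lemma dissipative_relation_graph: "dissipative_relation (closure graph) (max \<sigma>m (15 * \<sigma>p))"
proof
  show "subspace (closure graph)" by (rule subspace_closure[OF subspace_graph])
  show "closed (closure graph)" by simp
  have "blocks \<subseteq> fst ` closure graph"
  proof
    fix X assume "X \<in> blocks"
    then obtain M where "X \<in> block (sec M)" by (auto simp: blocks_def)
    then have "(X, Lb M X) \<in> closure graph" using Lb_graph closure_subset by blast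
    then show "X \<in> fst ` closure graph" by force
  qed
  then show "closure (fst ` closure graph) = UNIV" using closure_mono closure_blocks by blast
  show "l * norm X \<le> norm (l *\<^sub>R X - Y)" if "(X, Y) \<in> closure graph" "max \<sigma>m (15 * \<sigma>p) < l" for l X Y
    using graph_dissipative[OF that(1)] that(2) by simp
  show "0 \<le> max \<sigma>m (15 * \<sigma>p)" using sp sm by simp
  fix l z assume "max \<sigma>m (15 * \<sigma>p) < l"
  then have l: "\<sigma>m < l" "15 * \<sigma>p < l" "l > 0" using sp sm by auto
  define R where "R = {l *\<^sub>R X - Y |X Y. (X, Y) \<in> closure graph}"
  have "closed R" unfolding R_def
    by (rule dissipative_range_closed[OF subspace_closure[OF subspace_graph] closed_closure l(3)])
      (rule graph_dissipative[OF _ l(1)])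
  have R_image: "R = (\<lambda>p. l *\<^sub>R fst p - snd p) ` closure graph" unfolding R_def by force
  have lin: "linear (\<lambda>p :: ('n option \<Rightarrow> nat) sa_tc \<times> ('n option \<Rightarrow> nat) sa_tc. l *\<^sub>R fst p - snd p)"
    by (simp add: linear_iff algebra_simps)
  have "subspace R"
    unfolding R_image by (rule linear_subspace_image[OF lin subspace_closure[OF subspace_graph]])
  have pos: "\<rho> \<in> R" if \<rho>: "\<rho> \<in> block (sec M)" "positive_op (tc_op \<rho>)" for \<rho> M
  proof -
    have "\<rho> \<in> closure R"
      unfolding closure_approachable
    proof (intro allI impI)
      fix e :: real assume "e > 0"
      then obtain X Y where XY: "(X, Y) \<in> graph" "dist (l *\<^sub>R X - Y) \<rho> < e"
        using graph_range_approx[OF \<rho> l(1,2)] by blast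
      then have "l *\<^sub>R X - Y \<in> R" unfolding R_def using closure_subset[of graph] by auto
      with XY(2) show "\<exists>y\<in>R. dist y \<rho> < e" by blast
    qed
    then show ?thesis using \<open>closed R\<close> by simp
  qed
  have "blocks \<subseteq> R"
  proof
    fix \<rho> assume "\<rho> \<in> blocks"
    then obtain M where M: "\<rho> \<in> block (sec M)" by (auto simp: blocks_def)
    obtain Y Z where YZ: "\<rho> = Y - Z" "positive_op (tc_op Y)" "positive_op (tc_op Z)"
      "\<And>m. tc_op \<rho> (basis_vec m) = 0 \<Longrightarrow> tc_op Y (basis_vec m) = 0 \<and> tc_op Z (basis_vec m) = 0"
      using jordan_decomposition[of \<rho>] by metis
    then have "Y \<in> block (sec M)" "Z \<in> block (sec M)" using M by (auto simp: block_def)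
    then show "\<rho> \<in> R" unfolding YZ(1) using pos YZ(2,3) by (intro subspace_diff \<open>subspace R\<close>) blast+
  qed
  then have "closure blocks \<subseteq> R" using \<open>closed R\<close> by (simp add: closure_minimal)
  then have "z \<in> R" unfolding closure_blocks by blast
  then show "\<exists>X Y. (X, Y) \<in> closure graph \<and> l *\<^sub>R X - Y = z" unfolding R_def by blast
qed

lemma tr_graph: "(X, Y) \<in> closure graph \<Longrightarrow> tr Y = 0"
proof -
  have "closed {p :: ('n option \<Rightarrow> nat) sa_tc \<times> ('n option \<Rightarrow> nat) sa_tc. tr (snd p) = 0}"
    by (intro closed_Collect_eq continuous_intros bounded_linear.continuous_on[OF bounded_linear_tr])
  then have "closure graph \<subseteq> {p. tr (snd p) = 0}"
    unfolding closure_graph using tr_Lb by (intro closure_minimal) auto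
  then show "(X, Y) \<in> closure graph \<Longrightarrow> tr Y = 0" by auto
qed

section \<open>Identification with the graphs and closures of the statement\<close>

lemma clinear_eq_basis:
  assumes "clinear_op A'" "clinear_op B'" "\<And>x. A' (basis_vec x) = B' (basis_vec x)"
  shows "A' = B'"
proof -
  have "adj A' = adj B'"
    by (rule blinfun_eqI, rule ell2_eqI) (metis assms adj_cinner cinner_basis_vec)
  then show ?thesis using assms adj_adj by metis
qed

text \<open>The restriction to \<open>D_sa\<close> constrains the sandwiched operator and not
  \<open>\<rho>\<close>. As the resolvent is diagonal with non-zero weights, it can be cancelled
  entry by entry, and self-adjointness passes to \<open>\<rho>\<close>.\<close>

lemma L_sa_graph_eq: "L_sa_graph E \<epsilon> \<eta> \<sigma>p \<sigma>m n = (\<lambda>(X, Y). (tc_op X, tc_op Y)) ` graph"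
proof -
  have val: "L_value E \<epsilon> \<eta> \<sigma>p \<sigma>m n (tc_op \<rho>) = tc_op (LV \<rho>)"
    "R_op o\<^sub>L tc_op \<rho> o\<^sub>L R_op = tc_op (conj_tc res_op \<rho>)" for \<rho>
    by (simp_all add: L_value_def Let_def R_op_eq LV_def tc_op_simps tc_op_conj mix(1) clinear KR(2)
        adj_res KR_def[symmetric] BR_def[symmetric] CR_def[symmetric])
  have sa: "selfadjoint \<rho>"
    if \<rho>: "\<rho> \<in> trace_class" "R_op o\<^sub>L \<rho> o\<^sub>L R_op \<in> sa_trace_class" for \<rho> :: "('n option \<Rightarrow> nat) op"
  proof -
    have cl: "clinear_op \<rho>" using \<rho>(1) by (simp add: trace_class_def)
    have Rb: "res_op (basis_vec m) = res_weight m *\<^sub>C basis_vec m" for m :: "'n option \<Rightarrow> nat"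
      using shift_op_adj_basis[OF shift_res, of m] by (simp add: adj_res res_weight_def)
    have nz: "res_weight m \<noteq> 0" for m :: "'n option \<Rightarrow> nat"
      unfolding res_weight_def of_real_eq_0_iff by simp
    have "adj (res_op o\<^sub>L \<rho> o\<^sub>L res_op) = res_op o\<^sub>L \<rho> o\<^sub>L res_op"
      using \<rho>(2) by (simp add: R_op_eq sa_trace_class_def selfadjoint_iff)
    then have h: "res_op o\<^sub>L (adj \<rho> o\<^sub>L res_op) = res_op o\<^sub>L \<rho> o\<^sub>L res_op"
      unfolding adj_compose[OF clinear_compose[OF clinear_res cl] clinear_res]
        adj_compose[OF clinear_res cl] adj_res .
    have eq: "res_op (adj \<rho> (res_op v)) = res_op (\<rho> (res_op v))" for v
      using arg_cong[OF h, of "\<lambda>A. blinfun_apply A v"] by simp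
    have "adj \<rho> = \<rho>"
    proof (rule clinear_eq_basis)
      fix m :: "'n option \<Rightarrow> nat"
      show "adj \<rho> (basis_vec m) = \<rho> (basis_vec m)"
      proof (rule ell2_eqI)
        fix m'
        have "coeff (res_op (adj \<rho> (res_op (basis_vec m)))) m' = coeff (res_op (\<rho> (res_op (basis_vec m)))) m'"
          by (simp add: eq)
        then show "coeff (adj \<rho> (basis_vec m)) m' = coeff (\<rho> (basis_vec m)) m'"
          using nz shift_res cl by (simp add: Rb shift_op_def clinear_opD clinear coeff_simps)
      qed
    qed (use cl in \<open>simp_all add: clinear\<close>)
    then show ?thesis using cl by (simp add: selfadjoint_iff)
  qed
  show ?thesis
  proof (intro set_eqI iffI)
    fix p assume "p \<in> L_sa_graph E \<epsilon> \<eta> \<sigma>p \<sigma>m n"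
    then obtain \<rho> where \<rho>: "\<rho> \<in> trace_class" "R_op o\<^sub>L \<rho> o\<^sub>L R_op \<in> sa_trace_class"
      "p = (R_op o\<^sub>L \<rho> o\<^sub>L R_op, L_value E \<epsilon> \<eta> \<sigma>p \<sigma>m n \<rho>)"
      by (auto simp: L_sa_graph_def L_graph_def D_sa_def)
    then have "\<rho> \<in> sa_trace_class" using sa by (simp add: sa_trace_class_def)
    then have "tc_op (Abs_tc \<rho>) = \<rho>" by (rule Abs_tc_inverse)
    then have "p = (tc_op (conj_tc res_op (Abs_tc \<rho>)), tc_op (LV (Abs_tc \<rho>)))"
      using \<rho>(3) val[of "Abs_tc \<rho>"] by simp
    then show "p \<in> (\<lambda>(X, Y). (tc_op X, tc_op Y)) ` graph" by (force simp: graph_def)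
  next
    fix p assume "p \<in> (\<lambda>(X, Y). (tc_op X, tc_op Y)) ` graph"
    then obtain \<rho> where p: "p = (tc_op (conj_tc res_op \<rho>), tc_op (LV \<rho>))" by (auto simp: graph_def)
    have "tc_op \<rho> \<in> trace_class" using tc_op[of \<rho>] by (simp add: sa_trace_class_def)
    moreover have "tc_op (conj_tc res_op \<rho>) \<in> D_sa"
      unfolding D_sa_def D_tilde_def
      using \<open>tc_op \<rho> \<in> trace_class\<close> tc_op[of "conj_tc res_op \<rho>"] val(2)[of \<rho>, symmetric] by auto
    ultimately show "p \<in> L_sa_graph E \<epsilon> \<eta> \<sigma>p \<sigma>m n"
      unfolding p L_sa_graph_def L_graph_def using val[of \<rho>] by force
  qed
qed

end

lemma graph_closure_tc:
  "graph_closure sa_trace_class trace_norm ((\<lambda>(X, Y). (tc_op X, tc_op Y)) ` A)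
    = (\<lambda>(X, Y). (tc_op X, tc_op Y)) ` closure A"
proof (intro set_eqI iffI)
  fix p assume "p \<in> graph_closure sa_trace_class trace_norm ((\<lambda>(X, Y). (tc_op X, tc_op Y)) ` A)"
  then obtain x y u v where p: "p = (x, y)" "x \<in> sa_trace_class" "y \<in> sa_trace_class"
    and uv: "\<And>j :: nat. (u j, v j) \<in> (\<lambda>(X, Y). (tc_op X, tc_op Y)) ` A"
    and lim: "(\<lambda>j. trace_norm (u j - x)) \<longlonglongrightarrow> 0" "(\<lambda>j. trace_norm (v j - y)) \<longlonglongrightarrow> 0"
    unfolding graph_closure_def by blast
  obtain X Y where XY: "x = tc_op X" "y = tc_op Y" using p(2,3) by (metis Abs_tc_inverse)
  have "\<forall>j. \<exists>U V. (U, V) \<in> A \<and> u j = tc_op U \<and> v j = tc_op V" using uv by fastforce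
  then obtain U V where UV: "\<And>j. (U j, V j) \<in> A" "\<And>j. u j = tc_op (U j)" "\<And>j. v j = tc_op (V j)" by metis
  have "U \<longlonglongrightarrow> X" "V \<longlonglongrightarrow> Y"
    using lim by (subst tendsto_dist_iff,
        simp add: UV XY norm_sa_tc.rep_eq minus_sa_tc.rep_eq dist_norm)+
  then have "(\<lambda>j. (U j, V j)) \<longlonglongrightarrow> (X, Y)" by (rule tendsto_Pair)
  then have "(X, Y) \<in> closure A" unfolding closure_sequential
    using UV(1) by (intro exI[of _ "\<lambda>j. (U j, V j)"]) simp
  then show "p \<in> (\<lambda>(X, Y). (tc_op X, tc_op Y)) ` closure A" by (force simp: p(1) XY)
next
  fix p assume "p \<in> (\<lambda>(X, Y). (tc_op X, tc_op Y)) ` closure A"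
  then obtain X Y where p: "p = (tc_op X, tc_op Y)" "(X, Y) \<in> closure A" by auto
  then obtain q where q: "\<And>j. q j \<in> A" "q \<longlonglongrightarrow> (X, Y)" unfolding closure_sequential by blast
  have "(\<lambda>j. dist (fst (q j)) X) \<longlonglongrightarrow> 0" "(\<lambda>j. dist (snd (q j)) Y) \<longlonglongrightarrow> 0"
    using tendsto_fst[OF q(2)] tendsto_snd[OF q(2)]
    by (simp_all only: fst_conv snd_conv tendsto_dist_iff[symmetric])
  then have "(\<lambda>j. trace_norm (tc_op (fst (q j)) - tc_op X)) \<longlonglongrightarrow> 0"
    "(\<lambda>j. trace_norm (tc_op (snd (q j)) - tc_op Y)) \<longlonglongrightarrow> 0"
    by (simp_all add: norm_sa_tc.rep_eq minus_sa_tc.rep_eq dist_norm)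
  moreover have "(tc_op (fst (q j)), tc_op (snd (q j))) \<in> (\<lambda>(X, Y). (tc_op X, tc_op Y)) ` A" for j
    using q(1)[of j] by (metis (no_types, lifting) case_prod_conv imageI prod.collapse)
  ultimately show "p \<in> graph_closure sa_trace_class trace_norm ((\<lambda>(X, Y). (tc_op X, tc_op Y)) ` A)"
    unfolding graph_closure_def p(1)
    by (clarsimp simp: tc_op)
      (rule exI[of _ "\<lambda>j. tc_op (fst (q j))"], rule exI[of _ "\<lambda>j. tc_op (snd (q j))"], simp)
qed

theorem theorem2p7:
  fixes E \<epsilon> \<eta> \<sigma>p \<sigma>m :: real and n :: "'n::finite"
  assumes "E > 0" and "\<epsilon> > 0" and "\<eta> > 0" and "\<eta>\<^sup>2 \<le> E * \<epsilon>"
    and "0 \<le> \<sigma>p" and "\<sigma>p < \<sigma>m"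
  shows "\<exists>T. contraction_semigroup sa_trace_class trace_norm T \<and>
             trace_preserving sa_trace_class T \<and>
             generator sa_trace_class trace_norm T =
               graph_closure sa_trace_class trace_norm (L_sa_graph E \<epsilon> \<eta> \<sigma>p \<sigma>m n)"
proof -
  interpret boson_model E \<epsilon> \<eta> \<sigma>p \<sigma>m n by unfold_locales (use assms in auto)
  interpret D: dissipative_relation "closure graph" "max \<sigma>m (15 * \<sigma>p)"
    by (rule dissipative_relation_graph)
  define T where "T t A = tc_op (D.T t (Abs_tc A))" for t A
  have rep: "tc_op (Abs_tc A) = A" if "A \<in> sa_trace_class" for A :: "('n option \<Rightarrow> nat) op"
    using that by (rule Abs_tc_inverse)
  have abs: "Abs_tc (tc_op X) = X" for X :: "('n option \<Rightarrow> nat) sa_tc" by (rule tc_op_inverse)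
  have ex: "\<exists>X. A = tc_op X" if "A \<in> sa_trace_class" for A :: "('n option \<Rightarrow> nat) op"
    using rep[OF that] by metis
  have T: "T t (tc_op X) = tc_op (D.T t X)" for t X by (simp add: T_def abs)
  note rep_eq = plus_sa_tc.rep_eq[symmetric] minus_sa_tc.rep_eq[symmetric] scaleR_sa_tc.rep_eq[symmetric]
    norm_sa_tc.rep_eq[symmetric]
  show ?thesis
  proof (intro exI conjI)
    show "contraction_semigroup sa_trace_class trace_norm T"
      unfolding contraction_semigroup_def
      by (auto dest!: ex simp: T tc_op rep_eq D.T_add D.T_scaleR D.T_zero D.T_semigroup D.norm_T D.T_continuous)
    show "trace_preserving sa_trace_class T"
      unfolding trace_preserving_def
    proof (intro allI impI ballI)
      fix t :: real and \<rho> :: "('n option \<Rightarrow> nat) op" assume t: "0 \<le> t" and "\<rho> \<in> sa_trace_class"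
      then obtain X where X: "\<rho> = tc_op X" using ex by blast
      have "tr (D.T t X) = tr X" by (rule D.T_invariant[OF bounded_linear_tr tr_graph t])
      then show "op_trace (T t \<rho>) = op_trace \<rho>"
        unfolding X T op_trace_sa[OF tc_op] tr_def by simp
    qed
    show "generator sa_trace_class trace_norm T
        = graph_closure sa_trace_class trace_norm (L_sa_graph E \<epsilon> \<eta> \<sigma>p \<sigma>m n)"
      unfolding L_sa_graph_eq graph_closure_tc
    proof (intro set_eqI iffI)
      fix p assume "p \<in> generator sa_trace_class trace_norm T"
      then obtain X Y where p: "p = (tc_op X, tc_op Y)"
        and lim: "((\<lambda>t. trace_norm ((1 / t) *\<^sub>R (T t (tc_op X) - tc_op X) - tc_op Y)) \<longlongrightarrow> 0) (at_right 0)"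
        unfolding generator_def using ex by blast
      then have "(X, Y) \<in> closure graph" by (simp add: T rep_eq D.generator_T)
      then show "p \<in> (\<lambda>(X, Y). (tc_op X, tc_op Y)) ` closure graph" by (force simp: p)
    next
      fix p assume "p \<in> (\<lambda>(X, Y). (tc_op X, tc_op Y)) ` closure graph"
      then obtain X Y where p: "p = (tc_op X, tc_op Y)" "(X, Y) \<in> closure graph" by auto
      then have "((\<lambda>t. trace_norm ((1 / t) *\<^sub>R (T t (tc_op X) - tc_op X) - tc_op Y)) \<longlongrightarrow> 0) (at_right 0)"
        by (simp add: T rep_eq D.generator_T)
      then show "p \<in> generator sa_trace_class trace_norm T"
        unfolding generator_def p(1) using tc_op by blast
    qed
  qed
qed

end
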